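(* Let $M^m$ be an $m$-manifold, let $f:M^m\to\mathbb{R}^{m+1}$ be a wave front, and let $\Sigma_f$ be its singular set. Let $U\subset M^m$ be an open subset such that $U\cap\Sigma_f$ consists only of $A_2$-singular points. Let $K$ denote the sectional curvature of the metric induced by $f$ on $U\setminus\Sigma_f$. Then the following hold: (1) If $K$ is bounded on $U\setminus\Sigma_f$, then the second fundamental form of $f$ vanishes along $\Sigma_f\cap U$, that is, $\mathit{II}(X,Y)=0$ for all $q\in\Sigma_f\cap U$ and $X,Y\in T_qM^m$. (2) If $K$ is non-negative on $U\setminus\Sigma_f$, then $K$ is bounded on $U\setminus\Sigma_f$, and the singular principal curvatures of $f$ along $U\cap\Sigma_f$ are all non-positive.
   Context: Everything is $C^\infty$. A map $f:M^m\to\mathbb{R}^{m+1}$ is a (wave) front if each $p\in M^m$ has a neighbourhood $W$ with a smooth unit normal field $\nu:W\to S^m$, $\langle df(X),\nu\rangle=0$ for all $X\in TW$, such that $(f,\nu):W\to\mathbb{R}^{m+1}\times S^m$ is an immersion. The singular set $\Sigma_f$ is the set of points where $f$ is not an immersion. The second fundamental form is $\mathit{II}(X,Y)=-\langle df(X),d\nu(Y)\rangle$ (defined up to the sign of $\nu$; symmetric on all of $M^m$). The sectional curvature is regarded as a function on the 2-planes tangent to $M^m\setminus\Sigma_f$. Let $\mathcal{E}_f$ be the rank $m$ bundle with fibre $\nu(p)^\perp\subset\mathbb{R}^{m+1}$, with the induced inner product and the metric connection $D$ (tangential part of the flat connection of $\mathbb{R}^{m+1}$), and let $\varphi=df:TM^m\to\mathcal{E}_f$.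 Work locally, with local orientations of $M^m$ and $\mathcal{E}_f$. Let $\mu$ be the section of $\det\mathcal{E}_f^*$ equal to $1$ on positive orthonormal frames, and, in positively oriented local coordinates $(u_1,\dots,u_m)$, put $\lambda=\mu(\varphi(\partial_{u_1}),\dots,\varphi(\partial_{u_m}))$. Then $\Sigma_f=\{\lambda=0\}$ locally. A point $p\in\Sigma_f$ is non-degenerate if $d\lambda(p)\ne0$; then near $p$ the set $\Sigma_f$ is a hypersurface of $M^m$ and $\ker\varphi$ is one-dimensional along it, spanned by a nowhere vanishing null vector field $\eta$. A non-degenerate singular point $p$ is an $A_2$-singular point if $\eta(p)$ is transversal to $\Sigma_f$. Near an $A_2$-point, $\varphi$ is injective on $T\Sigma_f$, so $ds^2=\varphi^*\langle\ ,\ \rangle$ is a Riemannian metric on $\Sigma_f$. Let $e_1,\dots,e_{m-1}$ be a local orthonormal frame of $T\Sigma_f$, let $\boldsymbol{n}$ be the section of $\mathcal{E}_f$ along $\Sigma_f$ such that $(\varphi(e_1),\dots,\varphi(e_{m-1}),\boldsymbol{n})$ is a positive orthonormal frame, and choose $\eta$ so that $(e_1,\dots,e_{m-1},\eta)$ is positively oriented in $M^m$. The singular shape operator is $$S(X)=-\operatorname{sgn}\bigl(d\lambda(\eta)\bigr)\,(\varphi|_{T\Sigma_f})^{-1}(D_X\boldsymbol{n}),\qquad X\in T\Sigma_f.$$ It is a $ds^2$-symmetric endomorphism of $T\Sigma_f$ independent of the choices made. Its eigenvalues are the singular principal curvatures of $f$.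
   Formalization: In (2), "K is bounded on U∖Σ_f" is proved as: K is bounded on C∖Σ_f for every compact C⊂U. Global boundedness fails, e.g. for the graph z=r^{3/2} over the punctured disc, where Σ_f is empty and K>0 is unbounded. *)

theory Defs
  imports "HOL-Analysis.Analysis"
begin

section \<open>Smooth manifolds\<close>

fun Ck_on :: "nat \<Rightarrow> 'a::euclidean_space set \<Rightarrow> ('a \<Rightarrow> 'b::real_normed_vector) \<Rightarrow> bool" where
  "Ck_on 0 S h \<longleftrightarrow> continuous_on S h"
| "Ck_on (Suc k) S h \<longleftrightarrow> (\<forall>x\<in>S. h differentiable (at x)) \<and>
     (\<forall>v. Ck_on k S (\<lambda>x. frechet_derivative h (at x) v))"

text \<open>To be used on open sets \<open>S\<close> only.\<close>

definition smooth_on :: "'a::euclidean_space set \<Rightarrow> ('a \<Rightarrow> 'b::real_normed_vector) \<Rightarrow> bool" where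
  "smooth_on S h \<longleftrightarrow> (\<forall>k. Ck_on k S h)"

text \<open>A chart is a pair of its domain and its coordinate map.\<close>

type_synonym ('a, 'm) chart = "'a set \<times> ('a \<Rightarrow> real ^ 'm)"

definition local_rep :: "('a, 'm::finite) chart \<Rightarrow> ('a \<Rightarrow> 'b) \<Rightarrow> real ^ 'm \<Rightarrow> 'b" where
  "local_rep \<kappa> h = h \<circ> inv_into (fst \<kappa>) (snd \<kappa>)"

definition smooth_atlas :: "('a::topological_space, 'm::finite) chart set \<Rightarrow> bool" where
  "smooth_atlas \<A> \<longleftrightarrow>
     (\<forall>\<kappa>\<in>\<A>. open (fst \<kappa>) \<and> open (snd \<kappa> ` fst \<kappa>) \<and>
        homeomorphism (fst \<kappa>) (snd \<kappa> ` fst \<kappa>) (snd \<kappa>) (inv_into (fst \<kappa>) (snd \<kappa>))) \<and>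
     (\<forall>\<kappa>\<in>\<A>. \<forall>\<kappa>'\<in>\<A>. smooth_on (snd \<kappa> ` (fst \<kappa> \<inter> fst \<kappa>')) (local_rep \<kappa> (snd \<kappa>')))"

definition manifold :: "('a, 'm::finite) chart set \<Rightarrow> 'a set" where
  "manifold \<A> = (\<Union>\<kappa>\<in>\<A>. fst \<kappa>)"

definition smooth_map ::
  "('a, 'm::finite) chart set \<Rightarrow> 'a set \<Rightarrow> ('a \<Rightarrow> 'b::real_normed_vector) \<Rightarrow> bool" where
  "smooth_map \<A> W h \<longleftrightarrow> (\<forall>\<kappa>\<in>\<A>. smooth_on (snd \<kappa> ` (W \<inter> fst \<kappa>)) (local_rep \<kappa> h))"

text \<open>
  Once a chart \<open>\<kappa>\<close> around \<open>q\<close> is given, tangent vectors at \<open>q\<close> are represented by their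
  components in \<open>\<kappa>\<close>; so the tangent space at \<open>q\<close> is all of \<open>real ^ 'm\<close>, and the coordinate
  vector fields are \<open>axis i 1\<close>.
\<close>

definition tangent_map ::
  "('a, 'm::finite) chart \<Rightarrow> ('a \<Rightarrow> 'b::real_normed_vector) \<Rightarrow> 'a \<Rightarrow> real ^ 'm \<Rightarrow> 'b" where
  "tangent_map \<kappa> h q = frechet_derivative (local_rep \<kappa> h) (at (snd \<kappa> q))"

definition immersion_at ::
  "('a, 'm::finite) chart set \<Rightarrow> ('a \<Rightarrow> 'b::real_normed_vector) \<Rightarrow> 'a \<Rightarrow> bool" where
  "immersion_at \<A> h q \<longleftrightarrow> (\<forall>\<kappa>\<in>\<A>. q \<in> fst \<kappa> \<longrightarrow> inj (tangent_map \<kappa> h q))"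

text \<open>
  Velocities at \<open>q\<close> of curves that lie in \<open>S\<close>. This is used where \<open>S\<close> is a hypersurface, and
  then it is the usual tangent space of \<open>S\<close>.
\<close>

definition tangent_space :: "('a, 'm::finite) chart \<Rightarrow> 'a set \<Rightarrow> 'a \<Rightarrow> (real ^ 'm) set" where
  "tangent_space \<kappa> S q = {X. \<exists>\<gamma>. \<gamma> 0 = snd \<kappa> q \<and> (\<gamma> has_vector_derivative X) (at (0::real)) \<and>
     (\<forall>\<^sub>F t in at 0. \<gamma> t \<in> snd \<kappa> ` (S \<inter> fst \<kappa>))}"


section \<open>Sectional curvature of a Riemannian metric on an open subset of a coordinate space\<close>

definition christoffel :: "(real ^ 'm \<Rightarrow> real ^ 'm \<Rightarrow> real ^ 'm \<Rightarrow> real) \<Rightarrow>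
    real ^ 'm \<Rightarrow> real ^ 'm \<Rightarrow> real ^ 'm \<Rightarrow> real ^ 'm::finite" where
  "christoffel g x u v =
     matrix_inv (\<chi> i j. g x (axis i 1) (axis j 1)) *v
     (\<chi> l. (frechet_derivative (\<lambda>y. g y v (axis l 1)) (at x) u
          + frechet_derivative (\<lambda>y. g y u (axis l 1)) (at x) v
          - frechet_derivative (\<lambda>y. g y u v) (at x) (axis l 1)) / 2)"

text \<open>
  The curvature tensor \<open>R(u,v)w = \<nabla>\<^sub>u\<nabla>\<^sub>v w - \<nabla>\<^sub>v\<nabla>\<^sub>u w\<close> of the Levi-Civita connection, for
  vector fields \<open>u\<close>, \<open>v\<close>, \<open>w\<close> with constant components.
\<close>

definition riemann :: "(real ^ 'm \<Rightarrow> real ^ 'm \<Rightarrow> real ^ 'm \<Rightarrow> real) \<Rightarrow>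
    real ^ 'm \<Rightarrow> real ^ 'm \<Rightarrow> real ^ 'm \<Rightarrow> real ^ 'm \<Rightarrow> real ^ 'm::finite" where
  "riemann g x u v w =
       frechet_derivative (\<lambda>y. christoffel g y v w) (at x) u
     - frechet_derivative (\<lambda>y. christoffel g y u w) (at x) v
     + christoffel g x u (christoffel g x v w)
     - christoffel g x v (christoffel g x u w)"

definition sectional_curvature :: "(real ^ 'm \<Rightarrow> real ^ 'm \<Rightarrow> real ^ 'm \<Rightarrow> real) \<Rightarrow>
    real ^ 'm \<Rightarrow> real ^ 'm \<Rightarrow> real ^ 'm::finite \<Rightarrow> real" where
  "sectional_curvature g x u v =
     g x (riemann g x u v v) u / (g x u u * g x v v - (g x u v)\<^sup>2)"

definition induced_metric :: "('a, 'm::finite) chart \<Rightarrow> ('a \<Rightarrow> 'e::euclidean_space) \<Rightarrow>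
    real ^ 'm \<Rightarrow> real ^ 'm \<Rightarrow> real ^ 'm \<Rightarrow> real" where
  "induced_metric \<kappa> f x u v =
     frechet_derivative (local_rep \<kappa> f) (at x) u \<bullet> frechet_derivative (local_rep \<kappa> f) (at x) v"

text \<open>
  The set of values, on all 2-planes tangent at points of \<open>V\<close>, of the sectional curvature of the
  metric induced by \<open>f\<close>; a 2-plane is given by a basis. \<open>V\<close> must not meet the singular set.
\<close>

definition curvature_values ::
  "('a, 'm::finite) chart set \<Rightarrow> ('a \<Rightarrow> 'e::euclidean_space) \<Rightarrow> 'a set \<Rightarrow> real set" where
  "curvature_values \<A> f V =
     {sectional_curvature (induced_metric \<kappa> f) (snd \<kappa> q) X Y | \<kappa> q X Y.
        \<kappa> \<in> \<A> \<and> q \<in> V \<inter> fst \<kappa> \<and> X \<noteq> Y \<and> independent {X, Y}}"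


section \<open>Wave fronts\<close>

text \<open>
  For an \<open>m\<close>-manifold, charts have values in \<open>real ^ 'm\<close> with \<open>m = CARD('m)\<close>. The ambient space
  of dimension \<open>m + 1\<close> is \<open>real ^ ('m option)\<close>.
\<close>

definition front_normal :: "('a::topological_space, 'm::finite) chart set \<Rightarrow>
    ('a \<Rightarrow> real ^ ('m option)) \<Rightarrow> 'a set \<Rightarrow> ('a \<Rightarrow> real ^ ('m option)) \<Rightarrow> bool" where
  "front_normal \<A> f W \<nu> \<longleftrightarrow> open W \<and> W \<subseteq> manifold \<A> \<and> smooth_map \<A> W \<nu> \<and>
     (\<forall>q\<in>W. norm (\<nu> q) = 1) \<and>
     (\<forall>\<kappa>\<in>\<A>. \<forall>q\<in>W \<inter> fst \<kappa>. \<forall>X. tangent_map \<kappa> f q X \<bullet> \<nu> q = 0) \<and>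
     (\<forall>q\<in>W. immersion_at \<A> (\<lambda>p. (f p, \<nu> p)) q)"

definition wave_front :: "('a::topological_space, 'm::finite) chart set \<Rightarrow>
    ('a \<Rightarrow> real ^ ('m option)) \<Rightarrow> bool" where
  "wave_front \<A> f \<longleftrightarrow> smooth_map \<A> (manifold \<A>) f \<and>
     (\<forall>p\<in>manifold \<A>. \<exists>W \<nu>. p \<in> W \<and> front_normal \<A> f W \<nu>)"

definition singular_set ::
  "('a, 'm::finite) chart set \<Rightarrow> ('a \<Rightarrow> real ^ ('m option)) \<Rightarrow> 'a set" where
  "singular_set \<A> f = {q \<in> manifold \<A>. \<not> immersion_at \<A> f q}"

definition second_form :: "('a, 'm::finite) chart \<Rightarrow> ('a \<Rightarrow> real ^ ('m option)) \<Rightarrow>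
    ('a \<Rightarrow> real ^ ('m option)) \<Rightarrow> 'a \<Rightarrow> real ^ 'm \<Rightarrow> real ^ 'm \<Rightarrow> real" where
  "second_form \<kappa> f \<nu> q X Y = - (tangent_map \<kappa> f q X \<bullet> tangent_map \<kappa> \<nu> q Y)"

text \<open>
  The volume form of the bundle with fibres \<open>\<nu>(q)\<^sup>\<bottom>\<close>, as \<open>\<mu>(v) = det(v, \<nu>)\<close>. It takes
  the values 1 and -1 on orthonormal frames, and an orthonormal frame counts as positive if the
  value is 1. Thus \<open>\<nu>\<close> determines the local orientation of the bundle (replacing \<open>\<nu>\<close> by
  \<open>- \<nu>\<close> gives the other one), and a chart determines the local orientation of the manifold.
\<close>

definition volume_form ::
  "('a \<Rightarrow> real ^ ('m::finite option)) \<Rightarrow> 'a \<Rightarrow> ('m \<Rightarrow> real ^ ('m option)) \<Rightarrow> real" where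
  "volume_form \<nu> q v = det (\<chi> i. case i of Some j \<Rightarrow> v j | None \<Rightarrow> \<nu> q)"

definition signed_density :: "('a, 'm::finite) chart \<Rightarrow> ('a \<Rightarrow> real ^ ('m option)) \<Rightarrow>
    ('a \<Rightarrow> real ^ ('m option)) \<Rightarrow> 'a \<Rightarrow> real" where
  "signed_density \<kappa> f \<nu> q = volume_form \<nu> q (\<lambda>i. tangent_map \<kappa> f q (axis i 1))"

definition null_vector ::
  "('a, 'm::finite) chart \<Rightarrow> ('a \<Rightarrow> real ^ ('m option)) \<Rightarrow> 'a \<Rightarrow> real ^ 'm \<Rightarrow> bool" where
  "null_vector \<kappa> f q X \<longleftrightarrow> X \<noteq> 0 \<and> tangent_map \<kappa> f q X = 0"

definition nondegenerate :: "('a, 'm::finite) chart \<Rightarrow> ('a \<Rightarrow> real ^ ('m option)) \<Rightarrow>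
    ('a \<Rightarrow> real ^ ('m option)) \<Rightarrow> 'a \<Rightarrow> bool" where
  "nondegenerate \<kappa> f \<nu> q \<longleftrightarrow> (\<exists>X. tangent_map \<kappa> (signed_density \<kappa> f \<nu>) q X \<noteq> 0)"

definition A2_singular_point :: "('a::topological_space, 'm::finite) chart set \<Rightarrow>
    ('a \<Rightarrow> real ^ ('m option)) \<Rightarrow> 'a \<Rightarrow> bool" where
  "A2_singular_point \<A> f q \<longleftrightarrow> q \<in> singular_set \<A> f \<and>
     (\<exists>\<kappa>\<in>\<A>. \<exists>W \<nu>. q \<in> W \<inter> fst \<kappa> \<and> front_normal \<A> f W \<nu> \<and> nondegenerate \<kappa> f \<nu> q \<and>
        (\<exists>\<eta>. null_vector \<kappa> f q \<eta> \<and> \<eta> \<notin> tangent_space \<kappa> (singular_set \<A> f) q))"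


section \<open>Singular principal curvatures\<close>

text \<open>
  Covariant derivative of a section \<open>s\<close> of the bundle with fibres \<open>\<nu>(q)\<^sup>\<bottom>\<close>: the tangential part
  of the derivative in the ambient space.
\<close>

definition cov_deriv :: "('a, 'm::finite) chart \<Rightarrow> ('a \<Rightarrow> real ^ ('m option)) \<Rightarrow>
    ('a \<Rightarrow> real ^ ('m option)) \<Rightarrow> 'a \<Rightarrow> real ^ 'm \<Rightarrow> real ^ ('m option)" where
  "cov_deriv \<kappa> \<nu> s q X = tangent_map \<kappa> s q X - (tangent_map \<kappa> s q X \<bullet> \<nu> q) *\<^sub>R \<nu> q"

text \<open>
  The data \<open>e\<close>, \<open>\<eta>\<close>, \<open>n\<close> along the singular set \<open>S\<close>, with \<open>\<eta>\<close> a null vector field. The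
  \<open>m - 1\<close> vector fields of the frame \<open>e\<close> of \<open>S\<close> are indexed by the elements of \<open>'m\<close> other
  than a chosen \<open>k\<close>, and \<open>\<eta>\<close> and \<open>n\<close> are both put at position \<open>k\<close> (instead of the last
  one). Which \<open>k\<close> is chosen does not matter: moving \<open>\<eta>\<close> and \<open>n\<close> to another position changes
  the signs of both orientations in the same way. Smooth fields along the hypersurface \<open>S\<close> are
  given as restrictions to \<open>S\<close> of smooth maps on the open set \<open>W\<close>; all conditions other than
  smoothness are only imposed at points of \<open>S\<close>.
\<close>

definition adapted_frame :: "('a::topological_space, 'm::finite) chart set \<Rightarrow> ('a, 'm) chart \<Rightarrow>
    ('a \<Rightarrow> real ^ ('m option)) \<Rightarrow> 'a set \<Rightarrow> ('a \<Rightarrow> real ^ ('m option)) \<Rightarrow> 'm \<Rightarrow>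
    ('m \<Rightarrow> 'a \<Rightarrow> real ^ 'm) \<Rightarrow> ('a \<Rightarrow> real ^ 'm) \<Rightarrow> ('a \<Rightarrow> real ^ ('m option)) \<Rightarrow> bool" where
  "adapted_frame \<A> \<kappa> f W \<nu> k e \<eta> n \<longleftrightarrow>
     (\<forall>i. i \<noteq> k \<longrightarrow> smooth_map \<A> W (e i)) \<and> smooth_map \<A> W \<eta> \<and> smooth_map \<A> W n \<and>
     (\<forall>p\<in>W \<inter> singular_set \<A> f.
        (\<forall>i. i \<noteq> k \<longrightarrow> e i p \<in> tangent_space \<kappa> (singular_set \<A> f) p) \<and>
        null_vector \<kappa> f p (\<eta> p) \<and>
        det (\<chi> i. if i = k then \<eta> p else e i p) > 0 \<and>
        (let v = (\<lambda>i. if i = k then n p else tangent_map \<kappa> f p (e i p)) in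
           (\<forall>i. v i \<bullet> \<nu> p = 0) \<and>
           (\<forall>i j. v i \<bullet> v j = (if i = j then 1 else 0)) \<and>
           volume_form \<nu> p v = 1))"

definition singular_shape_operator :: "('a, 'm::finite) chart set \<Rightarrow> ('a, 'm) chart \<Rightarrow>
    ('a \<Rightarrow> real ^ ('m option)) \<Rightarrow> ('a \<Rightarrow> real ^ ('m option)) \<Rightarrow> ('a \<Rightarrow> real ^ 'm) \<Rightarrow>
    ('a \<Rightarrow> real ^ ('m option)) \<Rightarrow> 'a \<Rightarrow> real ^ 'm \<Rightarrow> real ^ 'm" where
  "singular_shape_operator \<A> \<kappa> f \<nu> \<eta> n q X =
     - sgn (tangent_map \<kappa> (signed_density \<kappa> f \<nu>) q (\<eta> q)) *\<^sub>R
       inv_into (tangent_space \<kappa> (singular_set \<A> f) q) (tangent_map \<kappa> f q) (cov_deriv \<kappa> \<nu> n q X)"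

definition singular_principal_curvature :: "('a::topological_space, 'm::finite) chart set \<Rightarrow>
    ('a \<Rightarrow> real ^ ('m option)) \<Rightarrow> 'a \<Rightarrow> real \<Rightarrow> bool" where
  "singular_principal_curvature \<A> f q c \<longleftrightarrow>
     (\<exists>\<kappa>\<in>\<A>. \<exists>W \<nu> k e \<eta> n. q \<in> W \<and> W \<subseteq> fst \<kappa> \<and> front_normal \<A> f W \<nu> \<and>
        adapted_frame \<A> \<kappa> f W \<nu> k e \<eta> n \<and>
        (\<exists>X\<in>tangent_space \<kappa> (singular_set \<A> f) q. X \<noteq> 0 \<and>
           singular_shape_operator \<A> \<kappa> f \<nu> \<eta> n q X = c *\<^sub>R X))"

end

theory Submission
  imports Defs
begin

text \<open>
  Near an \<open>A\<^sub>2\<close>-point \<open>q\<close> the front folds along the null direction \<open>\<eta>\<close>: the differential \<open>df\<close> kills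
  \<open>\<eta>\<close>, but the second derivative \<open>w\<close> of \<open>f\<close> along \<open>\<eta>\<close> leaves the image of \<open>df\<close>. Where \<open>f\<close> is an
  immersion, the Gauss equation (\<open>gauss_equation\<close>) says that
  \<open>K(X,Y) = (II(X,X) II(Y,Y) - II(X,Y)\<^sup>2) / (|X|\<^sup>2 |Y|\<^sup>2 - \<langle>X,Y\<rangle>\<^sup>2)\<close>. Apply it in a chart on the ray
  \<open>q + t\<eta>\<close>, to the planes spanned by \<open>\<eta>\<close> and a constant vector \<open>X\<close> with \<open>df\<^sub>q(X) \<noteq> 0\<close>. As \<open>df(\<eta>) = tw + o(t)\<close>,
  the denominator is \<open>b t\<^sup>2 + o(t\<^sup>2)\<close> with \<open>b > 0\<close>, and \<open>II(\<eta>,\<eta>) = -t \<langle>w, d\<nu>(\<eta>)\<rangle> + o(t)\<close>, while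
  \<open>II(X,\<eta>) = O(t)\<close>. The coefficient \<open>\<langle>w, d\<nu>(\<eta>)\<rangle>\<close> is not zero because \<open>(f,\<nu>)\<close> is an immersion
  (\<open>fold_normal_deriv\<close>). So \<open>t K(X,\<eta>)\<close> converges to a nonzero multiple of \<open>II\<^sub>q(X,X)\<close>
  (\<open>fold_curvature_limit\<close>). If \<open>K\<close> is bounded, this limit is zero; if \<open>K\<close> is non-negative, the limit is
  non-negative from \<open>t > 0\<close> and non-positive from \<open>t < 0\<close>, so it is zero again. If \<open>df\<^sub>q(X) = 0\<close>, then \<open>II\<^sub>q(X,X) = 0\<close> anyway.
  Polarization gives \<open>II\<^sub>q = 0\<close>.

  Now let \<open>K\<close> be non-negative, and let \<open>\<lambda>\<close> be the signed density. As \<open>II\<close> vanishes on the hypersurface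
  \<open>\<lambda> = 0\<close>, it is \<open>O(\<lambda>)\<close> near it (\<open>bounded_by_defining_function\<close>), so the numerator is \<open>O(\<lambda>\<^sup>2)\<close>. By
  Cramer's rule \<open>df\<close> shrinks lengths at most by a constant times \<open>|\<lambda>|\<close>, and orthogonally to \<open>\<eta>\<close> it
  does not shrink them by more than a constant; hence the denominator is at least a constant times
  \<open>\<lambda>\<^sup>2\<close> for orthonormal vectors (\<open>curvature_estimate\<close>). This bounds \<open>K\<close> near every point of \<open>U\<close>, so
  on compact subsets, which is how boundedness is meant in the second part; towards the boundary of \<open>U\<close>
  the curvature may still grow.

  For the sign, the numerator on the ray is now \<open>t\<^sup>2 (B(X,X) B(\<eta>,\<eta>) - B(X,\<eta>)\<^sup>2) + o(t\<^sup>2)\<close>, where \<open>B\<close> is the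
  derivative of \<open>II\<close> along \<open>\<eta>\<close>. So \<open>B(X,X) B(\<eta>,\<eta>)\<close> is non-negative. Along the singular set
  \<open>d\<nu>(\<eta>) = b n\<close> with \<open>b \<noteq> 0\<close>, and differentiating this in the direction of a tangent vector \<open>X\<close> of the singular
  set gives \<open>B(X,X) = -b \<langle>D\<^sub>X n, df(X)\<rangle>\<close>, whereas \<open>B(\<eta>,\<eta>) = -b \<langle>w, n\<rangle>\<close> (\<open>weingarten_identity\<close>). Hence
  \<open>\<langle>D\<^sub>X n, df(X)\<rangle> \<langle>w, n\<rangle>\<close> is non-negative. Since \<open>\<langle>w, n\<rangle>\<close> has the sign of \<open>d\<lambda>(\<eta>)\<close>, every eigenvalue of
  the singular shape operator is non-positive (\<open>principal_curvature_nonpos\<close>).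

  All limits are taken along straight lines in one chart, so the singular hypersurface is never
  straightened. A change of chart enters only through its first derivative.
\<close>

abbreviation dir_deriv :: "('a::real_normed_vector \<Rightarrow> 'b::real_normed_vector) \<Rightarrow> 'a \<Rightarrow> 'a \<Rightarrow> 'b" (\<open>\<partial>\<close>)
  where "\<partial> F x v \<equiv> frechet_derivative F (at x) v"

section \<open>Calculus of smooth maps\<close>

lemma dir_deriv_works:
  "F differentiable (at x) \<Longrightarrow> (F has_derivative (\<lambda>v. \<partial> F x v)) (at x)"
  using frechet_derivative_works by blast

lemma dir_deriv_eq: "(F has_derivative F') (at x) \<Longrightarrow> \<partial> F x v = F' v"
  using frechet_derivative_at by metis

lemma Ck_on_cong:
  assumes "open S" "\<And>x. x \<in> S \<Longrightarrow> f x = g x" "Ck_on k S f"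
  shows "Ck_on k S g"
  using assms(2,3)
proof (induction k arbitrary: f g)
  case 0
  then show ?case by (simp cong: continuous_on_cong)
next
  case (Suc k)
  have der: "(g has_derivative (\<lambda>v. \<partial> f x v)) (at x)" if "x \<in> S" for x
  proof -
    have "(f has_derivative (\<lambda>v. \<partial> f x v)) (at x)"
      using Suc.prems that by (intro dir_deriv_works) auto
    then show ?thesis
      by (rule has_derivative_transform_within_open[OF _ \<open>open S\<close> that]) (use Suc.prems in auto)
  qed
  have "Ck_on k S (\<lambda>x. \<partial> g x v)" for v
    by (rule Suc.IH[of "\<lambda>x. \<partial> f x v"]) (use Suc.prems dir_deriv_eq[OF der] in auto)
  then show ?case using der by (auto simp: differentiable_def)
qed

lemma Ck_on_bounded_linear:
  assumes "open S" "bounded_linear L" "Ck_on k S f"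
  shows "Ck_on k S (\<lambda>x. L (f x))"
  using assms(3)
proof (induction k arbitrary: f)
  case 0
  then show ?case
    using bounded_linear.continuous_on[OF assms(2)] by auto
next
  case (Suc k)
  have der: "((\<lambda>x. L (f x)) has_derivative (\<lambda>v. L (\<partial> f x v))) (at x)" if "x \<in> S" for x
    using Suc.prems that
    by (intro bounded_linear.has_derivative[OF assms(2)] dir_deriv_works) auto
  have "Ck_on k S (\<lambda>x. \<partial> (\<lambda>x. L (f x)) x v)" for v
    by (rule Ck_on_cong[OF \<open>open S\<close> _ Suc.IH[of "\<lambda>x. \<partial> f x v"]])
      (use Suc.prems dir_deriv_eq[OF der] in auto)
  then show ?case using der by (auto simp: differentiable_def)
qed

lemma Ck_on_add:
  assumes "open S" "Ck_on k S f" "Ck_on k S g"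
  shows "Ck_on k S (\<lambda>x. f x + g x)"
  using assms(2,3)
proof (induction k arbitrary: f g)
  case 0
  then show ?case by (auto intro: continuous_intros)
next
  case (Suc k)
  have der: "((\<lambda>x. f x + g x) has_derivative (\<lambda>v. \<partial> f x v + \<partial> g x v)) (at x)" if "x \<in> S" for x
    using Suc.prems that by (intro has_derivative_add dir_deriv_works) auto
  have "Ck_on k S (\<lambda>x. \<partial> (\<lambda>x. f x + g x) x v)" for v
    by (rule Ck_on_cong[OF \<open>open S\<close> _ Suc.IH[of "\<lambda>x. \<partial> f x v" "\<lambda>x. \<partial> g x v"]])
      (use Suc.prems dir_deriv_eq[OF der] in auto)
  then show ?case using der by (auto simp: differentiable_def)
qed

lemma Ck_on_SucD:
  "Ck_on (Suc k) S f \<Longrightarrow> Ck_on k S f"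
proof (induction k arbitrary: f)
  case 0
  then show ?case
    by (metis Ck_on.simps differentiable_at_imp_differentiable_on differentiable_imp_continuous_on)
next
  case (Suc k)
  have "Ck_on k S (\<lambda>x. \<partial> f x v)" for v
    using Suc.IH[of "\<lambda>x. \<partial> f x v"] Suc.prems by auto
  then show ?case using Suc.prems by auto
qed

lemma Ck_on_bilinear:
  assumes "open S" "bounded_bilinear B" "Ck_on k S f" "Ck_on k S g"
  shows "Ck_on k S (\<lambda>x. B (f x) (g x))"
  using assms(3,4)
proof (induction k arbitrary: f g)
  case 0
  then show ?case by (auto intro: bounded_bilinear.continuous_on[OF assms(2)])
next
  case (Suc k)
  have der: "((\<lambda>x. B (f x) (g x)) has_derivative (\<lambda>v. B (f x) (\<partial> g x v) + B (\<partial> f x v) (g x))) (at x)"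
    if "x \<in> S" for x
    using Suc.prems that
    by (intro bounded_bilinear.FDERIV[OF assms(2)] dir_deriv_works) auto
  have "Ck_on k S (\<lambda>x. \<partial> (\<lambda>x. B (f x) (g x)) x v)" for v
  proof (rule Ck_on_cong[OF \<open>open S\<close>])
    show "Ck_on k S (\<lambda>x. B (f x) (\<partial> g x v) + B (\<partial> f x v) (g x))"
      using Ck_on_SucD[OF Suc.prems(1)] Ck_on_SucD[OF Suc.prems(2)] Suc.prems
      by (intro Ck_on_add \<open>open S\<close> Suc.IH) auto
  qed (use dir_deriv_eq[OF der] in auto)
  then show ?case using der by (auto simp: differentiable_def)
qed

lemma Ck_on_const: "Ck_on k S (\<lambda>x. c)"
  by (induction k arbitrary: c) auto

lemma Ck_on_subset: "Ck_on k S f \<Longrightarrow> T \<subseteq> S \<Longrightarrow> Ck_on k T f"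
  by (induction k arbitrary: f) (auto intro: continuous_on_subset)

lemma smooth_on_subset: "smooth_on S f \<Longrightarrow> T \<subseteq> S \<Longrightarrow> smooth_on T f"
  using Ck_on_subset unfolding smooth_on_def by blast

lemma smooth_on_bounded_linear:
  "open S \<Longrightarrow> bounded_linear L \<Longrightarrow> smooth_on S f \<Longrightarrow> smooth_on S (\<lambda>x. L (f x))"
  using Ck_on_bounded_linear unfolding smooth_on_def by blast

lemma smooth_on_bilinear:
  "open S \<Longrightarrow> bounded_bilinear B \<Longrightarrow> smooth_on S f \<Longrightarrow> smooth_on S g \<Longrightarrow> smooth_on S (\<lambda>x. B (f x) (g x))"
  using Ck_on_bilinear unfolding smooth_on_def by blast

lemmas smooth_on_inner = smooth_on_bilinear[OF _ bounded_bilinear_inner]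
lemmas smooth_on_mult = smooth_on_bilinear[OF _ bounded_bilinear_mult]

lemma smooth_on_add: "open S \<Longrightarrow> smooth_on S f \<Longrightarrow> smooth_on S g \<Longrightarrow> smooth_on S (\<lambda>x. f x + g x)"
  using Ck_on_add unfolding smooth_on_def by blast

lemma smooth_on_const: "smooth_on S (\<lambda>x. c)"
  using Ck_on_const unfolding smooth_on_def by blast

lemma smooth_on_sum:
  "open S \<Longrightarrow> (\<And>i. i \<in> I \<Longrightarrow> smooth_on S (f i)) \<Longrightarrow> smooth_on S (\<lambda>x. \<Sum>i\<in>I. f i x)"
  by (induction I rule: infinite_finite_induct) (auto intro: smooth_on_const smooth_on_add)

lemma smooth_on_prod:
  fixes f :: "'i \<Rightarrow> 'a::euclidean_space \<Rightarrow> real"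
  shows "open S \<Longrightarrow> (\<And>i. i \<in> I \<Longrightarrow> smooth_on S (f i)) \<Longrightarrow> smooth_on S (\<lambda>x. \<Prod>i\<in>I. f i x)"
  by (induction I rule: infinite_finite_induct) (auto intro: smooth_on_const smooth_on_mult)

lemma smooth_on_det:
  fixes A :: "'a::euclidean_space \<Rightarrow> real ^ 'n ^ 'n"
  assumes "open S" "\<And>i. smooth_on S (\<lambda>x. A x $ i)"
  shows "smooth_on S (\<lambda>x. det (A x))"
  unfolding det_def
  by (intro smooth_on_sum smooth_on_mult smooth_on_const smooth_on_prod
      smooth_on_bounded_linear[OF _ bounded_linear_vec_nth] assms)

lemma smooth_on_differentiable: "smooth_on S h \<Longrightarrow> x \<in> S \<Longrightarrow> h differentiable (at x)"
  unfolding smooth_on_def using Ck_on.simps(2) by blast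

lemma smooth_on_has_derivative:
  "smooth_on S h \<Longrightarrow> x \<in> S \<Longrightarrow> (h has_derivative (\<lambda>v. \<partial> h x v)) (at x)"
  by (intro dir_deriv_works smooth_on_differentiable)

lemma smooth_on_dir_deriv: "smooth_on S h \<Longrightarrow> smooth_on S (\<lambda>x. \<partial> h x v)"
  unfolding smooth_on_def using Ck_on.simps(2) by blast

lemma smooth_on_continuous: "smooth_on S h \<Longrightarrow> continuous_on S h"
  unfolding smooth_on_def using Ck_on.simps(1) by blast

lemma smooth_on_isCont: "smooth_on S h \<Longrightarrow> x \<in> S \<Longrightarrow> isCont h x"
  by (intro differentiable_imp_continuous_within smooth_on_differentiable)

lemma linear_dir_deriv: "h differentiable (at x) \<Longrightarrow> linear (\<lambda>v. \<partial> h x v)"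
  by (rule linear_frechet_derivative)

lemma dir_deriv_basis:
  fixes h :: "'a::euclidean_space \<Rightarrow> 'b::real_normed_vector"
  assumes "h differentiable (at x)"
  shows "\<partial> h x v = (\<Sum>b\<in>Basis. (v \<bullet> b) *\<^sub>R \<partial> h x b)"
proof -
  interpret linear "\<lambda>v. \<partial> h x v" by (rule linear_dir_deriv[OF assms])
  have "\<partial> h x (\<Sum>b\<in>Basis. (v \<bullet> b) *\<^sub>R b) = (\<Sum>b\<in>Basis. (v \<bullet> b) *\<^sub>R \<partial> h x b)"
    by (simp add: sum scaleR)
  then show ?thesis by (simp add: euclidean_representation)
qed

lemma tendsto_dir_deriv:
  fixes F :: "'a::euclidean_space \<Rightarrow> 'b::real_normed_vector"
  assumes "open S" "smooth_on S F" "x \<in> S" "(Y \<longlongrightarrow> x) G" "(V \<longlongrightarrow> v) G"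
  shows "((\<lambda>t. \<partial> F (Y t) (V t)) \<longlongrightarrow> \<partial> F x v) G"
proof -
  have "((\<lambda>t. \<partial> F (Y t) b) \<longlongrightarrow> \<partial> F x b) G" for b
    by (rule isCont_tendsto_compose[OF smooth_on_isCont[OF smooth_on_dir_deriv[OF assms(2)] assms(3)] assms(4)])
  then have "((\<lambda>t. \<Sum>b\<in>Basis. (V t \<bullet> b) *\<^sub>R \<partial> F (Y t) b) \<longlongrightarrow> (\<Sum>b\<in>Basis. (v \<bullet> b) *\<^sub>R \<partial> F x b)) G"
    by (intro tendsto_intros assms(5))
  moreover have "\<forall>\<^sub>F t in G. Y t \<in> S"
    using assms(1,3,4) topological_tendstoD by blast
  then have "\<forall>\<^sub>F t in G. (\<Sum>b\<in>Basis. (V t \<bullet> b) *\<^sub>R \<partial> F (Y t) b) = \<partial> F (Y t) (V t)"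
    by eventually_elim (metis dir_deriv_basis[OF smooth_on_differentiable[OF assms(2)]])
  ultimately show ?thesis
    using dir_deriv_basis[OF smooth_on_differentiable[OF assms(2,3)], of v]
    by (auto elim: Lim_transform_eventually)
qed

text \<open>
  The product rule for \<open>y \<mapsto> dF\<^sub>y(V(y))\<close>, where the direction varies with the point. Here \<open>V\<close> is given by
  Christoffel symbols, in the proof of the Gauss equation, or it is a null vector field along the singular set.
\<close>

lemma has_derivative_dir_deriv_field:
  fixes F :: "'a::euclidean_space \<Rightarrow> 'b::real_normed_vector"
  assumes "open S" "smooth_on S F" "x \<in> S" "(V has_derivative V') (at x)"
  shows "((\<lambda>y. \<partial> F y (V y)) has_derivative
    (\<lambda>u. \<partial> (\<lambda>y. \<partial> F y (V x)) x u + \<partial> F x (V' u))) (at x)"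
proof -
  have d2: "((\<lambda>y. \<partial> F y b) has_derivative (\<lambda>u. \<partial> (\<lambda>y. \<partial> F y b) x u)) (at x)" for b
    by (rule smooth_on_has_derivative[OF smooth_on_dir_deriv[OF assms(2)] assms(3)])
  have basis: "\<partial> F y v = (\<Sum>b\<in>Basis. (v \<bullet> b) *\<^sub>R \<partial> F y b)" if "y \<in> S" for y v
    by (rule dir_deriv_basis[OF smooth_on_differentiable[OF assms(2) that]])
  have fixed: "((\<lambda>y. \<partial> F y v) has_derivative (\<lambda>u. \<Sum>b\<in>Basis. (v \<bullet> b) *\<^sub>R \<partial> (\<lambda>y. \<partial> F y b) x u)) (at x)" for v
    by (rule has_derivative_transform_within_open[OF _ assms(1,3), of "\<lambda>y. \<Sum>b\<in>Basis. (v \<bullet> b) *\<^sub>R \<partial> F y b"])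
      (auto intro!: derivative_eq_intros d2 simp flip: basis)
  have "((\<lambda>y. \<Sum>b\<in>Basis. (V y \<bullet> b) *\<^sub>R \<partial> F y b) has_derivative
    (\<lambda>u. \<Sum>b\<in>Basis. (V x \<bullet> b) *\<^sub>R \<partial> (\<lambda>y. \<partial> F y b) x u + (V' u \<bullet> b) *\<^sub>R \<partial> F x b)) (at x)"
    by (auto intro!: derivative_eq_intros d2 assms(4))
  then have "((\<lambda>y. \<partial> F y (V y)) has_derivative
    (\<lambda>u. \<Sum>b\<in>Basis. (V x \<bullet> b) *\<^sub>R \<partial> (\<lambda>y. \<partial> F y b) x u + (V' u \<bullet> b) *\<^sub>R \<partial> F x b)) (at x)"
    by (rule has_derivative_transform_within_open[OF _ assms(1,3)]) (simp flip: basis)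
  then show ?thesis
    unfolding dir_deriv_eq[OF fixed, of "V x"] sum.distrib basis[OF assms(3), symmetric] .
qed

lemma has_vector_derivative_along_line:
  assumes "F differentiable (at (x + t *\<^sub>R v))"
  shows "((\<lambda>s. F (x + s *\<^sub>R v)) has_vector_derivative \<partial> F (x + t *\<^sub>R v) v) (at t)"
proof -
  have "((\<lambda>s. x + s *\<^sub>R v) has_derivative (\<lambda>h. h *\<^sub>R v)) (at t)"
    by (auto intro!: derivative_eq_intros)
  from diff_chain_at[OF this dir_deriv_works[OF assms]]
  have "((\<lambda>s. F (x + s *\<^sub>R v)) has_derivative (\<lambda>h. \<partial> F (x + t *\<^sub>R v) (h *\<^sub>R v))) (at t)"
    by (simp add: o_def)
  then show ?thesis
    unfolding has_vector_derivative_def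
    using linear_cmul[OF linear_dir_deriv[OF assms]] by simp
qed

lemma has_real_derivative_along_line:
  fixes F :: "'a::real_normed_vector \<Rightarrow> real"
  assumes "F differentiable (at (x + t *\<^sub>R v))"
  shows "((\<lambda>s. F (x + s *\<^sub>R v)) has_real_derivative \<partial> F (x + t *\<^sub>R v) v) (at t)"
  using has_vector_derivative_along_line[OF assms]
  by (simp add: has_real_derivative_iff_has_vector_derivative)

text \<open>
  Equality of mixed second derivatives is proved in the classical way: the second difference of \<open>h\<close> over
  a small parallelogram is symmetric in its two sides, and two applications of the mean value theorem
  turn it into either of the two mixed derivatives at a nearby point.
\<close>

lemma second_difference_mean_value:
  fixes h :: "'a::euclidean_space \<Rightarrow> real"
  assumes "smooth_on S h" "0 < t" "cball x (t * (norm u + norm v)) \<subseteq> S"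
  obtains z where "z \<in> cball x (t * (norm u + norm v))"
    "h (x + t *\<^sub>R u + t *\<^sub>R v) - h (x + t *\<^sub>R u) - h (x + t *\<^sub>R v) + h x
       = t\<^sup>2 * \<partial> (\<lambda>y. \<partial> h y u) z v"
proof -
  have inS: "x + s *\<^sub>R u + r *\<^sub>R v \<in> cball x (t * (norm u + norm v))" if "0 \<le> s" "s \<le> t" "0 \<le> r" "r \<le> t" for s r
  proof -
    have "norm (s *\<^sub>R u + r *\<^sub>R v) \<le> s * norm u + r * norm v"
      using that by (metis norm_triangle_le norm_scaleR abs_of_nonneg order_refl)
    also have "\<dots> \<le> t * norm u + t * norm v"
      using that by (intro add_mono mult_right_mono) auto
    finally have "norm (s *\<^sub>R u + r *\<^sub>R v) \<le> t * (norm u + norm v)" by (simp add: distrib_left)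
    moreover have "x - (x + s *\<^sub>R u + r *\<^sub>R v) = - (s *\<^sub>R u + r *\<^sub>R v)" by simp
    ultimately show ?thesis unfolding mem_cball dist_norm by (simp only: norm_minus_cancel)
  qed
  have d: "h differentiable (at (x + s *\<^sub>R u + r *\<^sub>R v))"
    and d': "(\<lambda>y. \<partial> h y u) differentiable (at (x + s *\<^sub>R u + r *\<^sub>R v))"
    if "0 \<le> s" "s \<le> t" "0 \<le> r" "r \<le> t" for s r
    using inS[OF that] assms(1,3) smooth_on_dir_deriv by (blast intro: smooth_on_differentiable)+
  have "((\<lambda>s. h (x + s *\<^sub>R u + t *\<^sub>R v) - h (x + s *\<^sub>R u)) has_real_derivative
      \<partial> h (x + s *\<^sub>R u + t *\<^sub>R v) u - \<partial> h (x + s *\<^sub>R u) u) (at s)" if "0 \<le> s" "s \<le> t" for s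
  proof -
    have swap: "x + t *\<^sub>R v + r *\<^sub>R u = x + r *\<^sub>R u + t *\<^sub>R v" for r by simp
    show ?thesis
      using has_real_derivative_along_line[of h "x + t *\<^sub>R v" s u]
        has_real_derivative_along_line[of h x s u] d[of s t] d[of s 0] that \<open>0 < t\<close>
      unfolding swap by (intro DERIV_diff) simp_all
  qed
  from MVT2[OF \<open>0 < t\<close> this] obtain s where s: "0 < s" "s < t"
    "h (x + t *\<^sub>R u + t *\<^sub>R v) - h (x + t *\<^sub>R u) - h (x + t *\<^sub>R v) + h x =
      t * (\<partial> h (x + s *\<^sub>R u + t *\<^sub>R v) u - \<partial> h (x + s *\<^sub>R u) u)"
    by auto
  have "((\<lambda>r. \<partial> h (x + s *\<^sub>R u + r *\<^sub>R v) u) has_real_derivative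
      \<partial> (\<lambda>y. \<partial> h y u) (x + s *\<^sub>R u + r *\<^sub>R v) v) (at r)" if "0 \<le> r" "r \<le> t" for r
    using has_real_derivative_along_line[of "\<lambda>y. \<partial> h y u" "x + s *\<^sub>R u" r v] d'[of s r] s(1,2) that by simp
  from MVT2[OF \<open>0 < t\<close> this] obtain r where r: "0 < r" "r < t"
    "\<partial> h (x + s *\<^sub>R u + t *\<^sub>R v) u - \<partial> h (x + s *\<^sub>R u) u =
      t * \<partial> (\<lambda>y. \<partial> h y u) (x + s *\<^sub>R u + r *\<^sub>R v) v"
    by auto
  show ?thesis
    by (rule that[of "x + s *\<^sub>R u + r *\<^sub>R v"]) (use s r inS[of s r] in \<open>auto simp: power2_eq_square\<close>)
qed

lemma second_deriv_symmetric_real: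
  fixes h :: "'a::euclidean_space \<Rightarrow> real"
  assumes "open S" "smooth_on S h" "x \<in> S"
  shows "\<partial> (\<lambda>y. \<partial> h y u) x v = \<partial> (\<lambda>y. \<partial> h y v) x u"
proof (rule ccontr)
  assume ne: "\<not> ?thesis"
  define e where "e = \<bar>\<partial> (\<lambda>y. \<partial> h y u) x v - \<partial> (\<lambda>y. \<partial> h y v) x u\<bar> / 2"
  have "e > 0" using ne by (simp add: e_def)
  have c: "isCont (\<lambda>z. \<partial> (\<lambda>y. \<partial> h y u) z v) x" for u v
    by (intro smooth_on_isCont[OF _ assms(3)] smooth_on_dir_deriv assms(2))
  obtain d1 where d1: "d1 > 0" "\<And>z. dist z x < d1 \<Longrightarrow> \<bar>\<partial> (\<lambda>y. \<partial> h y u) z v - \<partial> (\<lambda>y. \<partial> h y u) x v\<bar> < e"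
    using c[of u v] \<open>e > 0\<close> unfolding continuous_at_eps_delta by (auto simp: dist_real_def)
  obtain d2 where d2: "d2 > 0" "\<And>z. dist z x < d2 \<Longrightarrow> \<bar>\<partial> (\<lambda>y. \<partial> h y v) z u - \<partial> (\<lambda>y. \<partial> h y v) x u\<bar> < e"
    using c[of v u] \<open>e > 0\<close> unfolding continuous_at_eps_delta by (auto simp: dist_real_def)
  obtain d3 where d3: "d3 > 0" "ball x d3 \<subseteq> S"
    using assms(1,3) openE by blast
  define d where "d = min d1 (min d2 d3)"
  have "d > 0" using d1 d2 d3 by (simp add: d_def)
  define t where "t = d / (2 * (norm u + norm v + 1))"
  have nn: "norm u + norm v + 1 > 0" by (smt (verit) norm_ge_zero)
  have "t > 0" using \<open>d > 0\<close> nn by (simp add: t_def)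
  have "t * (norm u + norm v) \<le> t * (norm u + norm v + 1)" using \<open>t > 0\<close> by simp
  also have "\<dots> = d / 2" using nn by (simp add: t_def field_simps)
  finally have td: "t * (norm u + norm v) < d" using \<open>d > 0\<close> by simp
  then have sub: "cball x (t * (norm u + norm v)) \<subseteq> S" and sub': "cball x (t * (norm v + norm u)) \<subseteq> S"
    using d3 by (force simp: d_def add.commute)+
  obtain z1 where z1: "z1 \<in> cball x (t * (norm u + norm v))"
    "h (x + t *\<^sub>R u + t *\<^sub>R v) - h (x + t *\<^sub>R u) - h (x + t *\<^sub>R v) + h x = t\<^sup>2 * \<partial> (\<lambda>y. \<partial> h y u) z1 v"
    using second_difference_mean_value[OF assms(2) \<open>t > 0\<close> sub] by blast
  obtain z2 where z2: "z2 \<in> cball x (t * (norm v + norm u))"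
    "h (x + t *\<^sub>R v + t *\<^sub>R u) - h (x + t *\<^sub>R v) - h (x + t *\<^sub>R u) + h x = t\<^sup>2 * \<partial> (\<lambda>y. \<partial> h y v) z2 u"
    using second_difference_mean_value[OF assms(2) \<open>t > 0\<close> sub'] by blast
  have "x + t *\<^sub>R v + t *\<^sub>R u = x + t *\<^sub>R u + t *\<^sub>R v" by simp
  with z1 z2 have "t\<^sup>2 * \<partial> (\<lambda>y. \<partial> h y u) z1 v = t\<^sup>2 * \<partial> (\<lambda>y. \<partial> h y v) z2 u" by (smt (verit))
  then have "\<partial> (\<lambda>y. \<partial> h y u) z1 v = \<partial> (\<lambda>y. \<partial> h y v) z2 u" using \<open>t > 0\<close> by simp
  moreover have "dist z1 x < d1" "dist z2 x < d2"
    using z1(1) z2(1) td by (auto simp: d_def dist_commute add.commute)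
  ultimately show False using d1(2)[of z1] d2(2)[of z2] unfolding e_def by (smt (verit) field_sum_of_halves)
qed

lemma second_deriv_symmetric:
  fixes F :: "'a::euclidean_space \<Rightarrow> 'b::euclidean_space"
  assumes "open S" "smooth_on S F" "x \<in> S"
  shows "\<partial> (\<lambda>y. \<partial> F y u) x v = \<partial> (\<lambda>y. \<partial> F y v) x u"
proof (rule euclidean_eqI)
  fix b :: 'b
  have comp: "\<partial> (\<lambda>y. G y \<bullet> b) y w = \<partial> G y w \<bullet> b" if "smooth_on S G" "y \<in> S" for G y w
    by (rule dir_deriv_eq) (auto intro!: derivative_eq_intros smooth_on_has_derivative[OF that])
  have "\<partial> (\<lambda>y. \<partial> F y u) x v \<bullet> b = \<partial> (\<lambda>y. \<partial> (\<lambda>y. F y \<bullet> b) y u) x v" for u v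
  proof -
    have "\<partial> (\<lambda>y. \<partial> F y u) x v \<bullet> b = \<partial> (\<lambda>y. \<partial> F y u \<bullet> b) x v"
      using comp[OF smooth_on_dir_deriv[OF assms(2)] assms(3)] by simp
    also have "\<dots> = \<partial> (\<lambda>y. \<partial> (\<lambda>y. F y \<bullet> b) y u) x v"
    proof (rule dir_deriv_eq[symmetric])
      have "((\<lambda>y. \<partial> F y u \<bullet> b) has_derivative (\<lambda>v. \<partial> (\<lambda>y. \<partial> F y u \<bullet> b) x v)) (at x)"
        by (intro smooth_on_has_derivative[OF _ assms(3)] smooth_on_inner assms smooth_on_const smooth_on_dir_deriv)
      then show "((\<lambda>y. \<partial> (\<lambda>y. F y \<bullet> b) y u) has_derivative (\<lambda>v. \<partial> (\<lambda>y. \<partial> F y u \<bullet> b) x v)) (at x)"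
        by (rule has_derivative_transform_within_open[OF _ assms(1,3)]) (simp add: comp[OF assms(2)])
    qed
    finally show ?thesis .
  qed
  moreover have "smooth_on S (\<lambda>y. F y \<bullet> b)"
    by (intro smooth_on_inner assms smooth_on_const)
  ultimately show "\<partial> (\<lambda>y. \<partial> F y u) x v \<bullet> b = \<partial> (\<lambda>y. \<partial> F y v) x u \<bullet> b"
    using second_deriv_symmetric_real[OF assms(1) _ assms(3)] by metis
qed

section \<open>Frames completed by a normal vector\<close>

text \<open>
  The rows are the vectors \<open>v j\<close>, and \<open>n\<close> in the additional row. With \<open>n\<close> the unit normal, its
  determinant is the volume form of the bundle of the hyperplanes orthogonal to the normal.
\<close>

definition frame_matrix ::
  "('m::finite \<Rightarrow> real ^ ('m option)) \<Rightarrow> real ^ ('m option) \<Rightarrow> real ^ ('m option) ^ ('m option)" where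
  "frame_matrix v n = (\<chi> i. case i of Some j \<Rightarrow> v j | None \<Rightarrow> n)"

lemma frame_matrix_rows [simp]:
  "frame_matrix v n $ Some j = v j" "frame_matrix v n $ None = n"
  by (simp_all add: frame_matrix_def)

lemma sum_UNIV_option: "(\<Sum>i\<in>(UNIV::'m::finite option set). h i) = h None + (\<Sum>j\<in>UNIV. h (Some j))"
  unfolding UNIV_option_conv by (subst sum.insert) (auto simp: sum.reindex)

lemma transpose_frame_matrix_mult:
  "transpose (frame_matrix v n) *v z = z $ None *\<^sub>R n + (\<Sum>j\<in>UNIV. z $ Some j *\<^sub>R v j)"
  unfolding matrix_mult_sum
  by (simp add: sum_UNIV_option column_transpose row_def vec_eq_iff scalar_mult_eq_scaleR)

lemma orthogonal_to_frame_eq_0: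
  assumes "det (frame_matrix v n) \<noteq> 0" "\<And>j. v j \<bullet> z = 0" "n \<bullet> z = 0"
  shows "z = 0"
proof -
  have "frame_matrix v n *v z = 0"
    unfolding vec_eq_iff
  proof
    fix i show "(frame_matrix v n *v z) $ i = 0 $ i"
      using assms(2,3) by (cases i) (simp_all add: matrix_vector_mul_component)
  qed
  then show ?thesis
    using assms(1) by (metis invertible_det_nz invertible_left_inverse matrix_left_invertible_ker)
qed

lemma frame_independent:
  assumes "det (frame_matrix v n) \<noteq> 0" "b *\<^sub>R n + (\<Sum>j\<in>UNIV. a j *\<^sub>R v j) = 0"
  shows "a j = 0" "b = 0"
proof -
  define z where "z = (\<chi> i. case i of Some j \<Rightarrow> a j | None \<Rightarrow> b)"
  have "transpose (frame_matrix v n) *v z = 0"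
    using assms(2) unfolding transpose_frame_matrix_mult z_def by simp
  then have "z = 0"
    using assms(1)
    by (metis det_transpose invertible_det_nz invertible_left_inverse matrix_left_invertible_ker)
  then have "z $ Some j = 0" "z $ None = 0" by simp_all
  then show "a j = 0" "b = 0" by (simp_all add: z_def)
qed

lemma det_frame_matrix_0_dependent:
  assumes "det (frame_matrix v n) = 0"
  obtains a b where "b \<noteq> 0 \<or> (\<exists>j. a j \<noteq> 0)" "b *\<^sub>R n + (\<Sum>j\<in>UNIV. a j *\<^sub>R v j) = 0"
proof -
  have "\<not> (\<forall>z. transpose (frame_matrix v n) *v z = 0 \<longrightarrow> z = 0)"
    using assms by (metis det_transpose invertible_det_nz invertible_left_inverse matrix_left_invertible_ker)
  then obtain z where z: "z \<noteq> 0" "transpose (frame_matrix v n) *v z = 0" by blast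
  have "z $ None \<noteq> 0 \<or> (\<exists>j. z $ Some j \<noteq> 0)"
    using z(1) by (metis not_None_eq vec_eq_iff zero_index)
  with z(2) show ?thesis
    using that[of "z $ None" "\<lambda>j. z $ Some j"] unfolding transpose_frame_matrix_mult by auto
qed

text \<open>
  This is the multiplicativity of the determinant for a block matrix with blocks \<open>A\<close> and \<open>1\<close>. All matrices
  are products of elementary ones, and for those it is one of the row rules for determinants.
\<close>

lemma det_frame_matrix_change_of_basis:
  fixes A :: "real ^ 'm ^ 'm::finite"
  shows "det (frame_matrix (\<lambda>i. \<Sum>j\<in>UNIV. A $ i $ j *\<^sub>R v j) n) = det A * det (frame_matrix v n)"
proof (induction A arbitrary: v rule: induct_matrix_elementary[case_names mult zero_row diagonal swap1 idplus])
  case (mult A B)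
  have "(\<Sum>j\<in>UNIV. (A ** B) $ i $ j *\<^sub>R v j) = (\<Sum>k\<in>UNIV. A $ i $ k *\<^sub>R (\<Sum>j\<in>UNIV. B $ k $ j *\<^sub>R v j))" for i
    unfolding matrix_matrix_mult_def
    by (simp add: scaleR_sum_left scaleR_sum_right) (rule sum.swap)
  then show ?case
    using mult.IH(1)[of "\<lambda>k. \<Sum>j\<in>UNIV. B $ k $ j *\<^sub>R v j"] mult.IH(2)[of v]
    by (simp add: det_mul)
next
  case (zero_row A i)
  then have "A $ i $ j = 0" for j by (metis row_def vec_lambda_eta zero_index)
  then have "row (Some i) (frame_matrix (\<lambda>i. \<Sum>j\<in>UNIV. A $ i $ j *\<^sub>R v j) n) = 0"
    by (simp add: row_def vec_eq_iff)
  then show ?case using det_zero_row(2)[OF zero_row] by (simp add: det_zero_row(2))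
next
  case (diagonal A)
  define c where "c i = (case i of Some j \<Rightarrow> A $ j $ j | None \<Rightarrow> 1)" for i
  have "(\<Sum>j\<in>UNIV. A $ i $ j *\<^sub>R v j) = A $ i $ i *\<^sub>R v i" for i
    using diagonal by (subst sum.remove[of _ i]) (auto intro!: sum.neutral)
  then have "frame_matrix (\<lambda>i. \<Sum>j\<in>UNIV. A $ i $ j *\<^sub>R v j) n = (\<chi> i. c i *s frame_matrix v n $ i)"
    by (auto simp: vec_eq_iff frame_matrix_def c_def split: option.split)
  moreover have "prod c UNIV = det A"
    using det_diagonal[of A] diagonal unfolding UNIV_option_conv
    by (subst prod.insert) (auto simp: prod.reindex c_def)
  ultimately show ?case by (simp add: det_rows_mul)
next
  case (swap1 p q)
  let ?T = "Transposition.transpose (Some p) (Some q)"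
  have "(\<Sum>j\<in>UNIV. (\<chi> i j. mat 1 $ i $ Transposition.transpose p q j) $ i $ j *\<^sub>R v j)
      = v (Transposition.transpose p q i)" for i :: 'm
  proof -
    have "(\<Sum>j\<in>UNIV. (\<chi> i j. mat 1 $ i $ Transposition.transpose p q j) $ i $ j *\<^sub>R v j)
        = (\<Sum>j\<in>UNIV. if j = Transposition.transpose p q i then v j else 0)"
      by (intro sum.cong) (auto simp: mat_def transpose_eq_iff)
    then show ?thesis by simp
  qed
  then have eq: "frame_matrix (\<lambda>i. \<Sum>j\<in>UNIV. (\<chi> i j. mat 1 $ i $ Transposition.transpose p q j) $ i $ j *\<^sub>R v j) n
      = (\<chi> i. frame_matrix v n $ ?T i)"
    by (auto simp: vec_eq_iff frame_matrix_def Transposition.transpose_def split: option.split)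
  have d: "det (\<chi> i j. mat 1 $ i $ Transposition.transpose p q j :: real ^ 'm ^ 'm) = -1"
  proof -
    have "(\<chi> i j. mat 1 $ i $ Transposition.transpose p q j) = (\<chi> i. (mat 1 :: real ^ 'm ^ 'm) $ Transposition.transpose p q i)"
      by (auto simp: vec_eq_iff mat_def transpose_eq_iff)
    then show ?thesis
      using \<open>p \<noteq> q\<close> det_permute_rows[OF permutes_swap_id[of p UNIV q], of "mat 1 :: real ^ 'm ^ 'm"]
      by (simp add: sign_swap_id)
  qed
  show ?case
    unfolding eq d
    using \<open>p \<noteq> q\<close> det_permute_rows[OF permutes_swap_id[of "Some p" UNIV "Some q"], of "frame_matrix v n"]
    by (simp add: sign_swap_id)
next
  case (idplus p q c)
  have "(\<Sum>j\<in>UNIV. (\<chi> i j. if i = p \<and> j = q then c else of_bool (i = j)) $ i $ j *\<^sub>R v j)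
      = v i + (if i = p then c *\<^sub>R v q else 0)" for i
  proof -
    have "(\<Sum>j\<in>UNIV. (\<chi> i j. if i = p \<and> j = q then c else of_bool (i = j)) $ i $ j *\<^sub>R v j)
        = (\<Sum>j\<in>UNIV. (if j = i then v j else 0) + (if j = q then if i = p then c *\<^sub>R v j else 0 else 0))"
      using \<open>p \<noteq> q\<close> by (intro sum.cong) auto
    then show ?thesis by (simp add: sum.distrib)
  qed
  then have rows: "(\<lambda>i. \<Sum>j\<in>UNIV. (\<chi> i j. if i = p \<and> j = q then c else of_bool (i = j)) $ i $ j *\<^sub>R v j)
      = (\<lambda>i. v i + (if i = p then c *\<^sub>R v q else 0))"
    by blast
  have "frame_matrix (\<lambda>i. \<Sum>j\<in>UNIV. (\<chi> i j. if i = p \<and> j = q then c else of_bool (i = j)) $ i $ j *\<^sub>R v j) n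
      = (\<chi> k. if k = Some p then row (Some p) (frame_matrix v n) + c *s row (Some q) (frame_matrix v n)
                else row k (frame_matrix v n))"
    unfolding rows by (auto simp: vec_eq_iff frame_matrix_def row_def split: option.split)
  moreover have "det (\<chi> i j. if i = p \<and> j = q then c else of_bool (i = j) :: real ^ 'm ^ 'm) = 1"
  proof -
    have "(\<chi> i j. if i = p \<and> j = q then c else of_bool (i = j) :: real ^ 'm ^ 'm)
      = (\<chi> k. if k = p then row p (mat 1) + c *s row q (mat 1) else row k (mat 1))"
      using \<open>p \<noteq> q\<close> by (auto simp: vec_eq_iff mat_def row_def)
    then show ?thesis using det_row_operation[OF \<open>p \<noteq> q\<close>, of "mat 1 :: real ^ 'm ^ 'm" c] by simp
  qed
  ultimately show ?case
    using \<open>p \<noteq> q\<close> det_row_operation[of "Some p" "Some q" "frame_matrix v n" c] by simp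
qed

lemma det_frame_matrix_scale:
  "det (frame_matrix (v(k := c *\<^sub>R v k)) n) = c * det (frame_matrix v n)"
proof -
  have "det (\<chi> i. if i = Some k then c *s (\<lambda>i. frame_matrix v n $ i) i else frame_matrix v n $ i)
    = c * det (\<chi> i. if i = Some k then (\<lambda>i. frame_matrix v n $ i) i else frame_matrix v n $ i)"
    by (rule det_row_mul)
  moreover have "(\<chi> i. if i = Some k then c *s (\<lambda>i. frame_matrix v n $ i) i else frame_matrix v n $ i)
    = frame_matrix (v(k := c *\<^sub>R v k)) n"
    by (auto simp: vec_eq_iff frame_matrix_def split: option.split)
  moreover have "(\<chi> i. if i = Some k then (\<lambda>i. frame_matrix v n $ i) i else frame_matrix v n $ i) = frame_matrix v n"
    by (auto simp: vec_eq_iff)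
  ultimately show ?thesis by simp
qed

lemma tendsto_det:
  fixes A :: "'b \<Rightarrow> real ^ 'n ^ 'n"
  assumes "\<And>i. ((\<lambda>t. A t $ i) \<longlongrightarrow> a $ i) G"
  shows "((\<lambda>t. det (A t)) \<longlongrightarrow> det a) G"
  unfolding det_def by (intro tendsto_intros tendsto_vec_nth assms)

lemma orthonormal_frame_expansion:
  assumes "det (frame_matrix v n) \<noteq> 0"
    "\<And>i j. v i \<bullet> v j = (if i = j then 1 else 0)" "\<And>i. v i \<bullet> n = 0" "z \<bullet> n = 0"
  shows "z = (\<Sum>j\<in>UNIV. (z \<bullet> v j) *\<^sub>R v j)"
proof -
  have "z - (\<Sum>j\<in>UNIV. (z \<bullet> v j) *\<^sub>R v j) = 0"
  proof (rule orthogonal_to_frame_eq_0[OF assms(1)])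
    show "v i \<bullet> (z - (\<Sum>j\<in>UNIV. (z \<bullet> v j) *\<^sub>R v j)) = 0" for i
      by (simp add: inner_diff_right inner_sum_right assms(2) inner_commute if_distrib cong: if_cong)
    show "n \<bullet> (z - (\<Sum>j\<in>UNIV. (z \<bullet> v j) *\<^sub>R v j)) = 0"
      using assms(3,4) by (simp add: inner_diff_right inner_sum_right inner_commute)
  qed
  then show ?thesis by simp
qed

lemma det_replaced_orthonormal_row:
  assumes "det (frame_matrix v n) \<noteq> 0"
    "\<And>i j. v i \<bullet> v j = (if i = j then 1 else 0)" "\<And>i. v i \<bullet> n = 0" "z \<bullet> n = 0"
  shows "det (frame_matrix (v(k := z)) n) = (z \<bullet> v k) * det (frame_matrix v n)"
proof -
  define A :: "real ^ 'a ^ 'a" where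
    "A = (\<chi> i. if i = k then \<Sum>i\<in>UNIV. (\<chi> j. z \<bullet> v j) $ i *s row i (mat 1) else row i (mat 1))"
  have "det A = z \<bullet> v k"
    unfolding A_def by (subst cramer_lemma_transpose) simp
  moreover have "(\<Sum>j\<in>UNIV. A $ i $ j *\<^sub>R v j) = (v(k := z)) i" for i
  proof (cases "i = k")
    case True
    then have "(\<Sum>j\<in>UNIV. A $ i $ j *\<^sub>R v j) = (\<Sum>j\<in>UNIV. (z \<bullet> v j) *\<^sub>R v j)"
      by (simp add: A_def row_def mat_def if_distrib cong: if_cong)
    then show ?thesis using True orthonormal_frame_expansion[OF assms] by simp
  next
    case False
    then have "(\<Sum>j\<in>UNIV. A $ i $ j *\<^sub>R v j) = (\<Sum>j\<in>UNIV. if j = i then v j else 0)"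
      by (intro sum.cong) (auto simp: A_def row_def mat_def)
    then show ?thesis using False by simp
  qed
  then have "(\<lambda>i. \<Sum>j\<in>UNIV. A $ i $ j *\<^sub>R v j) = v(k := z)" by blast
  ultimately show ?thesis
    using det_frame_matrix_change_of_basis[of A v n] by simp
qed

section \<open>Fronts in coordinates and the Gauss equation\<close>

lemma bounded_linear_axis: "bounded_linear (\<lambda>r. r *\<^sub>R axis i (1::real))"
  by (rule bounded_linear_scaleR_left)

lemma vec_lambda_axis_sum: "(\<chi> i. f i) = (\<Sum>i\<in>UNIV. f i *\<^sub>R axis i (1::real))"
  by (simp add: vec_eq_iff axis_def if_distrib cong: if_cong)

lemma smooth_on_vec:
  fixes f :: "'a::euclidean_space \<Rightarrow> 'n::finite \<Rightarrow> real"
  assumes "open S" "\<And>i. smooth_on S (\<lambda>x. f x i)"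
  shows "smooth_on S (\<lambda>x. \<chi> i. f x i)"
  unfolding vec_lambda_axis_sum
  by (intro smooth_on_sum smooth_on_bounded_linear[OF _ bounded_linear_axis] assms)

lemma dir_deriv_axis_sum:
  fixes h :: "real ^ 'n::finite \<Rightarrow> 'b::real_normed_vector"
  assumes "h differentiable (at x)"
  shows "\<partial> h x v = (\<Sum>j\<in>UNIV. v $ j *\<^sub>R \<partial> h x (axis j 1))"
proof -
  have "\<partial> h x (\<Sum>j\<in>UNIV. v $ j *\<^sub>R axis j 1) = (\<Sum>j\<in>UNIV. v $ j *\<^sub>R \<partial> h x (axis j 1))"
    using linear_dir_deriv[OF assms] by (simp add: linear_sum linear_cmul)
  then show ?thesis by (simp flip: vec_lambda_axis_sum)
qed

text \<open>
  All local arguments take place in a chart with a fixed unit normal field; \<open>F\<close> and \<open>N\<close> are the front and the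
  normal field as functions of the coordinates.
\<close>

locale local_front =
  fixes \<Omega> :: "(real ^ 'm::finite) set" and F N :: "real ^ 'm \<Rightarrow> real ^ ('m option)"
  assumes open_dom: "open \<Omega>"
    and smooth_F: "smooth_on \<Omega> F"
    and smooth_N: "smooth_on \<Omega> N"
    and norm_N: "\<And>x. x \<in> \<Omega> \<Longrightarrow> norm (N x) = 1"
    and normal: "\<And>x X. x \<in> \<Omega> \<Longrightarrow> \<partial> F x X \<bullet> N x = 0"
    and immersion: "\<And>x X. x \<in> \<Omega> \<Longrightarrow> \<partial> F x X = 0 \<Longrightarrow> \<partial> N x X = 0 \<Longrightarrow> X = 0"
begin

definition hess :: "real ^ 'm \<Rightarrow> real ^ 'm \<Rightarrow> real ^ 'm \<Rightarrow> real ^ ('m option)" where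
  "hess x X Y = \<partial> (\<lambda>y. \<partial> F y Y) x X"

definition sff :: "real ^ 'm \<Rightarrow> real ^ 'm \<Rightarrow> real ^ 'm \<Rightarrow> real" where
  "sff x X Y = - (\<partial> F x X \<bullet> \<partial> N x Y)"

definition metric :: "real ^ 'm \<Rightarrow> real ^ 'm \<Rightarrow> real ^ 'm \<Rightarrow> real" where
  "metric x X Y = \<partial> F x X \<bullet> \<partial> F x Y"

text \<open>
  The function \<open>\<lambda>\<close> in coordinates; its zero set is the singular set.
\<close>

definition density :: "real ^ 'm \<Rightarrow> real" where
  "density x = det (frame_matrix (\<lambda>i. \<partial> F x (axis i 1)) (N x))"

definition regular :: "real ^ 'm \<Rightarrow> bool" where
  "regular x \<longleftrightarrow> inj (\<partial> F x)"

lemma diff_F: "x \<in> \<Omega> \<Longrightarrow> F differentiable (at x)"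
  and diff_N: "x \<in> \<Omega> \<Longrightarrow> N differentiable (at x)"
  using smooth_F smooth_N smooth_on_differentiable by blast+

lemma linear_F: "x \<in> \<Omega> \<Longrightarrow> linear (\<partial> F x)"
  and linear_N: "x \<in> \<Omega> \<Longrightarrow> linear (\<partial> N x)"
  using linear_dir_deriv diff_F diff_N by blast+

lemma N_unit: "x \<in> \<Omega> \<Longrightarrow> N x \<bullet> N x = 1"
  using norm_N by (simp add: dot_square_norm)

lemma smooth_dF: "smooth_on \<Omega> (\<lambda>y. \<partial> F y X)"
  and smooth_dN: "smooth_on \<Omega> (\<lambda>y. \<partial> N y X)"
  by (intro smooth_on_dir_deriv smooth_F smooth_N)+

lemma smooth_hess: "smooth_on \<Omega> (\<lambda>y. hess y X Y)"
  unfolding hess_def by (intro smooth_on_dir_deriv smooth_F)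

lemma smooth_sff: "smooth_on \<Omega> (\<lambda>y. sff y X Y)"
proof -
  have "smooth_on \<Omega> (\<lambda>y. (- 1) * (\<partial> F y X \<bullet> \<partial> N y Y))"
    by (intro smooth_on_mult smooth_on_inner smooth_on_const open_dom smooth_dF smooth_dN)
  then show ?thesis by (simp add: sff_def)
qed

lemma smooth_density: "smooth_on \<Omega> density"
  unfolding density_def
proof (rule smooth_on_det[OF open_dom])
  fix i show "smooth_on \<Omega> (\<lambda>x. frame_matrix (\<lambda>i. \<partial> F x (axis i 1)) (N x) $ i)"
    by (cases i) (simp_all add: smooth_N smooth_dF)
qed

lemma hess_sym: "x \<in> \<Omega> \<Longrightarrow> hess x X Y = hess x Y X"
  unfolding hess_def by (intro second_deriv_symmetric[OF open_dom] smooth_F)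

text \<open>
  The derivative of the identity \<open>\<langle>dF(X), N\<rangle> = 0\<close>. It gives the symmetry of the second fundamental form
  at all points, singular ones included.
\<close>

lemma normal_deriv:
  assumes "x \<in> \<Omega>"
  shows "\<partial> F x X \<bullet> \<partial> N x Y + hess x Y X \<bullet> N x = 0"
proof -
  have "((\<lambda>y. \<partial> F y X \<bullet> N y) has_derivative (\<lambda>u. \<partial> F x X \<bullet> \<partial> N x u + hess x u X \<bullet> N x)) (at x)"
    unfolding hess_def
    by (intro derivative_intros smooth_on_has_derivative[OF smooth_dF assms]
        smooth_on_has_derivative[OF smooth_N assms])
  moreover have "((\<lambda>y. \<partial> F y X \<bullet> N y) has_derivative (\<lambda>u. 0)) (at x)"
    by (rule has_derivative_transform_within_open[OF has_derivative_const[of 0] open_dom assms])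
      (simp add: normal)
  ultimately have "(\<lambda>u. \<partial> F x X \<bullet> \<partial> N x u + hess x u X \<bullet> N x) = (\<lambda>u. 0)"
    by (rule has_derivative_unique)
  then show ?thesis by (rule fun_cong)
qed

lemma dN_tangent:
  assumes "x \<in> \<Omega>"
  shows "\<partial> N x X \<bullet> N x = 0"
proof -
  have "((\<lambda>y. N y \<bullet> N y) has_derivative (\<lambda>u. N x \<bullet> \<partial> N x u + \<partial> N x u \<bullet> N x)) (at x)"
    by (intro derivative_intros smooth_on_has_derivative[OF smooth_N assms])
  moreover have "((\<lambda>y. N y \<bullet> N y) has_derivative (\<lambda>u. 0)) (at x)"
    by (rule has_derivative_transform_within_open[OF has_derivative_const[of 1] open_dom assms])
      (simp add: N_unit)
  ultimately have "(\<lambda>u. N x \<bullet> \<partial> N x u + \<partial> N x u \<bullet> N x) = (\<lambda>u. 0)"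
    by (rule has_derivative_unique)
  from fun_cong[OF this, of X] show ?thesis by (simp add: inner_commute)
qed

lemma sff_hess: "x \<in> \<Omega> \<Longrightarrow> sff x X Y = hess x X Y \<bullet> N x"
  using normal_deriv[of x X Y] hess_sym[of x X Y] by (simp add: sff_def)

lemma sff_sym: "x \<in> \<Omega> \<Longrightarrow> sff x X Y = sff x Y X"
  by (simp add: sff_hess hess_sym)

lemma density_change_of_basis:
  assumes "x \<in> \<Omega>"
  shows "det (frame_matrix (\<lambda>i. \<partial> F x (A $ i)) (N x)) = det A * density x"
proof -
  have "(\<lambda>i. \<partial> F x (A $ i)) = (\<lambda>i. \<Sum>j\<in>UNIV. A $ i $ j *\<^sub>R \<partial> F x (axis j 1))"
    by (intro ext dir_deriv_axis_sum diff_F assms)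
  then show ?thesis
    unfolding density_def by (simp only: det_frame_matrix_change_of_basis)
qed

lemma regularD: "regular x \<Longrightarrow> x \<in> \<Omega> \<Longrightarrow> \<partial> F x X = 0 \<Longrightarrow> X = 0"
  using linear_F linear_injective_0 unfolding regular_def by blast

lemma regular_iff_density:
  assumes "x \<in> \<Omega>"
  shows "regular x \<longleftrightarrow> density x \<noteq> 0"
proof
  assume reg: "regular x"
  show "density x \<noteq> 0"
  proof
    assume "density x = 0"
    then obtain a b where ab: "b \<noteq> 0 \<or> (\<exists>j. a j \<noteq> 0)"
      "b *\<^sub>R N x + (\<Sum>j\<in>UNIV. a j *\<^sub>R \<partial> F x (axis j 1)) = 0"
      unfolding density_def by (rule det_frame_matrix_0_dependent)
    have "(\<Sum>j\<in>UNIV. a j *\<^sub>R \<partial> F x (axis j 1)) = \<partial> F x (\<chi> j. a j)"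
      using dir_deriv_axis_sum[OF diff_F[OF assms], of "\<chi> j. a j"] by simp
    with ab(2) have eq: "b *\<^sub>R N x + \<partial> F x (\<chi> j. a j) = 0" by simp
    then have "(b *\<^sub>R N x + \<partial> F x (\<chi> j. a j)) \<bullet> N x = 0" by simp
    then have "b = 0" by (simp add: inner_add_left normal N_unit assms)
    moreover from this eq have "(\<chi> j. a j) = 0"
      using regularD[OF reg assms] by simp
    then have "a j = 0" for j by (metis vec_lambda_beta zero_index)
    ultimately show False using ab(1) by blast
  qed
next
  assume d: "density x \<noteq> 0"
  have "X = 0" if "\<partial> F x X = 0" for X
  proof -
    have "0 *\<^sub>R N x + (\<Sum>j\<in>UNIV. X $ j *\<^sub>R \<partial> F x (axis j 1)) = 0"
      using that dir_deriv_axis_sum[OF diff_F[OF assms], of X] by simp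
    then have "X $ j = 0" for j using frame_independent(1) d unfolding density_def by blast
    then show ?thesis by (simp add: vec_eq_iff)
  qed
  then show "regular x"
    using linear_F[OF assms] linear_injective_0 unfolding regular_def by blast
qed

lemma orthogonal_to_tangent:
  assumes "x \<in> \<Omega>" "regular x" "\<And>X. z \<bullet> \<partial> F x X = 0"
  shows "z = (z \<bullet> N x) *\<^sub>R N x"
proof -
  have "z - (z \<bullet> N x) *\<^sub>R N x = 0"
    by (rule orthogonal_to_frame_eq_0[of "\<lambda>i. \<partial> F x (axis i 1)" "N x"])
      (use assms regular_iff_density in \<open>simp_all add: density_def inner_diff_right normal N_unit inner_commute[of _ z]
        inner_commute[of "N x" z]\<close>)
  then show ?thesis by simp
qed

definition gram :: "real ^ 'm \<Rightarrow> real ^ 'm ^ 'm" where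
  "gram x = (\<chi> i j. metric x (axis i 1) (axis j 1))"

lemma gram_mult: "x \<in> \<Omega> \<Longrightarrow> (gram x *v w) $ l = \<partial> F x w \<bullet> \<partial> F x (axis l 1)"
  unfolding dir_deriv_axis_sum[OF diff_F, of x w] inner_sum_left
  by (simp add: gram_def metric_def matrix_vector_mult_def inner_commute mult.commute)

lemma smooth_gram_row: "smooth_on \<Omega> (\<lambda>x. gram x $ i)"
  unfolding gram_def metric_def
  by (simp, intro smooth_on_vec smooth_on_inner open_dom smooth_dF)

lemma det_gram_nz:
  assumes "x \<in> \<Omega>" "regular x"
  shows "det (gram x) \<noteq> 0"
proof -
  have "w = 0" if "gram x *v w = 0" for w
  proof -
    have "\<partial> F x w \<bullet> \<partial> F x (axis l 1) = 0" for l
      using gram_mult[OF assms(1), of w l] that by simp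
    then have "\<partial> F x w \<bullet> (\<Sum>j\<in>UNIV. w $ j *\<^sub>R \<partial> F x (axis j 1)) = 0"
      by (simp add: inner_sum_right)
    then have "\<partial> F x w \<bullet> \<partial> F x w = 0"
      by (simp flip: dir_deriv_axis_sum[OF diff_F[OF assms(1)]])
    then show ?thesis using regularD[OF assms(2,1)] by simp
  qed
  then show ?thesis
    by (metis invertible_det_nz invertible_left_inverse matrix_left_invertible_ker)
qed

lemma metric_has_derivative:
  assumes "x \<in> \<Omega>"
  shows "\<partial> (\<lambda>y. metric y X Y) x Z = \<partial> F x X \<bullet> hess x Z Y + hess x Z X \<bullet> \<partial> F x Y"
  unfolding metric_def hess_def
  by (rule dir_deriv_eq)
    (intro derivative_intros smooth_on_has_derivative[OF smooth_dF assms])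

text \<open>
  The symmetric combination of derivatives of the metric in the Christoffel symbols equals the inner
  product of the second derivative of \<open>F\<close> with \<open>dF\<close>. So they solve a linear system with the
  Gram matrix, which means that \<open>dF\<close> maps them to the tangential part of the second derivative.
\<close>

lemma christoffel_system:
  assumes "x \<in> \<Omega>" "regular x"
  shows "gram x *v christoffel metric x u v = (\<chi> l. hess x u v \<bullet> \<partial> F x (axis l 1))"
proof -
  have "(\<partial> (\<lambda>y. metric y v (axis l 1)) x u + \<partial> (\<lambda>y. metric y u (axis l 1)) x v
      - \<partial> (\<lambda>y. metric y u v) x (axis l 1)) / 2 = hess x u v \<bullet> \<partial> F x (axis l 1)" for l
    unfolding metric_has_derivative[OF assms(1)]
    using hess_sym[OF assms(1), of u v] hess_sym[OF assms(1), of u "axis l 1"] hess_sym[OF assms(1), of v "axis l 1"]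
    by (simp add: inner_commute)
  then have "christoffel metric x u v = matrix_inv (gram x) *v (\<chi> l. hess x u v \<bullet> \<partial> F x (axis l 1))"
    by (simp add: christoffel_def gram_def)
  moreover have "gram x ** matrix_inv (gram x) = mat 1"
    using det_gram_nz[OF assms] someI_ex[of "\<lambda>B. gram x ** B = mat 1 \<and> B ** gram x = mat 1"]
    unfolding matrix_inv_def invertible_det_nz[symmetric] invertible_def by blast
  ultimately show ?thesis
    by (simp add: matrix_vector_mul_assoc)
qed

lemma christoffel_tangent:
  assumes "x \<in> \<Omega>" "regular x"
  shows "\<partial> F x (christoffel metric x u v) \<bullet> \<partial> F x w = hess x u v \<bullet> \<partial> F x w"
proof -
  have "\<partial> F x (christoffel metric x u v) \<bullet> \<partial> F x (axis l 1) = hess x u v \<bullet> \<partial> F x (axis l 1)" for l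
    using christoffel_system[OF assms, of u v] gram_mult[OF assms(1), of "christoffel metric x u v" l]
    by simp
  then show ?thesis
    unfolding dir_deriv_axis_sum[OF diff_F[OF assms(1)], of w] inner_sum_right by simp
qed

lemma regular_near:
  assumes "x \<in> \<Omega>" "regular x"
  obtains T where "open T" "x \<in> T" "T \<subseteq> \<Omega>" "\<And>y. y \<in> T \<Longrightarrow> regular y"
proof
  let ?T = "\<Omega> \<inter> density -` (- {0})"
  show "open ?T"
    by (rule continuous_open_preimage[OF smooth_on_continuous[OF smooth_density] open_dom]) auto
  show "x \<in> ?T" "?T \<subseteq> \<Omega>" using assms regular_iff_density by auto
  show "regular y" if "y \<in> ?T" for y using that regular_iff_density by auto
qed

text \<open>
  By Cramer's rule the solution of the system is a quotient of smooth functions.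
\<close>

lemma christoffel_differentiable:
  assumes "x \<in> \<Omega>" "regular x"
  shows "(\<lambda>y. christoffel metric y u v) differentiable (at x)"
proof -
  obtain T where T: "open T" "x \<in> T" "T \<subseteq> \<Omega>" "\<And>y. y \<in> T \<Longrightarrow> regular y"
    using regular_near[OF assms] by blast
  define b where "b y = (\<chi> l. hess y u v \<bullet> \<partial> F y (axis l 1))" for y
  define num where "num y = (\<chi> k. det (\<chi> i j. if j = k then b y $ i else gram y $ i $ j))" for y
  have comp: "smooth_on \<Omega> (\<lambda>y. gram y $ i $ j)" "smooth_on \<Omega> (\<lambda>y. b y $ i)" for i j
    by (auto simp: gram_def metric_def b_def
        intro!: smooth_on_inner open_dom smooth_dF smooth_hess)
  have "smooth_on \<Omega> num"
    unfolding num_def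
  proof (intro smooth_on_vec[OF open_dom] smooth_on_det[OF open_dom])
    fix k i
    have "smooth_on \<Omega> (\<lambda>y. if j = k then b y $ i else gram y $ i $ j)" for j
      using comp by (cases "j = k") auto
    then show "smooth_on \<Omega> (\<lambda>y. (\<chi> i j. if j = k then b y $ i else gram y $ i $ j) $ i)"
      by (simp add: smooth_on_vec[OF open_dom])
  qed
  moreover have "smooth_on \<Omega> (\<lambda>y. det (gram y))"
    by (intro smooth_on_det open_dom smooth_gram_row)
  ultimately have "(\<lambda>y. inverse (det (gram y)) *\<^sub>R num y) differentiable (at x)"
    using det_gram_nz[OF assms] assms(1)
    by (intro differentiable_scaleR differentiable_inverse) (auto intro: smooth_on_differentiable)
  moreover have "inverse (det (gram y)) *\<^sub>R num y = christoffel metric y u v" if "y \<in> T" for y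
  proof -
    have y: "y \<in> \<Omega>" "regular y" using T that by auto
    have "christoffel metric y u v = (\<chi> k. det (\<chi> i j. if j = k then b y $ i else gram y $ i $ j) / det (gram y))"
      using christoffel_system[OF y, of u v] unfolding b_def[symmetric]
      by (subst (asm) cramer[OF det_gram_nz[OF y]]) simp
    then show ?thesis by (simp add: num_def vec_eq_iff divide_inverse mult.commute)
  qed
  ultimately show ?thesis
    unfolding differentiable_def by (metis (no_types, lifting) has_derivative_transform_within_open[OF _ T(1,2)])
qed

text \<open>
  Differentiate \<open>\<langle>dF(\<Gamma>(v,w)), dF(l)\<rangle> = \<langle>d\<^sup>2F(v,w), dF(l)\<rangle>\<close> in direction \<open>u\<close>. The part of \<open>d\<^sup>2F(v,w)\<close> that
  \<open>dF(\<Gamma>(v,w))\<close> misses is normal, and contributes the product \<open>II(v,w) II(u,l)\<close>. The third derivatives of \<open>F\<close>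
  cancel when the result is antisymmetrized in \<open>u\<close> and \<open>v\<close>.
\<close>

theorem gauss_equation:
  assumes "x \<in> \<Omega>" "regular x"
  shows "metric x (riemann metric x u v w) l = sff x v w * sff x u l - sff x u w * sff x v l"
proof -
  obtain T where T: "open T" "x \<in> T" "T \<subseteq> \<Omega>" "\<And>y. y \<in> T \<Longrightarrow> regular y"
    using regular_near[OF assms] by blast
  let ?\<Gamma> = "christoffel metric"
  have key: "\<partial> F x (\<partial> (\<lambda>y. ?\<Gamma> y v w) x u + ?\<Gamma> x u (?\<Gamma> x v w)) \<bullet> \<partial> F x l
      = \<partial> (\<lambda>y. hess y v w) x u \<bullet> \<partial> F x l + sff x v w * sff x u l" for u v w l
  proof -
    have "((\<lambda>y. ?\<Gamma> y v w) has_derivative (\<lambda>u. \<partial> (\<lambda>y. ?\<Gamma> y v w) x u)) (at x)"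
      by (intro dir_deriv_works christoffel_differentiable assms)
    then have "((\<lambda>y. \<partial> F y (?\<Gamma> y v w) \<bullet> \<partial> F y l) has_derivative
       (\<lambda>u. \<partial> F x (?\<Gamma> x v w) \<bullet> hess x u l
          + (hess x u (?\<Gamma> x v w) + \<partial> F x (\<partial> (\<lambda>y. ?\<Gamma> y v w) x u)) \<bullet> \<partial> F x l)) (at x)"
      unfolding hess_def
      by (intro has_derivative_inner has_derivative_dir_deriv_field[OF open_dom smooth_F assms(1)]
          smooth_on_has_derivative[OF smooth_dF assms(1)])
    moreover have "((\<lambda>y. hess y v w \<bullet> \<partial> F y l) has_derivative
       (\<lambda>u. hess x v w \<bullet> hess x u l + \<partial> (\<lambda>y. hess y v w) x u \<bullet> \<partial> F x l)) (at x)"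
      by (subst (3) hess_def) (intro has_derivative_inner
          smooth_on_has_derivative[OF smooth_dF assms(1)] smooth_on_has_derivative[OF smooth_hess assms(1)])
    then have "((\<lambda>y. \<partial> F y (?\<Gamma> y v w) \<bullet> \<partial> F y l) has_derivative
       (\<lambda>u. hess x v w \<bullet> hess x u l + \<partial> (\<lambda>y. hess y v w) x u \<bullet> \<partial> F x l)) (at x)"
      by (rule has_derivative_transform_within_open[OF _ T(1,2)])
        (use T christoffel_tangent in auto)
    ultimately have "(\<lambda>u. \<partial> F x (?\<Gamma> x v w) \<bullet> hess x u l
          + (hess x u (?\<Gamma> x v w) + \<partial> F x (\<partial> (\<lambda>y. ?\<Gamma> y v w) x u)) \<bullet> \<partial> F x l)
        = (\<lambda>u. hess x v w \<bullet> hess x u l + \<partial> (\<lambda>y. hess y v w) x u \<bullet> \<partial> F x l)"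
      by (rule has_derivative_unique)
    from fun_cong[OF this, of u]
    have 1: "\<partial> F x (?\<Gamma> x v w) \<bullet> hess x u l
          + (hess x u (?\<Gamma> x v w) + \<partial> F x (\<partial> (\<lambda>y. ?\<Gamma> y v w) x u)) \<bullet> \<partial> F x l
        = hess x v w \<bullet> hess x u l + \<partial> (\<lambda>y. hess y v w) x u \<bullet> \<partial> F x l"
      .
    define z where "z = hess x v w - \<partial> F x (?\<Gamma> x v w)"
    have "z = (z \<bullet> N x) *\<^sub>R N x"
      by (rule orthogonal_to_tangent[OF assms])
        (simp add: z_def inner_diff_left christoffel_tangent[OF assms])
    moreover have "z \<bullet> N x = sff x v w"
      by (simp add: z_def inner_diff_left normal assms(1) sff_hess)
    ultimately have "z \<bullet> hess x u l = sff x v w * sff x u l"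
      using sff_hess[OF assms(1), of u l] by (metis inner_commute inner_scaleR_left)
    then have 2: "hess x v w \<bullet> hess x u l = \<partial> F x (?\<Gamma> x v w) \<bullet> hess x u l + sff x v w * sff x u l"
      by (simp add: z_def inner_diff_left)
    show ?thesis
      using 1 2 christoffel_tangent[OF assms, of u "?\<Gamma> x v w" l] linear_add[OF linear_F[OF assms(1)]]
      by (simp add: inner_add_left)
  qed
  have sym: "\<partial> (\<lambda>y. hess y v w) x u = \<partial> (\<lambda>y. hess y u w) x v"
    unfolding hess_def by (rule second_deriv_symmetric[OF open_dom smooth_dF assms(1)])
  have "riemann metric x u v w = (\<partial> (\<lambda>y. ?\<Gamma> y v w) x u + ?\<Gamma> x u (?\<Gamma> x v w))
       - (\<partial> (\<lambda>y. ?\<Gamma> y u w) x v + ?\<Gamma> x v (?\<Gamma> x u w))"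
    by (simp add: riemann_def)
  then have "metric x (riemann metric x u v w) l
      = \<partial> F x (\<partial> (\<lambda>y. ?\<Gamma> y v w) x u + ?\<Gamma> x u (?\<Gamma> x v w)) \<bullet> \<partial> F x l
      - \<partial> F x (\<partial> (\<lambda>y. ?\<Gamma> y u w) x v + ?\<Gamma> x v (?\<Gamma> x u w)) \<bullet> \<partial> F x l"
    by (simp only: metric_def[of x _ l] linear_diff[OF linear_F[OF assms(1)]] inner_diff_left)
  then show ?thesis
    unfolding key by (simp add: sym)
qed

corollary sectional_curvature_eq:
  assumes "x \<in> \<Omega>" "regular x"
  shows "sectional_curvature metric x X Y =
    (sff x X X * sff x Y Y - (sff x X Y)\<^sup>2) / (metric x X X * metric x Y Y - (metric x X Y)\<^sup>2)"
  using gauss_equation[OF assms, of X Y Y X] sff_sym[OF assms(1), of X Y]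
  by (simp add: sectional_curvature_def power2_eq_square mult.commute)

end

section \<open>Level sets\<close>

lemma tendsto_ray_quotient:
  assumes "G differentiable (at q)" "G q = 0"
  shows "((\<lambda>t. G (q + t *\<^sub>R v) /\<^sub>R t) \<longlongrightarrow> \<partial> G q v) (at (0::real))"
proof -
  have "((\<lambda>s. G (q + s *\<^sub>R v)) has_derivative (\<lambda>h. h *\<^sub>R \<partial> G q v)) (at 0)"
    using has_vector_derivative_along_line[of G q 0 v] assms(1) by (simp add: has_vector_derivative_def)
  then have "((\<lambda>h. norm (G (q + h *\<^sub>R v) - h *\<^sub>R \<partial> G q v) / norm h) \<longlongrightarrow> 0) (at 0)"
    using assms(2) by (simp add: has_derivative_at)
  moreover have "\<forall>\<^sub>F h in at (0::real). norm (G (q + h *\<^sub>R v) - h *\<^sub>R \<partial> G q v) / norm h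
      = norm (G (q + h *\<^sub>R v) /\<^sub>R h - \<partial> G q v)"
  proof (rule eventually_at_topological[THEN iffD2], intro exI[of _ UNIV] conjI ballI impI)
    fix h :: real assume "h \<noteq> 0"
    then have "G (q + h *\<^sub>R v) /\<^sub>R h - \<partial> G q v = (G (q + h *\<^sub>R v) - h *\<^sub>R \<partial> G q v) /\<^sub>R h"
      by (simp add: scaleR_diff_right)
    then show "norm (G (q + h *\<^sub>R v) - h *\<^sub>R \<partial> G q v) / norm h = norm (G (q + h *\<^sub>R v) /\<^sub>R h - \<partial> G q v)"
      by (simp add: divide_inverse mult.commute)
  qed auto
  ultimately have "((\<lambda>h. norm (G (q + h *\<^sub>R v) /\<^sub>R h - \<partial> G q v)) \<longlongrightarrow> 0) (at 0)"
    by (rule Lim_transform_eventually)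
  then show ?thesis
    by (rule LIM_zero_cancel[OF tendsto_norm_zero_cancel])
qed

lemma tendsto_ray: "((\<lambda>t. q + t *\<^sub>R v) \<longlongrightarrow> (q::'a::real_normed_vector)) (at (0::real))"
proof -
  have "((\<lambda>t. q + t *\<^sub>R v) \<longlongrightarrow> q + 0 *\<^sub>R v) (at (0::real))" by (intro tendsto_intros)
  then show ?thesis by simp
qed

text \<open>
  This is \<open>tangent_space\<close> for subsets of a coordinate space.
\<close>

definition velocities :: "'a::real_normed_vector set \<Rightarrow> 'a \<Rightarrow> 'a set" where
  "velocities S q = {X. \<exists>\<gamma>. \<gamma> 0 = q \<and> (\<gamma> has_vector_derivative X) (at (0::real)) \<and> (\<forall>\<^sub>F t in at 0. \<gamma> t \<in> S)}"

lemma dir_deriv_eq_0_of_velocity: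
  fixes G :: "'a::real_normed_vector \<Rightarrow> 'b::real_normed_vector"
  assumes "X \<in> velocities S q" "(G has_derivative G') (at q)" "G q = 0"
    "\<forall>\<^sub>F y in nhds q. y \<in> S \<longrightarrow> G y = 0"
  shows "G' X = 0"
proof -
  obtain \<gamma> where \<gamma>: "\<gamma> 0 = q" "(\<gamma> has_vector_derivative X) (at (0::real))" "\<forall>\<^sub>F t in at 0. \<gamma> t \<in> S"
    using assms(1) unfolding velocities_def by blast
  have "(\<gamma> \<longlongrightarrow> q) (at 0)"
    using \<gamma>(1,2) has_vector_derivative_continuous continuous_within by metis
  then have "\<forall>\<^sub>F t in at 0. \<gamma> t \<in> S \<longrightarrow> G (\<gamma> t) = 0"
    using assms(4) unfolding filterlim_def le_filter_def eventually_filtermap by blast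
  then have ev: "\<forall>\<^sub>F t in at 0. G (\<gamma> t) = 0"
    using \<gamma>(3) by eventually_elim simp
  have "((\<lambda>t. G (\<gamma> t)) has_derivative (\<lambda>h. G' (h *\<^sub>R X))) (at 0)"
    using diff_chain_at[of \<gamma> "\<lambda>h. h *\<^sub>R X" 0 G G'] \<gamma>(1,2) assms(2)
    by (simp add: has_vector_derivative_def o_def)
  moreover have "((\<lambda>t. G (\<gamma> t)) has_derivative (\<lambda>h. 0)) (at 0)"
  proof (rule has_derivative_transform_eventually[OF has_derivative_const])
    show "\<forall>\<^sub>F t in at 0. 0 = G (\<gamma> t)" using ev by eventually_elim (rule sym)
  qed (use \<gamma>(1) assms(3) in auto)
  ultimately have "(\<lambda>h. G' (h *\<^sub>R X)) = (\<lambda>h. 0)"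
    by (rule has_derivative_unique)
  from fun_cong[OF this, of 1] show ?thesis by simp
qed

text \<open>
  At \<open>q + tX + s\<eta>\<close> the function \<open>g\<close> equals \<open>s g'(\<eta>)\<close> up to an error that is small compared with \<open>t\<close>. So it
  has opposite signs at \<open>s = e|t|\<close> and \<open>s = -e|t|\<close>, and it vanishes in between.
\<close>

lemma level_set_zero_near_tangent:
  fixes g :: "'a::real_normed_vector \<Rightarrow> real"
  assumes "open S" "continuous_on S g" "q \<in> S" "(g has_derivative g') (at q)" "g q = 0"
    "g' X = 0" "g' \<eta> > 0" "e > 0"
  shows "\<forall>\<^sub>F t in at (0::real). \<exists>s. \<bar>s\<bar> \<le> e * \<bar>t\<bar> \<and> q + t *\<^sub>R X + s *\<^sub>R \<eta> \<in> S \<and> g (q + t *\<^sub>R X + s *\<^sub>R \<eta>) = 0"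
proof -
  define L where "L = norm X + e * norm \<eta> + 1"
  have "L > 0" using \<open>e > 0\<close> unfolding L_def by (simp add: add_nonneg_pos)
  define \<epsilon> where "\<epsilon> = e * g' \<eta> / L"
  have "\<epsilon> > 0" using assms(7,8) \<open>L > 0\<close> by (simp add: \<epsilon>_def)
  interpret g': bounded_linear g' using assms(4) by (rule has_derivative_bounded_linear)
  obtain d1 where d1: "d1 > 0" "\<And>y. norm (y - q) < d1 \<Longrightarrow> \<bar>g y - g' (y - q)\<bar> \<le> \<epsilon> * norm (y - q)"
    using assms(4,5) \<open>\<epsilon> > 0\<close> unfolding has_derivative_at_alt by auto
  obtain d2 where d2: "d2 > 0" "ball q d2 \<subseteq> S" using assms(1,3) openE by blast
  define d where "d = min d1 d2 / L"
  have "d > 0" using d1 d2 \<open>L > 0\<close> by (simp add: d_def)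
  have "\<exists>s. \<bar>s\<bar> \<le> e * \<bar>t\<bar> \<and> q + t *\<^sub>R X + s *\<^sub>R \<eta> \<in> S \<and> g (q + t *\<^sub>R X + s *\<^sub>R \<eta>) = 0"
    if t: "t \<noteq> 0" "\<bar>t\<bar> < d" for t
  proof -
    have small: "norm (t *\<^sub>R X + s *\<^sub>R \<eta>) < \<bar>t\<bar> * L" if "\<bar>s\<bar> \<le> e * \<bar>t\<bar>" for s
    proof -
      have "norm (t *\<^sub>R X + s *\<^sub>R \<eta>) \<le> \<bar>t\<bar> * norm X + \<bar>s\<bar> * norm \<eta>"
        by (metis norm_triangle_ineq norm_scaleR)
      also have "\<dots> \<le> \<bar>t\<bar> * norm X + e * \<bar>t\<bar> * norm \<eta>"
        using that by (intro add_mono mult_right_mono) auto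
      also have "\<dots> = \<bar>t\<bar> * (norm X + e * norm \<eta>)"
        by (simp add: algebra_simps)
      also have "\<dots> < \<bar>t\<bar> * L"
        unfolding L_def using t by (intro mult_strict_left_mono) auto
      finally show ?thesis .
    qed
    have "\<bar>t\<bar> * L < min d1 d2" using t(2) \<open>L > 0\<close> by (simp add: d_def pos_less_divide_eq)
    then have inS: "q + t *\<^sub>R X + s *\<^sub>R \<eta> \<in> S"
      and near: "norm (t *\<^sub>R X + s *\<^sub>R \<eta>) < d1" if "\<bar>s\<bar> \<le> e * \<bar>t\<bar>" for s
    proof -
      from small[OF that] \<open>\<bar>t\<bar> * L < min d1 d2\<close> have n: "norm (t *\<^sub>R X + s *\<^sub>R \<eta>) < d1" "norm (t *\<^sub>R X + s *\<^sub>R \<eta>) < d2" by auto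
      have "dist q (q + t *\<^sub>R X + s *\<^sub>R \<eta>) = norm (t *\<^sub>R X + s *\<^sub>R \<eta>)"
        by (metis add.assoc add_diff_cancel_left' dist_commute dist_norm)
      then show "q + t *\<^sub>R X + s *\<^sub>R \<eta> \<in> S" "norm (t *\<^sub>R X + s *\<^sub>R \<eta>) < d1" using n d2(2) by auto
    qed
    have est: "\<bar>g (q + t *\<^sub>R X + s *\<^sub>R \<eta>) - s * g' \<eta>\<bar> < e * g' \<eta> * \<bar>t\<bar>" if "\<bar>s\<bar> \<le> e * \<bar>t\<bar>" for s
    proof -
      have "\<bar>g (q + t *\<^sub>R X + s *\<^sub>R \<eta>) - g' (t *\<^sub>R X + s *\<^sub>R \<eta>)\<bar> \<le> \<epsilon> * norm (t *\<^sub>R X + s *\<^sub>R \<eta>)"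
        using d1(2)[of "q + t *\<^sub>R X + s *\<^sub>R \<eta>"] near[OF that] by (simp add: add.assoc)
      also have "\<dots> < \<epsilon> * (\<bar>t\<bar> * L)" using small[OF that] \<open>\<epsilon> > 0\<close> by (rule mult_strict_left_mono)
      also have "\<dots> = e * g' \<eta> * \<bar>t\<bar>" using \<open>L > 0\<close> by (simp add: \<epsilon>_def)
      finally show ?thesis by (simp add: g'.add g'.scaleR assms(6))
    qed
    have "\<exists>s\<ge>- (e * \<bar>t\<bar>). s \<le> e * \<bar>t\<bar> \<and> g (q + t *\<^sub>R X + s *\<^sub>R \<eta>) = 0"
    proof (rule IVT')
      show "- (e * \<bar>t\<bar>) \<le> e * \<bar>t\<bar>" using \<open>e > 0\<close> by simp
      show "g (q + t *\<^sub>R X + - (e * \<bar>t\<bar>) *\<^sub>R \<eta>) \<le> 0"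
        using est[of "- (e * \<bar>t\<bar>)"] \<open>e > 0\<close> by (simp add: abs_less_iff abs_mult algebra_simps)
      show "0 \<le> g (q + t *\<^sub>R X + (e * \<bar>t\<bar>) *\<^sub>R \<eta>)"
        using est[of "e * \<bar>t\<bar>"] \<open>e > 0\<close> by (simp add: abs_less_iff abs_mult algebra_simps)
      show "continuous_on {- (e * \<bar>t\<bar>)..e * \<bar>t\<bar>} (\<lambda>s. g (q + t *\<^sub>R X + s *\<^sub>R \<eta>))"
        by (rule continuous_on_compose2[OF assms(2)]) (auto intro!: continuous_intros inS)
    qed
    then obtain s where s: "- (e * \<bar>t\<bar>) \<le> s" "s \<le> e * \<bar>t\<bar>" "g (q + t *\<^sub>R X + s *\<^sub>R \<eta>) = 0" by blast
    then have "\<bar>s\<bar> \<le> e * \<bar>t\<bar>" by linarith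
    then show ?thesis using inS s(3) by blast
  qed
  then show ?thesis
    unfolding eventually_at using \<open>d > 0\<close> by (auto simp: dist_real_def)
qed

text \<open>
  This replaces the implicit function theorem. A curve in the level set with velocity \<open>X\<close> need not be
  continuous away from \<open>0\<close>, so it suffices to choose for each \<open>t\<close> a zero close to \<open>q + tX\<close>.
\<close>

lemma kernel_in_velocities:
  fixes g :: "'a::real_normed_vector \<Rightarrow> real"
  assumes "open S" "continuous_on S g" "q \<in> S" "(g has_derivative g') (at q)" "g q = 0"
    "g' X = 0" "g' \<eta> \<noteq> 0"
  shows "X \<in> velocities {y \<in> S. g y = 0} q"
proof -
  obtain \<zeta> where \<zeta>: "g' \<zeta> > 0"
  proof (cases "g' \<eta> > 0")
    case False
    have "linear g'" using assms(4) has_derivative_linear by blast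
    with False assms(7) have "g' (- \<eta>) > 0" by (simp add: linear_neg)
    then show ?thesis using that by blast
  qed (use that in blast)
  define Z where "Z t = {s. q + t *\<^sub>R X + s *\<^sub>R \<zeta> \<in> S \<and> g (q + t *\<^sub>R X + s *\<^sub>R \<zeta>) = 0}" for t
  have zeros: "\<forall>\<^sub>F t in at 0. \<exists>s\<in>Z t. \<bar>s\<bar> \<le> e * \<bar>t\<bar>" if "e > 0" for e
    using level_set_zero_near_tangent[OF assms(1-6) \<zeta> that] by eventually_elim (auto simp: Z_def)
  (* A zero whose distance from q + t X is within t^2 of the least one. The previous lemma, applied with
     each e > 0, then shows that s(t) is o(t). *)
  define s where "s t = (if t = 0 then 0 else SOME s. s \<in> Z t \<and> \<bar>s\<bar> < Inf (abs ` Z t) + t\<^sup>2)" for t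
  have s0: "s 0 = 0" by (simp add: s_def)
  have s: "s t \<in> Z t \<and> \<bar>s t\<bar> < Inf (abs ` Z t) + t\<^sup>2" if "t \<noteq> 0" "Z t \<noteq> {}" for t
  proof -
    have "\<exists>r\<in>abs ` Z t. r < Inf (abs ` Z t) + t\<^sup>2"
    proof (rule ccontr)
      assume "\<not> ?thesis"
      then have "Inf (abs ` Z t) + t\<^sup>2 \<le> Inf (abs ` Z t)"
        using that(2) by (intro cInf_greatest) (auto simp: not_less)
      then show False using that(1) by simp
    qed
    then have "\<exists>s. s \<in> Z t \<and> \<bar>s\<bar> < Inf (abs ` Z t) + t\<^sup>2" by blast
    from someI_ex[OF this] show ?thesis using that(1) by (simp add: s_def)
  qed
  have s_in: "\<forall>\<^sub>F t in at 0. s t \<in> Z t"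
    using zeros[OF zero_less_one] eventually_neq_at_within[of 0 0 UNIV]
    by eventually_elim (use s in blast)
  have "((\<lambda>t. s t / t) \<longlongrightarrow> 0) (at 0)"
  proof (rule tendstoI)
    fix e :: real assume "e > 0"
    have "\<forall>\<^sub>F t in at 0. \<bar>t\<bar> < e / 2"
      using \<open>e > 0\<close> unfolding eventually_at by (intro exI[of _ "e / 2"]) (auto simp: dist_real_def)
    then show "\<forall>\<^sub>F t in at 0. dist (s t / t) 0 < e"
      using zeros[OF half_gt_zero[OF \<open>e > 0\<close>]] eventually_neq_at_within[of 0 0 UNIV]
    proof (eventually_elim)
      case (elim t)
      then obtain r where r: "r \<in> Z t" "\<bar>r\<bar> \<le> e / 2 * \<bar>t\<bar>" by auto
      have "bdd_below (abs ` Z t)" by (intro bdd_belowI[of _ 0]) auto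
      then have "Inf (abs ` Z t) \<le> \<bar>r\<bar>" using r(1) by (intro cInf_lower) auto
      then have "\<bar>s t\<bar> < e / 2 * \<bar>t\<bar> + \<bar>t\<bar> * \<bar>t\<bar>"
        using s[of t] r elim(3) by (fastforce simp: power2_eq_square)
      also have "\<bar>t\<bar> * \<bar>t\<bar> \<le> e / 2 * \<bar>t\<bar>" using elim(1) by (intro mult_right_mono) auto
      finally have "\<bar>s t\<bar> < e * \<bar>t\<bar>" by simp
      then show ?case using elim(3) by (simp add: dist_real_def pos_divide_less_eq)
    qed
  qed
  then have "(s has_real_derivative 0) (at 0)"
    by (simp add: DERIV_def s0)
  then have "((\<lambda>t. q + t *\<^sub>R X + s t *\<^sub>R \<zeta>) has_vector_derivative X) (at 0)"
    by (auto intro!: derivative_eq_intros simp: has_real_derivative_iff_has_vector_derivative)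
  moreover have "\<forall>\<^sub>F t in at 0. q + t *\<^sub>R X + s t *\<^sub>R \<zeta> \<in> {y \<in> S. g y = 0}"
    using s_in by eventually_elim (simp add: Z_def)
  ultimately show ?thesis
    unfolding velocities_def by (intro CollectI exI[of _ "\<lambda>t. q + t *\<^sub>R X + s t *\<^sub>R \<zeta>"]) (simp add: s0)
qed

lemma isCont_tendsto_nhds: "isCont f q \<Longrightarrow> (f \<longlongrightarrow> f q) (nhds q)"
  by (simp add: isCont_def tendsto_at_iff_tendsto_nhds)

text \<open>
  From \<open>x\<close> one reaches a zero of \<open>g\<close> by moving along \<open>\<eta>\<close> over a parameter length of at most
  \<open>|g x| / a\<close>, where \<open>a\<close> is a lower bound for the derivative of \<open>g\<close> along \<open>\<eta>\<close>. At this zero \<open>u\<close>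
  vanishes, and on the way it changes by at most a constant times that length.
\<close>

lemma bounded_by_defining_function_aux:
  fixes g u :: "'a::euclidean_space \<Rightarrow> real"
  assumes "open S" "smooth_on S g" "smooth_on S u" "q \<in> S" "g q = 0" "\<partial> g q \<eta> > 0"
    "\<And>x. x \<in> S \<Longrightarrow> g x = 0 \<Longrightarrow> u x = 0"
  shows "\<exists>C. \<forall>\<^sub>F x in nhds q. \<bar>u x\<bar> \<le> C * \<bar>g x\<bar>"
proof -
  define a where "a = \<partial> g q \<eta> / 2"
  define M where "M = \<bar>\<partial> u q \<eta>\<bar> + 1"
  have "a > 0" using assms(6) by (simp add: a_def)
  have "\<eta> \<noteq> 0"
    using assms(6) linear_0[OF linear_dir_deriv[OF smooth_on_differentiable[OF assms(2,4)]]] by auto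
  have "\<forall>\<^sub>F y in nhds q. \<partial> g y \<eta> > a"
    by (rule order_tendstoD(1)[OF isCont_tendsto_nhds[OF smooth_on_isCont[OF smooth_on_dir_deriv[OF assms(2)] assms(4)]]])
      (use assms(6) in \<open>simp add: a_def\<close>)
  moreover have "\<forall>\<^sub>F y in nhds q. \<bar>\<partial> u y \<eta>\<bar> < M"
    by (rule order_tendstoD(2)[OF tendsto_rabs[OF isCont_tendsto_nhds[OF smooth_on_isCont[OF smooth_on_dir_deriv[OF assms(3)] assms(4)]]]])
      (simp add: M_def)
  moreover have "\<forall>\<^sub>F y in nhds q. y \<in> S" using assms(1,4) by (rule eventually_nhds_in_open)
  ultimately have "\<forall>\<^sub>F y in nhds q. y \<in> S \<and> \<partial> g y \<eta> > a \<and> \<bar>\<partial> u y \<eta>\<bar> < M"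
    by eventually_elim blast
  then obtain d where d: "d > 0" "\<And>y. dist y q < d \<Longrightarrow> y \<in> S \<and> \<partial> g y \<eta> > a \<and> \<bar>\<partial> u y \<eta>\<bar> < M"
    unfolding eventually_nhds_metric by blast
  define r where "r = d / 2"
  have "\<forall>\<^sub>F y in nhds q. \<bar>g y\<bar> < a * (r / norm \<eta>)"
    by (rule order_tendstoD(2)[OF tendsto_rabs[OF isCont_tendsto_nhds[OF smooth_on_isCont[OF assms(2,4)]]]])
      (use assms(5) \<open>a > 0\<close> \<open>\<eta> \<noteq> 0\<close> d(1) in \<open>simp add: r_def\<close>)
  moreover have "\<forall>\<^sub>F y in nhds q. dist y q < r"
    using d(1) unfolding eventually_nhds_metric r_def by (intro exI[of _ "d / 2"]) auto
  ultimately have "\<forall>\<^sub>F x in nhds q. \<bar>u x\<bar> \<le> M / a * \<bar>g x\<bar>"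
  proof (eventually_elim)
    case (elim x)
    define \<sigma> where "\<sigma> = \<bar>g x\<bar> / a"
    have "\<sigma> \<ge> 0" using \<open>a > 0\<close> by (simp add: \<sigma>_def)
    have "\<sigma> < r / norm \<eta>" using elim(1) \<open>a > 0\<close> by (simp add: \<sigma>_def pos_divide_less_eq mult.commute)
    then have \<sigma>r: "\<sigma> * norm \<eta> < r" using \<open>\<eta> \<noteq> 0\<close> by (simp add: pos_less_divide_eq)
    have near: "dist (x + s *\<^sub>R \<eta>) q < d" if "\<bar>s\<bar> \<le> \<sigma>" for s
    proof -
      have "dist (x + s *\<^sub>R \<eta>) q \<le> \<bar>s\<bar> * norm \<eta> + dist x q"
        using dist_triangle[of "x + s *\<^sub>R \<eta>" q x] by (simp add: dist_norm)
      moreover have "\<bar>s\<bar> * norm \<eta> \<le> \<sigma> * norm \<eta>" using that by (rule mult_right_mono) simp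
      ultimately show ?thesis using \<sigma>r elim(2) by (simp add: r_def)
    qed
    have dg: "((\<lambda>s. g (x + s *\<^sub>R \<eta>)) has_real_derivative \<partial> g (x + s *\<^sub>R \<eta>) \<eta>) (at s)"
      and du: "((\<lambda>s. u (x + s *\<^sub>R \<eta>)) has_real_derivative \<partial> u (x + s *\<^sub>R \<eta>) \<eta>) (at s)"
      if "\<bar>s\<bar> \<le> \<sigma>" for s
      using d(2)[OF near[OF that]] assms(2,3)
      by (auto intro!: has_real_derivative_along_line intro: smooth_on_differentiable)
    have inc: "g (x + \<sigma> *\<^sub>R \<eta>) \<ge> g x + \<sigma> * a" "g x - \<sigma> * a \<ge> g (x + (- \<sigma>) *\<^sub>R \<eta>)"
    proof -
      show "g (x + \<sigma> *\<^sub>R \<eta>) \<ge> g x + \<sigma> * a"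
      proof (cases "\<sigma> = 0")
        case False
        then have "0 < \<sigma>" using \<open>\<sigma> \<ge> 0\<close> by simp
        from MVT2[OF this, of "\<lambda>s. g (x + s *\<^sub>R \<eta>)" "\<lambda>s. \<partial> g (x + s *\<^sub>R \<eta>) \<eta>"] dg
        obtain z where z: "0 < z" "z < \<sigma>" "g (x + \<sigma> *\<^sub>R \<eta>) - g (x + 0 *\<^sub>R \<eta>) = (\<sigma> - 0) * \<partial> g (x + z *\<^sub>R \<eta>) \<eta>" by auto
        have "\<sigma> * a \<le> \<sigma> * \<partial> g (x + z *\<^sub>R \<eta>) \<eta>"
          using d(2)[OF near[of z]] z \<open>0 < \<sigma>\<close> by (intro mult_left_mono) auto
        then show ?thesis using z(3) by simp
      qed simp
      show "g x - \<sigma> * a \<ge> g (x + (- \<sigma>) *\<^sub>R \<eta>)"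
      proof (cases "\<sigma> = 0")
        case False
        then have "- \<sigma> < 0" using \<open>\<sigma> \<ge> 0\<close> by simp
        from MVT2[OF this, of "\<lambda>s. g (x + s *\<^sub>R \<eta>)" "\<lambda>s. \<partial> g (x + s *\<^sub>R \<eta>) \<eta>"] dg
        obtain z where z: "- \<sigma> < z" "z < 0" "g (x + 0 *\<^sub>R \<eta>) - g (x + (- \<sigma>) *\<^sub>R \<eta>) = (0 - - \<sigma>) * \<partial> g (x + z *\<^sub>R \<eta>) \<eta>" by auto
        have "\<sigma> * a \<le> \<sigma> * \<partial> g (x + z *\<^sub>R \<eta>) \<eta>"
          using d(2)[OF near[of z]] z \<open>- \<sigma> < 0\<close> by (intro mult_left_mono) auto
        then show ?thesis using z(3) by simp
      qed simp
    qed
    have \<sigma>a: "\<sigma> * a = \<bar>g x\<bar>" using \<open>a > 0\<close> by (simp add: \<sigma>_def)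
    have "\<exists>s\<ge>- \<sigma>. s \<le> \<sigma> \<and> g (x + s *\<^sub>R \<eta>) = 0"
    proof (rule IVT')
      show "continuous_on {- \<sigma>..\<sigma>} (\<lambda>s. g (x + s *\<^sub>R \<eta>))"
        by (intro continuous_at_imp_continuous_on ballI DERIV_isCont[OF dg]) (simp add: abs_le_iff)
    qed (use inc \<sigma>a \<open>\<sigma> \<ge> 0\<close> in auto)
    then obtain s where s': "- \<sigma> \<le> s" "s \<le> \<sigma>" and s0: "g (x + s *\<^sub>R \<eta>) = 0" by blast
    from s' have "\<bar>s\<bar> \<le> \<sigma>" by linarith
    note s = this s0
    have "u (x + s *\<^sub>R \<eta>) = 0" using assms(7) s d(2) near by blast
    define \<psi> where "\<psi> s = u (x + s *\<^sub>R \<eta>)" for s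
    define \<psi>' where "\<psi>' s = \<partial> u (x + s *\<^sub>R \<eta>) \<eta>" for s
    have range: "\<bar>z\<bar> \<le> \<sigma>" if "z \<in> {- \<sigma>..\<sigma>}" for z using that by (simp add: abs_le_iff)
    have "(\<psi> has_field_derivative \<psi>' z) (at z within {- \<sigma>..\<sigma>})" if "z \<in> {- \<sigma>..\<sigma>}" for z
      unfolding \<psi>_def \<psi>'_def by (rule has_field_derivative_at_within[OF du[OF range[OF that]]])
    moreover have "norm (\<psi>' z) \<le> M" if "z \<in> {- \<sigma>..\<sigma>}" for z
      using d(2)[OF near[OF range[OF that]]] by (simp add: \<psi>'_def)
    moreover have "0 \<in> {- \<sigma>..\<sigma>}" "s \<in> {- \<sigma>..\<sigma>}" using s' by simp_all
    ultimately have "norm (\<psi> 0 - \<psi> s) \<le> M * norm (0 - s)"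
      by (rule field_differentiable_bound[OF convex_real_interval(5)])
    then have "\<bar>u x\<bar> \<le> M * \<bar>s\<bar>" using \<open>u (x + s *\<^sub>R \<eta>) = 0\<close> by (simp add: \<psi>_def)
    also have "\<dots> \<le> M * \<sigma>" using s(1) by (intro mult_left_mono) (auto simp: M_def)
    finally show ?case by (simp add: \<sigma>_def)
  qed
  then show ?thesis by blast
qed

lemma bounded_by_defining_function:
  fixes g u :: "'a::euclidean_space \<Rightarrow> real"
  assumes "open S" "smooth_on S g" "smooth_on S u" "q \<in> S" "g q = 0" "\<partial> g q \<eta> \<noteq> 0"
    "\<And>x. x \<in> S \<Longrightarrow> g x = 0 \<Longrightarrow> u x = 0"
  shows "\<exists>C. \<forall>\<^sub>F x in nhds q. \<bar>u x\<bar> \<le> C * \<bar>g x\<bar>"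
proof (cases "\<partial> g q \<eta> > 0")
  case False
  then have "\<partial> g q (- \<eta>) > 0"
    using assms(6) linear_neg[OF linear_dir_deriv[OF smooth_on_differentiable[OF assms(2,4)]]] by simp
  then show ?thesis using bounded_by_defining_function_aux[OF assms(1-5) _ assms(7)] by blast
qed (use bounded_by_defining_function_aux[OF assms(1-5) _ assms(7)] in blast)

section \<open>Fold points: the curvature along the null direction\<close>

lemma exists_basis_with_row:
  assumes "\<eta> \<noteq> (0 :: real ^ 'm::finite)"
  obtains A :: "real ^ 'm ^ 'm" and k where "A $ k = \<eta>" "det A \<noteq> 0"
proof -
  obtain k where k: "\<eta> $ k \<noteq> 0" using assms by (metis vec_eq_iff zero_index)
  define A :: "real ^ 'm ^ 'm" where
    "A = (\<chi> i. if i = k then \<Sum>i\<in>UNIV. \<eta> $ i *s row i (mat 1) else row i (mat 1))"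
  have "det A = \<eta> $ k" unfolding A_def by (subst cramer_lemma_transpose) simp
  moreover have "A $ k = \<eta>"
    by (simp add: A_def vec_eq_iff row_def mat_def if_distrib cong: if_cong)
  ultimately show ?thesis using that k by metis
qed

context local_front
begin

lemma ray_in_dom: "q \<in> \<Omega> \<Longrightarrow> \<forall>\<^sub>F t in at 0. q + t *\<^sub>R v \<in> \<Omega>"
  using tendsto_ray[of q v] open_dom topological_tendstoD by blast

text \<open>
  In a basis \<open>A\<close> with \<open>\<eta>\<close> in position \<open>k\<close>, the row \<open>k\<close> of the frame matrix at \<open>q + t\<eta>\<close> is \<open>dF(\<eta>)\<close>, which vanishes
  at \<open>t = 0\<close>. So \<open>\<lambda>/t\<close> is, up to the factor \<open>det A\<close>, the determinant with this row divided by \<open>t\<close>, and in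
  the limit the row becomes the second derivative of \<open>F\<close> along \<open>\<eta>\<close>. Thus \<open>d\<lambda>(\<eta>) \<noteq> 0\<close> says that the
  image of \<open>dF\<close> is a hyperplane in the orthogonal complement of \<open>N\<close> and does not contain this second derivative.
\<close>

lemma density_deriv:
  assumes "q \<in> \<Omega>" "\<partial> F q \<eta> = 0" "A $ k = \<eta>" "det A \<noteq> 0"
  shows "density q = 0"
    and "det A * \<partial> density q \<eta> = det (frame_matrix ((\<lambda>i. \<partial> F q (A $ i))(k := hess q \<eta> \<eta>)) (N q))"
proof -
  have "det A * density q = det (frame_matrix ((\<lambda>i. \<partial> F q (A $ i))(k := 0 *\<^sub>R \<partial> F q (A $ k))) (N q))"
  proof -
    have "(\<lambda>i. \<partial> F q (A $ i))(k := 0 *\<^sub>R \<partial> F q (A $ k)) = (\<lambda>i. \<partial> F q (A $ i))"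
      using assms(2,3) by (auto simp: fun_eq_iff)
    then show ?thesis using density_change_of_basis[OF assms(1), of A] by simp
  qed
  also have "\<dots> = 0" by (subst det_frame_matrix_scale) simp
  finally show d0: "density q = 0" using assms(4) by simp
  let ?row = "\<lambda>t i. \<partial> F (q + t *\<^sub>R \<eta>) (A $ i)"
  have "((\<lambda>t. det (frame_matrix ((?row t)(k := ?row t k /\<^sub>R t)) (N (q + t *\<^sub>R \<eta>))))
      \<longlongrightarrow> det (frame_matrix ((\<lambda>i. \<partial> F q (A $ i))(k := hess q \<eta> \<eta>)) (N q))) (at 0)"
  proof (rule tendsto_det)
    fix i :: "'m option"
    show "((\<lambda>t. frame_matrix ((?row t)(k := ?row t k /\<^sub>R t)) (N (q + t *\<^sub>R \<eta>)) $ i)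
      \<longlongrightarrow> frame_matrix ((\<lambda>i. \<partial> F q (A $ i))(k := hess q \<eta> \<eta>)) (N q) $ i) (at 0)"
    proof (cases i)
      case None
      then show ?thesis
        using isCont_tendsto_compose[OF smooth_on_isCont[OF smooth_N assms(1)] tendsto_ray] by simp
    next
      case (Some j)
      show ?thesis
      proof (cases "j = k")
        case True
        then show ?thesis
          using Some assms(2,3) tendsto_ray_quotient[of "\<lambda>y. \<partial> F y \<eta>" q \<eta>]
            smooth_on_differentiable[OF smooth_dF assms(1)] by (simp add: hess_def)
      next
        case False
        then show ?thesis
          using Some tendsto_dir_deriv[OF open_dom smooth_F assms(1) tendsto_ray tendsto_const] by simp
      qed
    qed
  qed
  note frame_limit = this
  have density_limit: "((\<lambda>t. det A * (density (q + t *\<^sub>R \<eta>) /\<^sub>R t)) \<longlongrightarrow> det A * \<partial> density q \<eta>) (at 0)"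
    by (intro tendsto_mult tendsto_const tendsto_ray_quotient d0
        smooth_on_differentiable[OF smooth_density assms(1)])
  have "\<forall>\<^sub>F t in at 0. det A * (density (q + t *\<^sub>R \<eta>) /\<^sub>R t)
      = det (frame_matrix ((?row t)(k := ?row t k /\<^sub>R t)) (N (q + t *\<^sub>R \<eta>)))"
    using ray_in_dom[OF assms(1), of \<eta>]
  proof eventually_elim
    case (elim t)
    then show ?case
      using det_frame_matrix_scale[of "?row t" k "inverse t" "N (q + t *\<^sub>R \<eta>)"]
        density_change_of_basis[OF elim, of A] by (simp add: mult.commute)
  qed
  from Lim_transform_eventually[OF density_limit this] frame_limit
  show "det A * \<partial> density q \<eta> = det (frame_matrix ((\<lambda>i. \<partial> F q (A $ i))(k := hess q \<eta> \<eta>)) (N q))"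
    by (rule tendsto_unique[OF trivial_limit_at])
qed

text \<open>
  The consequences of \<open>d\<lambda>(\<eta>) \<noteq> 0\<close> at a null vector \<open>\<eta>\<close> that the limits along the ray \<open>q + t\<eta>\<close> require. In
  this form they carry over to every other normal field of the same front.
\<close>

definition fold_at :: "real ^ 'm \<Rightarrow> real ^ 'm \<Rightarrow> bool" where
  "fold_at q \<eta> \<longleftrightarrow> q \<in> \<Omega> \<and> \<eta> \<noteq> 0 \<and> \<partial> F q \<eta> = 0 \<and>
     (\<forall>z. (\<forall>X. \<partial> F q X \<bullet> z = 0) \<longrightarrow> hess q \<eta> \<eta> \<bullet> z = 0 \<longrightarrow> N q \<bullet> z = 0 \<longrightarrow> z = 0) \<and>
     (\<forall>\<^sub>F t in at 0. regular (q + t *\<^sub>R \<eta>))"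

lemma
  assumes "q \<in> \<Omega>" "\<eta> \<noteq> 0" "\<partial> F q \<eta> = 0" "\<partial> density q \<eta> \<noteq> 0"
  shows transversal_imp_fold: "fold_at q \<eta>"
    and transversal_kernel: "\<And>X. \<partial> F q X = 0 \<Longrightarrow> \<exists>c. X = c *\<^sub>R \<eta>"
proof -
  obtain A :: "real ^ 'm ^ 'm" and k where A: "A $ k = \<eta>" "det A \<noteq> 0"
    using exists_basis_with_row[OF assms(2)] by blast
  note dens = density_deriv[OF assms(1,3) A]
  then have frame: "det (frame_matrix ((\<lambda>i. \<partial> F q (A $ i))(k := hess q \<eta> \<eta>)) (N q)) \<noteq> 0"
    using A(2) assms(4) by (metis mult_eq_0_iff)
  have "z = 0" if "\<And>X. \<partial> F q X \<bullet> z = 0" "hess q \<eta> \<eta> \<bullet> z = 0" "N q \<bullet> z = 0" for z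
    by (rule orthogonal_to_frame_eq_0[OF frame]) (use that in auto)
  moreover have "\<forall>\<^sub>F t in at 0. density (q + t *\<^sub>R \<eta>) /\<^sub>R t \<noteq> 0"
    by (rule tendsto_imp_eventually_ne[OF tendsto_ray_quotient assms(4)])
      (use dens smooth_on_differentiable[OF smooth_density assms(1)] in auto)
  then have "\<forall>\<^sub>F t in at 0. regular (q + t *\<^sub>R \<eta>)"
    using ray_in_dom[OF assms(1), of \<eta>] by eventually_elim (auto simp: regular_iff_density)
  ultimately show "fold_at q \<eta>" unfolding fold_at_def using assms by blast
  fix X assume X: "\<partial> F q X = 0"
  have "invertible (transpose A)" using A(2) by (simp add: invertible_det_nz)
  then obtain c where "transpose A *v c = X"
    by (metis invertible_def matrix_vector_mul_assoc matrix_vector_mul_lid)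
  then have c: "X = (\<Sum>i\<in>UNIV. c $ i *\<^sub>R A $ i)"
    unfolding matrix_mult_sum by (simp add: row_def vec_eq_iff scalar_mult_eq_scaleR column_def transpose_def)
  have "\<partial> F q X = (\<Sum>i\<in>UNIV. c $ i *\<^sub>R \<partial> F q (A $ i))"
    unfolding c using linear_F[OF assms(1)] by (simp add: linear_sum linear_cmul)
  also have "\<dots> = (\<Sum>i\<in>UNIV. (if i = k then 0 else c $ i) *\<^sub>R ((\<lambda>i. \<partial> F q (A $ i))(k := hess q \<eta> \<eta>)) i)"
    using A(1) assms(3) by (intro sum.cong) auto
  finally have "0 *\<^sub>R N q + (\<Sum>i\<in>UNIV. (if i = k then 0 else c $ i) *\<^sub>R ((\<lambda>i. \<partial> F q (A $ i))(k := hess q \<eta> \<eta>)) i) = 0"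
    using X by simp
  from frame_independent(1)[OF frame this] have "c $ i = 0" if "i \<noteq> k" for i using that by metis
  then have "X = (\<Sum>i\<in>UNIV. if i = k then c $ k *\<^sub>R A $ k else 0)"
    unfolding c by (intro sum.cong) auto
  then show "\<exists>c. X = c *\<^sub>R \<eta>" using A(1) by auto
qed

end

text \<open>
  Both normals are orthogonal to the image of \<open>dF\<close> and to the second derivative along \<open>\<eta>\<close>. By the fold
  condition the vectors with this property form a line.
\<close>

lemma fold_at_change_normal:
  assumes "local_front \<Omega> F N" "local_front \<Omega>' F N'" "local_front.fold_at \<Omega> F N q \<eta>" "q \<in> \<Omega>'"
  shows "local_front.fold_at \<Omega>' F N' q \<eta>"
proof -
  interpret a: local_front \<Omega> F N by fact
  interpret b: local_front \<Omega>' F N' by fact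
  have q: "q \<in> \<Omega>" "\<partial> F q \<eta> = 0" using assms(3) by (auto simp: a.fold_at_def)
  have span: "z = 0" if "\<And>X. \<partial> F q X \<bullet> z = 0" "a.hess q \<eta> \<eta> \<bullet> z = 0" "N q \<bullet> z = 0" for z
    using assms(3) that unfolding a.fold_at_def by blast
  have perp: "a.hess q \<eta> \<eta> \<bullet> N q = 0" "a.hess q \<eta> \<eta> \<bullet> N' q = 0"
    using a.normal_deriv[OF q(1), of \<eta> \<eta>] b.normal_deriv[OF assms(4), of \<eta> \<eta>] q by auto
  define z' where "z' = N' q - (N' q \<bullet> N q) *\<^sub>R N q"
  have "z' = 0"
  proof (rule span)
    show "\<partial> F q X \<bullet> z' = 0" for X
      using a.normal[OF q(1), of X] b.normal[OF assms(4), of X] by (simp add: z'_def inner_diff_right)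
    show "a.hess q \<eta> \<eta> \<bullet> z' = 0" using perp by (simp add: z'_def inner_diff_right)
    show "N q \<bullet> z' = 0"
      using a.N_unit[OF q(1)] by (simp add: z'_def inner_diff_right inner_commute)
  qed
  then have N': "N' q = (N' q \<bullet> N q) *\<^sub>R N q" by (simp add: z'_def)
  have "v \<bullet> N q = 0" if "v \<bullet> N' q = 0" for v
  proof -
    have "(N' q \<bullet> N q) * (v \<bullet> N q) = 0" using that N' by (metis inner_scaleR_right)
    moreover have "N' q \<bullet> N q \<noteq> 0" using N' b.N_unit[OF assms(4)] by auto
    ultimately show ?thesis by simp
  qed
  then have "N q \<bullet> z = 0" if "N' q \<bullet> z = 0" for z using that by (metis inner_commute)
  then show ?thesis
    using assms(3,4) unfolding a.fold_at_def b.fold_at_def by blast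
qed

lemma gram_eq_orthogonal_part:
  fixes v w :: "'b::real_inner"
  assumes "v \<noteq> 0" "c = (v \<bullet> w) / (v \<bullet> v)"
  shows "(v \<bullet> v) * (w \<bullet> w) - (v \<bullet> w)\<^sup>2 = (v \<bullet> v) * ((w - c *\<^sub>R v) \<bullet> (w - c *\<^sub>R v))"
proof -
  have "v \<bullet> v > 0" using assms(1) by simp
  then show ?thesis
    by (simp add: assms(2) inner_diff_left inner_diff_right inner_commute field_simps power2_eq_square)
qed

lemma inner_gram_pos:
  fixes v w :: "'b::real_inner"
  assumes "v \<noteq> 0" "\<And>c. w \<noteq> c *\<^sub>R v"
  shows "(v \<bullet> v) * (w \<bullet> w) - (v \<bullet> w)\<^sup>2 > 0"
  unfolding gram_eq_orthogonal_part[OF assms(1) refl]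
  using assms by (intro mult_pos_pos) auto

context local_front
begin

lemma tendsto_F_ray: "q \<in> \<Omega> \<Longrightarrow> ((\<lambda>t. \<partial> F (q + t *\<^sub>R \<eta>) X) \<longlongrightarrow> \<partial> F q X) (at 0)"
  by (rule tendsto_dir_deriv[OF open_dom smooth_F _ tendsto_ray tendsto_const])

lemma tendsto_N_ray: "q \<in> \<Omega> \<Longrightarrow> ((\<lambda>t. \<partial> N (q + t *\<^sub>R \<eta>) X) \<longlongrightarrow> \<partial> N q X) (at 0)"
  by (rule tendsto_dir_deriv[OF open_dom smooth_N _ tendsto_ray tendsto_const])

lemma tendsto_F_null_ray:
  "q \<in> \<Omega> \<Longrightarrow> \<partial> F q \<eta> = 0 \<Longrightarrow> ((\<lambda>t. \<partial> F (q + t *\<^sub>R \<eta>) \<eta> /\<^sub>R t) \<longlongrightarrow> hess q \<eta> \<eta>) (at 0)"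
  unfolding hess_def
  by (rule tendsto_ray_quotient[OF smooth_on_differentiable[OF smooth_dF]])

lemma tendsto_sff_ray: "q \<in> \<Omega> \<Longrightarrow> ((\<lambda>t. sff (q + t *\<^sub>R \<eta>) X Y) \<longlongrightarrow> sff q X Y) (at 0)"
  using isCont_tendsto_compose[OF smooth_on_isCont[OF smooth_sff] tendsto_ray] .

lemma fold_regular_ray: "fold_at q \<eta> \<Longrightarrow> \<forall>\<^sub>F t in at 0. regular (q + t *\<^sub>R \<eta>)"
  by (simp add: fold_at_def)

text \<open>
  The vector \<open>dN(\<eta>)\<close> is not zero, because \<open>(F, N)\<close> is an immersion. By the symmetry of the second
  fundamental form it is orthogonal to the image of \<open>dF\<close>, and it is orthogonal to \<open>N\<close>. So the fold
  condition excludes that it is orthogonal to the second derivative along \<open>\<eta>\<close> as well.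
\<close>

lemma fold_normal_deriv:
  assumes "fold_at q \<eta>"
  shows "hess q \<eta> \<eta> \<bullet> \<partial> N q \<eta> \<noteq> 0"
proof
  note f = assms[unfolded fold_at_def]
  have q: "q \<in> \<Omega>" "\<partial> F q \<eta> = 0" using f by blast+
  assume 0: "hess q \<eta> \<eta> \<bullet> \<partial> N q \<eta> = 0"
  have 1: "\<partial> F q X \<bullet> \<partial> N q \<eta> = 0" for X
    using sff_sym[OF q(1), of X \<eta>] q(2) by (simp add: sff_def)
  have 2: "N q \<bullet> \<partial> N q \<eta> = 0" using dN_tangent[OF q(1), of \<eta>] by (simp add: inner_commute)
  have "\<partial> N q \<eta> = 0" using f 0 1 2 by blast
  then have "\<eta> = 0" using immersion[OF q] by blast
  then show False using f by blast
qed

text \<open>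
  Numerator and denominator of the sectional curvature in the Gauss equation.
\<close>

definition plane_num :: "real ^ 'm \<Rightarrow> real ^ 'm \<Rightarrow> real ^ 'm \<Rightarrow> real" where
  "plane_num x X Y = sff x X X * sff x Y Y - (sff x X Y)\<^sup>2"

definition plane_den :: "real ^ 'm \<Rightarrow> real ^ 'm \<Rightarrow> real ^ 'm \<Rightarrow> real" where
  "plane_den x X Y = metric x X X * metric x Y Y - (metric x X Y)\<^sup>2"

lemma fold_plane_den_limit:
  assumes "fold_at q \<eta>" "\<partial> F q X \<noteq> 0"
  shows "\<exists>b>0. ((\<lambda>t. plane_den (q + t *\<^sub>R \<eta>) X \<eta> / t\<^sup>2) \<longlongrightarrow> b) (at 0)"
proof (intro exI conjI)
  have q: "q \<in> \<Omega>" "\<partial> F q \<eta> = 0" using assms(1) by (auto simp: fold_at_def)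
  let ?v = "\<partial> F q X" and ?w = "hess q \<eta> \<eta>"
  have "?w \<noteq> c *\<^sub>R ?v" for c
  proof
    assume "?w = c *\<^sub>R ?v"
    then have "?w \<bullet> \<partial> N q \<eta> = c * (?v \<bullet> \<partial> N q \<eta>)" by simp
    also have "?v \<bullet> \<partial> N q \<eta> = 0" using sff_sym[OF q(1), of X \<eta>] q(2) by (simp add: sff_def)
    finally show False using fold_normal_deriv[OF assms(1)] by simp
  qed
  then show "(?v \<bullet> ?v) * (?w \<bullet> ?w) - (?v \<bullet> ?w)\<^sup>2 > 0" by (rule inner_gram_pos[OF assms(2)])
  let ?L = "\<lambda>t. \<partial> F (q + t *\<^sub>R \<eta>)"
  have "((\<lambda>t. (?L t X \<bullet> ?L t X) * ((?L t \<eta> /\<^sub>R t) \<bullet> (?L t \<eta> /\<^sub>R t)) - (?L t X \<bullet> (?L t \<eta> /\<^sub>R t))\<^sup>2)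
      \<longlongrightarrow> (?v \<bullet> ?v) * (?w \<bullet> ?w) - (?v \<bullet> ?w)\<^sup>2) (at 0)"
    by (intro tendsto_intros tendsto_F_ray[OF q(1)] tendsto_F_null_ray[OF q])
  moreover have "\<forall>\<^sub>F t in at 0. (?L t X \<bullet> ?L t X) * ((?L t \<eta> /\<^sub>R t) \<bullet> (?L t \<eta> /\<^sub>R t)) - (?L t X \<bullet> (?L t \<eta> /\<^sub>R t))\<^sup>2
      = plane_den (q + t *\<^sub>R \<eta>) X \<eta> / t\<^sup>2"
    using eventually_neq_at_within[of 0 0 UNIV]
    by eventually_elim (simp add: plane_den_def metric_def field_simps power2_eq_square)
  ultimately show "((\<lambda>t. plane_den (q + t *\<^sub>R \<eta>) X \<eta> / t\<^sup>2) \<longlongrightarrow> (?v \<bullet> ?v) * (?w \<bullet> ?w) - (?v \<bullet> ?w)\<^sup>2) (at 0)"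
    by (rule Lim_transform_eventually)
qed

text \<open>
  Of the two terms of the numerator, the first is \<open>t\<close> times a function with limit a nonzero multiple of
  \<open>II(X,X)\<close>, and the second is of order \<open>t\<^sup>2\<close>. The denominator is of exact order \<open>t\<^sup>2\<close>.
\<close>

lemma fold_curvature_limit:
  assumes "fold_at q \<eta>" "\<partial> F q X \<noteq> 0"
  shows "\<exists>c. c \<noteq> 0 \<and> ((\<lambda>t. t * sectional_curvature metric (q + t *\<^sub>R \<eta>) X \<eta>) \<longlongrightarrow> c * sff q X X) (at 0)"
proof -
  have q: "q \<in> \<Omega>" "\<partial> F q \<eta> = 0" using assms(1) by (auto simp: fold_at_def)
  obtain b where b: "b > 0" "((\<lambda>t. plane_den (q + t *\<^sub>R \<eta>) X \<eta> / t\<^sup>2) \<longlongrightarrow> b) (at 0)"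
    using fold_plane_den_limit[OF assms] by blast
  define a where "a = - (hess q \<eta> \<eta> \<bullet> \<partial> N q \<eta>)"
  have "a \<noteq> 0" using fold_normal_deriv[OF assms(1)] by (simp add: a_def)
  let ?x = "\<lambda>t. q + t *\<^sub>R \<eta>"
  let ?w = "\<lambda>t. \<partial> F (?x t) \<eta> /\<^sub>R t"
  have "((\<lambda>t. sff (?x t) X X * - (?w t \<bullet> \<partial> N (?x t) \<eta>) - t * (?w t \<bullet> \<partial> N (?x t) X)\<^sup>2)
      \<longlongrightarrow> sff q X X * - (hess q \<eta> \<eta> \<bullet> \<partial> N q \<eta>) - 0 * (hess q \<eta> \<eta> \<bullet> \<partial> N q X)\<^sup>2) (at 0)"
    by (intro tendsto_intros tendsto_N_ray[OF q(1)] tendsto_F_null_ray[OF q] tendsto_sff_ray[OF q(1)])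
  then have "((\<lambda>t. (sff (?x t) X X * - (?w t \<bullet> \<partial> N (?x t) \<eta>) - t * (?w t \<bullet> \<partial> N (?x t) X)\<^sup>2)
      / (plane_den (?x t) X \<eta> / t\<^sup>2)) \<longlongrightarrow> sff q X X * a / b) (at 0)"
    using b by (intro tendsto_divide) (simp_all add: a_def)
  moreover have "\<forall>\<^sub>F t in at 0. (sff (?x t) X X * - (?w t \<bullet> \<partial> N (?x t) \<eta>) - t * (?w t \<bullet> \<partial> N (?x t) X)\<^sup>2)
      / (plane_den (?x t) X \<eta> / t\<^sup>2) = t * sectional_curvature metric (?x t) X \<eta>"
    using eventually_neq_at_within[of 0 0 UNIV] ray_in_dom[OF q(1), of \<eta>]
      fold_regular_ray[OF assms(1)]
  proof eventually_elim
    case (elim t)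
    have "sff (?x t) X \<eta> = - t * (?w t \<bullet> \<partial> N (?x t) X)"
      using sff_sym[OF elim(2), of X \<eta>] elim(1) by (simp add: sff_def)
    moreover have "sff (?x t) \<eta> \<eta> = - t * (?w t \<bullet> \<partial> N (?x t) \<eta>)"
      using elim(1) by (simp add: sff_def)
    ultimately have "sectional_curvature metric (?x t) X \<eta>
        = (sff (?x t) X X * (- t * (?w t \<bullet> \<partial> N (?x t) \<eta>)) - (- t * (?w t \<bullet> \<partial> N (?x t) X))\<^sup>2) / plane_den (?x t) X \<eta>"
      using sectional_curvature_eq[OF elim(2,3), of X \<eta>] by (simp add: plane_den_def)
    moreover have "(s * - w - t * u\<^sup>2) / (d / t\<^sup>2) = t * ((s * (- t * w) - (- t * u)\<^sup>2) / d)" for s w u d :: real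
      using elim(1) by (cases "d = 0") (simp_all add: field_simps power2_eq_square)
    ultimately show ?case by simp
  qed
  ultimately have "((\<lambda>t. t * sectional_curvature metric (?x t) X \<eta>) \<longlongrightarrow> sff q X X * a / b) (at 0)"
    by (rule Lim_transform_eventually)
  then show ?thesis using \<open>a \<noteq> 0\<close> b(1) by (intro exI[of _ "a / b"]) (simp add: mult.commute)
qed

lemma sff_polarization:
  assumes "q \<in> \<Omega>" "\<And>X. sff q X X = 0"
  shows "sff q X Y = 0"
proof -
  have "sff q (X + Y) (X + Y) = sff q X X + sff q X Y + sff q Y X + sff q Y Y"
    using linear_add[OF linear_F[OF assms(1)]] linear_add[OF linear_N[OF assms(1)]]
    by (simp add: sff_def inner_add_left inner_add_right)
  then show ?thesis using assms sff_sym[OF assms(1), of X Y] by simp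
qed

lemma sff_null: "\<partial> F q X = 0 \<Longrightarrow> sff q X Y = 0"
  by (simp add: sff_def)

lemma fold_sff_eq_0_if_bounded:
  assumes "fold_at q \<eta>"
    "\<And>X. \<partial> F q X \<noteq> 0 \<Longrightarrow> \<forall>\<^sub>F t in at 0. \<bar>sectional_curvature metric (q + t *\<^sub>R \<eta>) X \<eta>\<bar> \<le> C"
  shows "sff q X Y = 0"
proof (rule sff_polarization)
  show "q \<in> \<Omega>" using assms(1) by (simp add: fold_at_def)
  fix X show "sff q X X = 0"
  proof (cases "\<partial> F q X = 0")
    case False
    then obtain c where c: "c \<noteq> 0"
      "((\<lambda>t. t * sectional_curvature metric (q + t *\<^sub>R \<eta>) X \<eta>) \<longlongrightarrow> c * sff q X X) (at 0)"
      using fold_curvature_limit[OF assms(1)] by blast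
    have "((\<lambda>t. t * sectional_curvature metric (q + t *\<^sub>R \<eta>) X \<eta>) \<longlongrightarrow> 0) (at 0)"
    proof (rule Lim_null_comparison)
      show "\<forall>\<^sub>F t in at 0. norm (t * sectional_curvature metric (q + t *\<^sub>R \<eta>) X \<eta>) \<le> \<bar>t\<bar> * C"
        using assms(2)[OF False] by eventually_elim (simp add: abs_mult mult_left_mono)
      have "((\<lambda>t. \<bar>t\<bar> * C) \<longlongrightarrow> \<bar>0\<bar> * C) (at (0::real))" by (intro tendsto_intros)
      then show "((\<lambda>t. \<bar>t\<bar> * C) \<longlongrightarrow> 0) (at (0::real))" by simp
    qed
    from tendsto_unique[OF trivial_limit_at c(2) this] show ?thesis using c(1) by simp
  qed (simp add: sff_null)
qed

text \<open>
  The factor \<open>t\<close> changes sign at the singular point, so the limit of \<open>t K\<close> is both non-negative and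
  non-positive.
\<close>

lemma fold_sff_eq_0_if_nonneg:
  assumes "fold_at q \<eta>"
    "\<And>X. \<partial> F q X \<noteq> 0 \<Longrightarrow> \<forall>\<^sub>F t in at 0. 0 \<le> sectional_curvature metric (q + t *\<^sub>R \<eta>) X \<eta>"
  shows "sff q X Y = 0"
proof (rule sff_polarization)
  show "q \<in> \<Omega>" using assms(1) by (simp add: fold_at_def)
  fix X show "sff q X X = 0"
  proof (cases "\<partial> F q X = 0")
    case False
    then obtain c where c: "c \<noteq> 0"
      "((\<lambda>t. t * sectional_curvature metric (q + t *\<^sub>R \<eta>) X \<eta>) \<longlongrightarrow> c * sff q X X) (at 0)"
      using fold_curvature_limit[OF assms(1)] by blast
    have lim: "((\<lambda>t. t * sectional_curvature metric (q + t *\<^sub>R \<eta>) X \<eta>) \<longlongrightarrow> c * sff q X X) (at_right 0)"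
      "((\<lambda>t. t * sectional_curvature metric (q + t *\<^sub>R \<eta>) X \<eta>) \<longlongrightarrow> c * sff q X X) (at_left 0)"
      using c(2) filterlim_at_split by blast+
    have nonneg: "\<forall>\<^sub>F t in at_right 0. 0 \<le> sectional_curvature metric (q + t *\<^sub>R \<eta>) X \<eta>"
      "\<forall>\<^sub>F t in at_left 0. 0 \<le> sectional_curvature metric (q + t *\<^sub>R \<eta>) X \<eta>"
      using assms(2)[OF False] by (simp_all add: eventually_at_split)
    have "0 \<le> c * sff q X X"
    proof (rule tendsto_lowerbound[OF lim(1)])
      show "\<forall>\<^sub>F t in at_right 0. 0 \<le> t * sectional_curvature metric (q + t *\<^sub>R \<eta>) X \<eta>"
        using nonneg(1) eventually_at_right_less[of 0] by eventually_elim simp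
    qed simp
    moreover have "c * sff q X X \<le> 0"
    proof (rule tendsto_upperbound[OF lim(2)])
      have "\<forall>\<^sub>F t in at_left 0. (t::real) < 0" by (simp add: eventually_at_filter)
      then show "\<forall>\<^sub>F t in at_left 0. t * sectional_curvature metric (q + t *\<^sub>R \<eta>) X \<eta> \<le> 0"
        using nonneg(2) by eventually_elim (simp add: mult_nonpos_nonneg)
    qed simp
    ultimately show ?thesis using c(1) by (metis mult_eq_0_iff order_antisym)
  qed (simp add: sff_null)
qed

text \<open>
  When \<open>II\<close> vanishes at \<open>q\<close>, both numerator and denominator of the curvature have order \<open>t\<^sup>2\<close>, and the sign of the
  curvature passes to the leading coefficient \<open>B(X,X) B(\<eta>,\<eta>) - B(X,\<eta>)\<^sup>2\<close>.
\<close>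

lemma fold_sff_deriv_nonneg:
  assumes "fold_at q \<eta>" "\<partial> F q X \<noteq> 0" "\<And>X Y. sff q X Y = 0"
    "\<forall>\<^sub>F t in at 0. 0 \<le> sectional_curvature metric (q + t *\<^sub>R \<eta>) X \<eta>"
  shows "0 \<le> \<partial> (\<lambda>y. sff y X X) q \<eta> * \<partial> (\<lambda>y. sff y \<eta> \<eta>) q \<eta>"
proof -
  have q: "q \<in> \<Omega>" using assms(1) by (simp add: fold_at_def)
  obtain b where b: "b > 0" "((\<lambda>t. plane_den (q + t *\<^sub>R \<eta>) X \<eta> / t\<^sup>2) \<longlongrightarrow> b) (at 0)"
    using fold_plane_den_limit[OF assms(1,2)] by blast
  let ?x = "\<lambda>t. q + t *\<^sub>R \<eta>"
  have B: "((\<lambda>t. sff (?x t) U V /\<^sub>R t) \<longlongrightarrow> \<partial> (\<lambda>y. sff y U V) q \<eta>) (at 0)" for U V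
    by (rule tendsto_ray_quotient) (use assms(3) smooth_on_differentiable[OF smooth_sff q] in auto)
  have "0 \<le> \<partial> (\<lambda>y. sff y X X) q \<eta> * \<partial> (\<lambda>y. sff y \<eta> \<eta>) q \<eta> - (\<partial> (\<lambda>y. sff y X \<eta>) q \<eta>)\<^sup>2"
  proof (rule tendsto_lowerbound)
    show "((\<lambda>t. (sff (?x t) X X /\<^sub>R t) * (sff (?x t) \<eta> \<eta> /\<^sub>R t) - (sff (?x t) X \<eta> /\<^sub>R t)\<^sup>2) \<longlongrightarrow>
      \<partial> (\<lambda>y. sff y X X) q \<eta> * \<partial> (\<lambda>y. sff y \<eta> \<eta>) q \<eta> - (\<partial> (\<lambda>y. sff y X \<eta>) q \<eta>)\<^sup>2) (at 0)"
      by (intro tendsto_intros B)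
    show "\<forall>\<^sub>F t in at 0. 0 \<le> (sff (?x t) X X /\<^sub>R t) * (sff (?x t) \<eta> \<eta> /\<^sub>R t) - (sff (?x t) X \<eta> /\<^sub>R t)\<^sup>2"
      using eventually_neq_at_within[of 0 0 UNIV] ray_in_dom[OF q(1), of \<eta>] assms(4)
        fold_regular_ray[OF assms(1)]
        order_tendstoD(1)[OF b(2) b(1)]
    proof eventually_elim
      case (elim t)
      have "plane_den (?x t) X \<eta> > 0" using elim(1,5) by (simp add: zero_less_divide_iff)
      then have "0 \<le> plane_num (?x t) X \<eta>"
        using elim(3) sectional_curvature_eq[OF elim(2,4), of X \<eta>]
        by (simp add: plane_den_def plane_num_def zero_le_divide_iff)
      moreover have "(sff (?x t) X X /\<^sub>R t) * (sff (?x t) \<eta> \<eta> /\<^sub>R t) - (sff (?x t) X \<eta> /\<^sub>R t)\<^sup>2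
          = plane_num (?x t) X \<eta> / t\<^sup>2"
        using elim(1) by (simp add: plane_num_def field_simps power2_eq_square)
      ultimately show ?case by simp
    qed
  qed simp
  then show ?thesis by (smt (verit) zero_le_power2)
qed

end

section \<open>Boundedness of the curvature\<close>

lemma abs_det_le:
  fixes A :: "real ^ 'n ^ 'n::finite"
  shows "\<bar>det A\<bar> \<le> fact CARD('n) * (\<Prod>i\<in>UNIV. norm (A $ i))"
proof -
  have "\<bar>det A\<bar> \<le> (\<Sum>p | p permutes (UNIV::'n set). \<bar>of_int (sign p) * (\<Prod>i\<in>UNIV. A $ i $ p i)\<bar>)"
    unfolding det_def by (rule sum_abs)
  also have "\<dots> \<le> (\<Sum>p | p permutes (UNIV::'n set). \<Prod>i\<in>UNIV. norm (A $ i))"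
  proof (rule sum_mono)
    fix p :: "'n \<Rightarrow> 'n"
    have "\<bar>of_int (sign p) * (\<Prod>i\<in>UNIV. A $ i $ p i)\<bar> = (\<Prod>i\<in>UNIV. \<bar>A $ i $ p i\<bar>)"
      by (simp add: abs_mult sign_def abs_prod)
    also have "\<dots> \<le> (\<Prod>i\<in>UNIV. norm (A $ i))"
      by (intro prod_mono) (simp add: component_le_norm_cart)
    finally show "\<bar>of_int (sign p) * (\<Prod>i\<in>UNIV. A $ i $ p i)\<bar> \<le> (\<Prod>i\<in>UNIV. norm (A $ i))" .
  qed
  also have "\<dots> = fact CARD('n) * (\<Prod>i\<in>UNIV. norm (A $ i))"
    by (simp add: card_permutations)
  finally show ?thesis .
qed

lemma plane_form_change_of_basis:
  fixes \<beta> :: "'b::real_vector \<Rightarrow> 'b \<Rightarrow> real"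
  assumes "bilinear \<beta>" "\<And>u v. \<beta> u v = \<beta> v u"
    "P = a *\<^sub>R X + b *\<^sub>R Y" "Q = c *\<^sub>R X + d *\<^sub>R Y"
  shows "\<beta> P P * \<beta> Q Q - (\<beta> P Q)\<^sup>2 = (a * d - b * c)\<^sup>2 * (\<beta> X X * \<beta> Y Y - (\<beta> X Y)\<^sup>2)"
  unfolding assms(3,4)
  by (simp add: bilinear_ladd[OF assms(1)] bilinear_radd[OF assms(1)] bilinear_lmul[OF assms(1)]
      bilinear_rmul[OF assms(1)] assms(2)[of Y X] algebra_simps power2_eq_square)

text \<open>
  Every plane contains a nonzero vector orthogonal to \<open>h\<close>. Completing it to an orthogonal basis of the plane makes the
  two lower bounds for \<open>dF\<close> in \<open>curvature_estimate\<close> applicable: one to this vector, the other to the second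
  basis vector up to a multiple of the first.
\<close>

lemma exists_adapted_plane_basis:
  fixes X Y h :: "'b::real_inner"
  assumes "X \<noteq> Y" "independent {X, Y}"
  obtains a b c d where "a * d - b * c \<noteq> 0"
    "a *\<^sub>R X + b *\<^sub>R Y \<noteq> 0" "c *\<^sub>R X + d *\<^sub>R Y \<noteq> 0"
    "(a *\<^sub>R X + b *\<^sub>R Y) \<bullet> h = 0" "(a *\<^sub>R X + b *\<^sub>R Y) \<bullet> (c *\<^sub>R X + d *\<^sub>R Y) = 0"
proof -
  have nz: "r *\<^sub>R X + s *\<^sub>R Y \<noteq> 0" if "r \<noteq> 0 \<or> s \<noteq> 0" for r s
  proof
    assume eq: "r *\<^sub>R X + s *\<^sub>R Y = 0"
    have "(\<Sum>v\<in>{X, Y}. (if v = X then r else s) *\<^sub>R v) = 0"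
      using eq assms(1) by simp
    then have "(if v = X then r else s) = 0" if "v \<in> {X, Y}" for v
      using independentD[OF assms(2), of "{X, Y}" "\<lambda>v. if v = X then r else s" v] that by simp
    from this[of X] this[of Y] show False using that assms(1) by auto
  qed
  obtain a b c0 d0 where 1: "a * d0 - b * c0 \<noteq> 0" "(a *\<^sub>R X + b *\<^sub>R Y) \<bullet> h = 0"
  proof (cases "Y \<bullet> h = 0")
    case True
    then show ?thesis using that[of 0 0 1 1] by simp
  next
    case False
    then show ?thesis using that[of "Y \<bullet> h" 1 "- (X \<bullet> h)" 0] by (simp add: inner_diff_left mult.commute)
  qed
  define P where "P = a *\<^sub>R X + b *\<^sub>R Y"
  (* A Gram-Schmidt step; it leaves a d - b c unchanged. *)
  define \<tau> where "\<tau> = ((c0 *\<^sub>R X + d0 *\<^sub>R Y) \<bullet> P) / (P \<bullet> P)"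
  have "a \<noteq> 0 \<or> b \<noteq> 0" using 1(1) by auto
  then have P: "P \<noteq> 0" unfolding P_def by (rule nz)
  define c where "c = c0 - \<tau> * a"
  define d where "d = d0 - \<tau> * b"
  have ad: "a * d - b * c \<noteq> 0" using 1(1) by (simp add: c_def d_def algebra_simps)
  then have "c \<noteq> 0 \<or> d \<noteq> 0" by auto
  have Q: "c *\<^sub>R X + d *\<^sub>R Y = (c0 *\<^sub>R X + d0 *\<^sub>R Y) - \<tau> *\<^sub>R P"
    by (simp add: c_def d_def P_def algebra_simps)
  have "P \<bullet> (c *\<^sub>R X + d *\<^sub>R Y) = 0"
    unfolding Q inner_diff_right using P by (simp add: \<tau>_def inner_commute)
  then show ?thesis
    using that[OF ad _ nz[OF \<open>c \<noteq> 0 \<or> d \<noteq> 0\<close>] 1(2)] P unfolding P_def by blast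
qed

context local_front
begin

lemma bilinear_sff: "x \<in> \<Omega> \<Longrightarrow> bilinear (sff x)"
  unfolding bilinear_def sff_def
  by (intro conjI allI linearI)
    (simp_all add: linear_add[OF linear_F] linear_add[OF linear_N] linear_cmul[OF linear_F] linear_cmul[OF linear_N]
      inner_add_left inner_add_right)

lemma bilinear_metric: "x \<in> \<Omega> \<Longrightarrow> bilinear (metric x)"
  unfolding bilinear_def metric_def
  by (intro conjI allI linearI)
    (simp_all add: linear_add[OF linear_F] linear_cmul[OF linear_F] inner_add_left inner_add_right)

lemma sff_bound:
  assumes "x \<in> \<Omega>" "\<And>i j. \<bar>sff x (axis i 1) (axis j 1)\<bar> \<le> B"
  shows "\<bar>sff x u v\<bar> \<le> (real CARD('m))\<^sup>2 * B * norm u * norm v"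
proof -
  have u: "u = (\<Sum>i\<in>UNIV. u $ i *\<^sub>R axis i 1)" and v: "v = (\<Sum>i\<in>UNIV. v $ i *\<^sub>R axis i 1)"
    by (simp_all flip: vec_lambda_axis_sum)
  have B: "B \<ge> 0" using assms(2) abs_ge_zero order_trans by blast
  have "sff x u v = (\<Sum>i\<in>UNIV. \<Sum>j\<in>UNIV. u $ i * v $ j * sff x (axis i 1) (axis j 1))"
  proof -
    have "\<partial> F x u = (\<Sum>i\<in>UNIV. u $ i *\<^sub>R \<partial> F x (axis i 1))" "\<partial> N x v = (\<Sum>i\<in>UNIV. v $ i *\<^sub>R \<partial> N x (axis i 1))"
      using dir_deriv_axis_sum[OF diff_F[OF assms(1)]] dir_deriv_axis_sum[OF diff_N[OF assms(1)]] by blast+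
    then show ?thesis
      by (simp add: sff_def inner_sum_left inner_sum_right sum_negf sum_distrib_left)
        (subst sum.swap, simp add: mult_ac)
  qed
  also have "\<bar>\<dots>\<bar> \<le> (\<Sum>i\<in>(UNIV::'m set). \<Sum>j\<in>(UNIV::'m set). norm u * norm v * B)"
    by (intro order_trans[OF sum_abs] sum_mono)
      (auto simp: abs_mult intro!: mult_mono assms(2) component_le_norm_cart)
  also have "\<dots> = (real CARD('m))\<^sup>2 * B * norm u * norm v"
    by (simp add: power2_eq_square)
  finally show ?thesis .
qed

text \<open>
  The weight \<open>s\<close> measures how degenerate \<open>dF\<close> is at \<open>x\<close>. It cancels: \<open>II\<close> is of order \<open>s\<close>, and since \<open>dF\<close>
  contracts by the factor \<open>s\<close> in at most one direction, the denominator is at least of order \<open>s\<^sup>2\<close>.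
\<close>

lemma curvature_estimate:
  assumes "x \<in> \<Omega>" "regular x" "X \<noteq> Y" "independent {X, Y}" "s > 0" "c > 0"
    and sff_le: "\<And>u v. \<bar>sff x u v\<bar> \<le> A * s * norm u * norm v"
    and lower: "\<And>Z. c * s * norm Z \<le> norm (\<partial> F x Z)"
    and lower_perp: "\<And>Z. Z \<bullet> h = 0 \<Longrightarrow> c * norm Z \<le> norm (\<partial> F x Z)"
  shows "\<bar>sectional_curvature metric x X Y\<bar> \<le> 2 * A\<^sup>2 / c ^ 4"
proof -
  obtain a1 b1 c1 d1 where ad: "a1 * d1 - b1 * c1 \<noteq> 0" and nzP: "a1 *\<^sub>R X + b1 *\<^sub>R Y \<noteq> 0"
    and nzQ: "c1 *\<^sub>R X + d1 *\<^sub>R Y \<noteq> 0" and Ph: "(a1 *\<^sub>R X + b1 *\<^sub>R Y) \<bullet> h = 0"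
    and PQ: "(a1 *\<^sub>R X + b1 *\<^sub>R Y) \<bullet> (c1 *\<^sub>R X + d1 *\<^sub>R Y) = 0"
    using exists_adapted_plane_basis[OF assms(3,4)] by metis
  define P where "P = a1 *\<^sub>R X + b1 *\<^sub>R Y"
  define Q where "Q = c1 *\<^sub>R X + d1 *\<^sub>R Y"
  note P = nzP[folded P_def] and Q = nzQ[folded Q_def] and Ph = Ph[folded P_def] and PQ = PQ[folded P_def Q_def]
  have "plane_num x P Q = (a1 * d1 - b1 * c1)\<^sup>2 * plane_num x X Y"
    unfolding plane_num_def
    by (rule plane_form_change_of_basis[OF bilinear_sff sff_sym P_def Q_def]) (rule assms(1))+
  moreover have "plane_den x P Q = (a1 * d1 - b1 * c1)\<^sup>2 * plane_den x X Y"
    unfolding plane_den_def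
    by (rule plane_form_change_of_basis[OF bilinear_metric _ P_def Q_def])
      (simp_all add: assms(1) metric_def inner_commute)
  ultimately have K: "sectional_curvature metric x X Y = plane_num x P Q / plane_den x P Q"
    using ad sectional_curvature_eq[OF assms(1,2)] by (simp add: plane_num_def plane_den_def)
  define R where "R = (norm P)\<^sup>2 * (norm Q)\<^sup>2"
  have R: "R > 0" using P Q by (simp add: R_def)
  have num: "\<bar>plane_num x P Q\<bar> \<le> 2 * A\<^sup>2 * s\<^sup>2 * R"
  proof -
    have "\<bar>sff x P P * sff x Q Q\<bar> \<le> (A * s * norm P * norm P) * (A * s * norm Q * norm Q)"
      unfolding abs_mult by (intro mult_mono sff_le) (auto intro: order_trans[OF abs_ge_zero sff_le])
    also have "\<dots> = A\<^sup>2 * s\<^sup>2 * R" by (simp add: R_def power2_eq_square)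
    finally have 1: "\<bar>sff x P P * sff x Q Q\<bar> \<le> A\<^sup>2 * s\<^sup>2 * R" .
    have "\<bar>sff x P Q\<bar>\<^sup>2 \<le> (A * s * norm P * norm Q)\<^sup>2"
      by (intro power_mono sff_le) simp
    also have "\<dots> = A\<^sup>2 * s\<^sup>2 * R" by (simp add: R_def power_mult_distrib)
    finally have 2: "(sff x P Q)\<^sup>2 \<le> A\<^sup>2 * s\<^sup>2 * R" by simp
    have "\<bar>plane_num x P Q\<bar> \<le> \<bar>sff x P P * sff x Q Q\<bar> + \<bar>(sff x P Q)\<^sup>2\<bar>"
      unfolding plane_num_def by (rule abs_triangle_ineq4)
    then show ?thesis using 1 2 by simp
  qed
  have den: "plane_den x P Q \<ge> c ^ 4 * s\<^sup>2 * R"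
  proof -
    have LP: "c * norm P \<le> norm (\<partial> F x P)" using lower_perp[OF Ph] .
    then have LP0: "\<partial> F x P \<noteq> 0" using P \<open>c > 0\<close> by (auto simp: mult_le_0_iff)
    define \<tau> where "\<tau> = (\<partial> F x P \<bullet> \<partial> F x Q) / (\<partial> F x P \<bullet> \<partial> F x P)"
    have "(norm Q)\<^sup>2 \<le> (norm (Q - \<tau> *\<^sub>R P))\<^sup>2"
    proof -
      have "(Q - \<tau> *\<^sub>R P) \<bullet> (Q - \<tau> *\<^sub>R P) = Q \<bullet> Q + \<tau> * \<tau> * (P \<bullet> P)"
        using PQ by (simp add: inner_diff_left inner_diff_right inner_commute[of Q P])
      moreover have "0 \<le> \<tau> * \<tau> * (P \<bullet> P)" by simp
      ultimately show ?thesis unfolding power2_norm_eq_inner by linarith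
    qed
    then have "norm Q \<le> norm (Q - \<tau> *\<^sub>R P)" by (rule power2_le_imp_le) simp
    then have LQ: "c * s * norm Q \<le> norm (\<partial> F x (Q - \<tau> *\<^sub>R P))"
      using \<open>c > 0\<close> \<open>s > 0\<close> by (intro order_trans[OF mult_left_mono lower]) auto
    have "plane_den x P Q = (norm (\<partial> F x P))\<^sup>2 * (norm (\<partial> F x (Q - \<tau> *\<^sub>R P)))\<^sup>2"
      unfolding plane_den_def metric_def gram_eq_orthogonal_part[OF LP0 \<tau>_def] power2_norm_eq_inner
        linear_diff[OF linear_F[OF assms(1)]] linear_cmul[OF linear_F[OF assms(1)]] ..
    moreover have "(c * norm P)\<^sup>2 * (c * s * norm Q)\<^sup>2 \<le> (norm (\<partial> F x P))\<^sup>2 * (norm (\<partial> F x (Q - \<tau> *\<^sub>R P)))\<^sup>2"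
      using LP LQ \<open>c > 0\<close> \<open>s > 0\<close> by (intro mult_mono power_mono) auto
    moreover have "(c * norm P)\<^sup>2 * (c * s * norm Q)\<^sup>2 = c ^ 4 * s\<^sup>2 * R"
      by (simp add: R_def power_mult_distrib power2_eq_square power4_eq_xxxx)
    ultimately show ?thesis by simp
  qed
  have D: "c ^ 4 * s\<^sup>2 * R > 0" using R assms(5,6) by simp
  have "\<bar>sectional_curvature metric x X Y\<bar> = \<bar>plane_num x P Q\<bar> / plane_den x P Q"
    unfolding K using den D by simp
  also have "\<dots> \<le> (2 * A\<^sup>2 * s\<^sup>2 * R) / (c ^ 4 * s\<^sup>2 * R)"
    using num den D R by (intro frac_le) auto
  also have "\<dots> = 2 * A\<^sup>2 / c ^ 4" using R \<open>s > 0\<close> by simp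
  finally show ?thesis .
qed

lemma dF_lower_bound_near:
  assumes "q \<in> \<Omega>" "\<And>Z. \<partial> F q Z = 0 \<Longrightarrow> Z \<bullet> h = 0 \<Longrightarrow> Z = 0"
  obtains c where "c > 0" "\<forall>\<^sub>F x in nhds q. \<forall>Z. Z \<bullet> h = 0 \<longrightarrow> c * norm Z \<le> norm (\<partial> F x Z)"
proof -
  let ?s = "{Z. Z \<bullet> h = 0}"
  have "closed ?s"
    using closed_hyperplane[of h 0] by (simp add: inner_commute)
  moreover have "subspace ?s" by (auto simp: subspace_def inner_add_left)
  moreover have "bounded_linear (\<partial> F q)" using linear_F[OF assms(1)] linear_conv_bounded_linear by blast
  ultimately obtain e where e: "e > 0" "\<forall>Z\<in>?s. e * norm Z \<le> norm (\<partial> F q Z)"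
    using injective_imp_isometric[of ?s "\<partial> F q"] assms(2) by (auto simp: mult.commute)
  define n where "n = real CARD('m)"
  have "n > 0" by (simp add: n_def)
  have "\<forall>\<^sub>F x in nhds q. norm (\<partial> F x (axis j 1) - \<partial> F q (axis j 1)) < e / (2 * n)" for j
    using isCont_tendsto_nhds[OF smooth_on_isCont[OF smooth_dF assms(1)], of "axis j 1"] \<open>e > 0\<close> \<open>n > 0\<close>
    unfolding tendsto_iff dist_norm by (metis divide_pos_pos mult_pos_pos zero_less_numeral)
  then have "\<forall>\<^sub>F x in nhds q. \<forall>j. norm (\<partial> F x (axis j 1) - \<partial> F q (axis j 1)) < e / (2 * n)"
    by (simp add: eventually_all_finite)
  then have "\<forall>\<^sub>F x in nhds q. \<forall>Z. Z \<bullet> h = 0 \<longrightarrow> e / 2 * norm Z \<le> norm (\<partial> F x Z)"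
    using eventually_nhds_in_open[OF open_dom assms(1)]
  proof (eventually_elim, intro allI impI)
    fix x Z :: "real ^ 'm" assume x: "\<forall>j. norm (\<partial> F x (axis j 1) - \<partial> F q (axis j 1)) < e / (2 * n)" "x \<in> \<Omega>" and Z: "Z \<bullet> h = 0"
    have "\<partial> F x Z - \<partial> F q Z = (\<Sum>j\<in>UNIV. Z $ j *\<^sub>R (\<partial> F x (axis j 1) - \<partial> F q (axis j 1)))"
      using dir_deriv_axis_sum[OF diff_F[OF x(2)], of Z] dir_deriv_axis_sum[OF diff_F[OF assms(1)], of Z]
      by (simp add: sum_subtractf scaleR_diff_right)
    also have "norm \<dots> \<le> (\<Sum>j\<in>(UNIV::'m set). norm Z * (e / (2 * n)))"
    proof (rule sum_norm_le)
      fix j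
      show "norm (Z $ j *\<^sub>R (\<partial> F x (axis j 1) - \<partial> F q (axis j 1))) \<le> norm Z * (e / (2 * n))"
        unfolding norm_scaleR using x(1)
        by (intro mult_mono) (auto simp: component_le_norm_cart less_imp_le)
    qed
    also have "\<dots> = e / 2 * norm Z" using \<open>n > 0\<close> by (simp add: n_def field_simps)
    finally have "norm (\<partial> F q Z) - norm (\<partial> F x Z) \<le> e / 2 * norm Z"
      by (metis norm_minus_commute norm_triangle_ineq2 order_trans)
    moreover have "e * norm Z \<le> norm (\<partial> F q Z)" using e(2) Z by blast
    ultimately show "e / 2 * norm Z \<le> norm (\<partial> F x Z)" by simp
  qed
  then show ?thesis using that[of "e / 2"] e(1) by simp
qed

text \<open>
  By Cramer's rule, each component of \<open>Z\<close> times \<open>\<lambda>\<close> is the determinant of a frame matrix in which one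
  row is replaced by \<open>dF(Z)\<close>. The other rows are bounded near \<open>q\<close>.
\<close>

lemma dF_density_bound_near:
  assumes "q \<in> \<Omega>"
  obtains c where "c > 0" "\<forall>\<^sub>F x in nhds q. \<forall>Z. c * \<bar>density x\<bar> * norm Z \<le> norm (\<partial> F x Z)"
proof -
  (* K bounds all rows near q, including the unit row N. In D, the factorial bounds the number of terms
     of the determinant, and one row is left out of the product because it is replaced by dF(Z). *)
  define K where "K = Max (insert 1 (range (\<lambda>j. norm (\<partial> F q (axis j 1)) + 1)))"
  have K: "K \<ge> 1" "norm (\<partial> F q (axis j 1)) + 1 \<le> K" for j
    unfolding K_def by (rule Max_ge; simp)+
  define D where "D = fact CARD('m option) * K ^ (CARD('m option) - 1)"
  have "D > 0" using K(1) by (simp add: D_def)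
  define m where "m = real CARD('m)"
  have "m > 0" by (simp add: m_def)
  have "\<forall>\<^sub>F x in nhds q. norm (\<partial> F x (axis j 1)) < K" for j
    by (rule order_tendstoD(2)[OF tendsto_norm[OF isCont_tendsto_nhds[OF smooth_on_isCont[OF smooth_dF assms(1)]]]])
      (use K(2)[of j] in simp)
  then have "\<forall>\<^sub>F x in nhds q. \<forall>j. norm (\<partial> F x (axis j 1)) < K"
    by (simp add: eventually_all_finite)
  then have "\<forall>\<^sub>F x in nhds q. \<forall>Z. 1 / (m * D) * \<bar>density x\<bar> * norm Z \<le> norm (\<partial> F x Z)"
    using eventually_nhds_in_open[OF open_dom assms(1)]
  proof (eventually_elim, intro allI)
    fix x Z :: "real ^ 'm" assume x: "\<forall>j. norm (\<partial> F x (axis j 1)) < K" "x \<in> \<Omega>"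
    let ?M = "frame_matrix (\<lambda>i. \<partial> F x (axis i 1)) (N x)"
    define z where "z = (\<chi> i. case i of Some j \<Rightarrow> Z $ j | None \<Rightarrow> 0)"
    have sum: "(\<Sum>i\<in>UNIV. z $ i *s row i ?M) = \<partial> F x Z"
      unfolding dir_deriv_axis_sum[OF diff_F[OF x(2)], of Z]
      by (simp add: sum_UNIV_option z_def row_def scalar_mult_eq_scaleR vec_eq_iff)
    have row: "norm (row i ?M) \<le> K" for i
    proof (cases i)
      case None
      then show ?thesis using norm_N[OF x(2)] K(1) by (simp add: row_def)
    next
      case (Some j)
      then show ?thesis using x(1) by (simp add: row_def less_imp_le)
    qed
    have comp: "\<bar>Z $ j\<bar> * \<bar>density x\<bar> \<le> D * norm (\<partial> F x Z)" for j
    proof -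
      let ?A = "\<chi> i. if i = Some j then \<Sum>i\<in>UNIV. z $ i *s row i ?M else row i ?M"
      have "\<bar>Z $ j\<bar> * \<bar>density x\<bar> = \<bar>det ?A\<bar>"
        unfolding cramer_lemma_transpose by (simp add: z_def density_def abs_mult)
      also have "\<dots> \<le> fact CARD('m option) * (\<Prod>i\<in>UNIV. norm (?A $ i))" by (rule abs_det_le)
      also have "(\<Prod>i\<in>UNIV. norm (?A $ i)) = norm (\<partial> F x Z) * (\<Prod>i\<in>UNIV - {Some j}. norm (?A $ i))"
        by (subst prod.remove[of _ "Some j"]) (simp_all add: sum)
      also have "fact CARD('m option) * (norm (\<partial> F x Z) * (\<Prod>i\<in>UNIV - {Some j}. norm (?A $ i)))
          \<le> fact CARD('m option) * (norm (\<partial> F x Z) * (\<Prod>i\<in>UNIV - {Some j}. K))"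
        by (intro mult_left_mono prod_mono) (use row in auto)
      also have "(\<Prod>i\<in>UNIV - {Some j}. K) = K ^ (CARD('m option) - 1)" by simp
      finally show ?thesis unfolding D_def by (simp only: mult_ac)
    qed
    have "norm Z * \<bar>density x\<bar> \<le> (\<Sum>j\<in>UNIV. \<bar>Z $ j\<bar>) * \<bar>density x\<bar>"
      by (intro mult_right_mono norm_le_l1_cart) simp
    also have "\<dots> \<le> (\<Sum>j\<in>(UNIV::'m set). D * norm (\<partial> F x Z))"
      unfolding sum_distrib_right by (intro sum_mono comp)
    also have "\<dots> = m * D * norm (\<partial> F x Z)" by (simp add: m_def)
    finally show "1 / (m * D) * \<bar>density x\<bar> * norm Z \<le> norm (\<partial> F x Z)"
      using \<open>m > 0\<close> \<open>D > 0\<close> by (simp add: field_simps)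
  qed
  then show ?thesis using that[of "1 / (m * D)"] \<open>m > 0\<close> \<open>D > 0\<close> by simp
qed

definition curvature_bounded_near :: "real ^ 'm \<Rightarrow> bool" where
  "curvature_bounded_near q \<longleftrightarrow> (\<exists>C. \<forall>\<^sub>F x in nhds q. regular x \<longrightarrow>
     (\<forall>X Y. X \<noteq> Y \<longrightarrow> independent {X, Y} \<longrightarrow> \<bar>sectional_curvature metric x X Y\<bar> \<le> C))"

text \<open>
  Regular points are the case \<open>w = 1\<close>, \<open>h = 0\<close>, and fold points the case \<open>w = |\<lambda>|\<close>, \<open>h = \<eta>\<close>.
\<close>

lemma curvature_bounded_near_weighted:
  assumes "q \<in> \<Omega>" "\<And>Z. \<partial> F q Z = 0 \<Longrightarrow> Z \<bullet> h = 0 \<Longrightarrow> Z = 0"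
    and w: "\<And>x. x \<in> \<Omega> \<Longrightarrow> regular x \<Longrightarrow> w x > 0"
    and sff: "\<And>i j. \<exists>A. \<forall>\<^sub>F x in nhds q. \<bar>sff x (axis i 1) (axis j 1)\<bar> \<le> A * w x"
    and low: "c1 > 0" "\<forall>\<^sub>F x in nhds q. \<forall>Z. c1 * w x * norm Z \<le> norm (\<partial> F x Z)"
  shows "curvature_bounded_near q"
proof -
  obtain c2 where c2: "c2 > 0" "\<forall>\<^sub>F x in nhds q. \<forall>Z. Z \<bullet> h = 0 \<longrightarrow> c2 * norm Z \<le> norm (\<partial> F x Z)"
    using dF_lower_bound_near[OF assms(1,2)] by blast
  define c where "c = min c1 c2"
  have "c > 0" using c2 low by (simp add: c_def)
  define A where "A i j = (SOME A. \<forall>\<^sub>F x in nhds q. \<bar>sff x (axis i 1) (axis j 1)\<bar> \<le> A * w x)" for i j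
  have A: "\<forall>\<^sub>F x in nhds q. \<bar>sff x (axis i 1) (axis j 1)\<bar> \<le> A i j * w x" for i j
    unfolding A_def by (rule someI_ex[OF sff])
  define A0 where "A0 = Max (range (\<lambda>(i, j). A i j))"
  have A0: "A i j \<le> A0" for i j
    unfolding A0_def by (rule Max_ge) (auto simp: image_iff intro: exI[of _ i] exI[of _ j])
  have "\<forall>\<^sub>F x in nhds q. \<forall>i j. \<bar>sff x (axis i 1) (axis j 1)\<bar> \<le> A i j * w x"
    using A by (simp add: eventually_all_finite)
  then have "\<forall>\<^sub>F x in nhds q. regular x \<longrightarrow> (\<forall>X Y. X \<noteq> Y \<longrightarrow> independent {X, Y} \<longrightarrow>
      \<bar>sectional_curvature metric x X Y\<bar> \<le> 2 * ((real CARD('m))\<^sup>2 * A0)\<^sup>2 / c ^ 4)"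
    using c2(2) low(2) eventually_nhds_in_open[OF open_dom assms(1)]
  proof (eventually_elim, intro impI allI)
    fix x X Y :: "real ^ 'm"
    assume sffx: "\<forall>i j. \<bar>sff x (axis i 1) (axis j 1)\<bar> \<le> A i j * w x"
      and perp: "\<forall>Z. Z \<bullet> h = 0 \<longrightarrow> c2 * norm Z \<le> norm (\<partial> F x Z)"
      and lowx: "\<forall>Z. c1 * w x * norm Z \<le> norm (\<partial> F x Z)"
      and x: "x \<in> \<Omega>" "regular x" and XY: "X \<noteq> Y" "independent {X, Y}"
    show "\<bar>sectional_curvature metric x X Y\<bar> \<le> 2 * ((real CARD('m))\<^sup>2 * A0)\<^sup>2 / c ^ 4"
    proof (rule curvature_estimate[OF x XY w[OF x] \<open>c > 0\<close>])
      have "\<bar>sff x (axis i 1) (axis j 1)\<bar> \<le> A0 * w x" for i j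
        using sffx A0[of i j] w[OF x] by (meson less_imp_le mult_right_mono order_trans)
      from sff_bound[OF x(1) this]
      show "\<bar>sff x u v\<bar> \<le> (real CARD('m))\<^sup>2 * A0 * w x * norm u * norm v" for u v
        by (simp add: mult_ac)
      show "c * w x * norm Z \<le> norm (\<partial> F x Z)" for Z
      proof -
        have "c * w x * norm Z \<le> c1 * w x * norm Z"
          using w[OF x] by (intro mult_right_mono) (auto simp: c_def)
        then show ?thesis using lowx order_trans by blast
      qed
      show "c * norm Z \<le> norm (\<partial> F x Z)" if "Z \<bullet> h = 0" for Z
      proof -
        have "c * norm Z \<le> c2 * norm Z" by (intro mult_right_mono) (auto simp: c_def)
        then show ?thesis using perp that order_trans by blast
      qed
    qed
  qed
  then show ?thesis unfolding curvature_bounded_near_def by blast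
qed

lemma curvature_bounded_near_regular:
  assumes "q \<in> \<Omega>" "regular q"
  shows "curvature_bounded_near q"
proof -
  have inj: "Z = 0" if "\<partial> F q Z = 0" for Z using regularD[OF assms(2,1) that] .
  obtain c where c: "c > 0" "\<forall>\<^sub>F x in nhds q. \<forall>Z. Z \<bullet> 0 = 0 \<longrightarrow> c * norm Z \<le> norm (\<partial> F x Z)"
    using dF_lower_bound_near[OF assms(1), of 0] inj by blast
  show ?thesis
  proof (rule curvature_bounded_near_weighted[OF assms(1), of 0 "\<lambda>_. 1", OF inj _ _ c(1)])
    show "\<exists>A. \<forall>\<^sub>F x in nhds q. \<bar>sff x (axis i 1) (axis j 1)\<bar> \<le> A * 1" for i j
    proof -
      have "\<forall>\<^sub>F x in nhds q. \<bar>sff x (axis i 1) (axis j 1)\<bar> < \<bar>sff q (axis i 1) (axis j 1)\<bar> + 1"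
        by (rule order_tendstoD(2)[OF tendsto_rabs[OF isCont_tendsto_nhds[OF smooth_on_isCont[OF smooth_sff assms(1)]]]]) simp
      then show ?thesis
        by (intro exI[of _ "\<bar>sff q (axis i 1) (axis j 1)\<bar> + 1"]) (auto elim: eventually_mono)
    qed
    show "\<forall>\<^sub>F x in nhds q. \<forall>Z. c * 1 * norm Z \<le> norm (\<partial> F x Z)" using c(2) by simp
  qed simp_all
qed

lemma curvature_bounded_near_transversal:
  assumes "q \<in> \<Omega>" "\<eta> \<noteq> 0" "\<partial> F q \<eta> = 0" "\<partial> density q \<eta> \<noteq> 0"
    and flat: "\<And>x X Y. x \<in> \<Omega> \<Longrightarrow> density x = 0 \<Longrightarrow> sff x X Y = 0"
  shows "curvature_bounded_near q"
proof -
  obtain c where c: "c > 0" "\<forall>\<^sub>F x in nhds q. \<forall>Z. c * \<bar>density x\<bar> * norm Z \<le> norm (\<partial> F x Z)"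
    using dF_density_bound_near[OF assms(1)] by blast
  have d0: "density q = 0"
  proof -
    obtain A :: "real ^ 'm ^ 'm" and k where "A $ k = \<eta>" "det A \<noteq> 0"
      using exists_basis_with_row[OF assms(2)] by blast
    from density_deriv(1)[OF assms(1,3) this] show ?thesis .
  qed
  show ?thesis
  proof (rule curvature_bounded_near_weighted[OF assms(1), of \<eta> "\<lambda>x. \<bar>density x\<bar>", OF _ _ _ c])
    show "Z = 0" if "\<partial> F q Z = 0" "Z \<bullet> \<eta> = 0" for Z
    proof -
      from transversal_kernel[OF assms(1-4) that(1)] that(2) show ?thesis by auto
    qed
    show "\<bar>density x\<bar> > 0" if "x \<in> \<Omega>" "regular x" for x
      using that regular_iff_density by simp
    show "\<exists>A. \<forall>\<^sub>F x in nhds q. \<bar>sff x (axis i 1) (axis j 1)\<bar> \<le> A * \<bar>density x\<bar>" for i j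
      by (rule bounded_by_defining_function[OF open_dom smooth_density smooth_sff assms(1) d0 assms(4)])
        (rule flat)
  qed
qed

end

section \<open>The sign of the singular principal curvatures\<close>

lemma velocities_subset:
  assumes "open T" "q \<in> T"
  shows "velocities A q \<subseteq> velocities (A \<inter> T) q"
proof
  fix X assume "X \<in> velocities A q"
  then obtain \<gamma> where \<gamma>: "\<gamma> 0 = q" "(\<gamma> has_vector_derivative X) (at (0::real))" "\<forall>\<^sub>F t in at 0. \<gamma> t \<in> A"
    unfolding velocities_def by blast
  have "(\<gamma> \<longlongrightarrow> q) (at 0)"
    using \<gamma>(1,2) has_vector_derivative_continuous continuous_within by metis
  then have "\<forall>\<^sub>F t in at 0. \<gamma> t \<in> T" using assms topological_tendstoD by blast
  with \<gamma>(3) have "\<forall>\<^sub>F t in at 0. \<gamma> t \<in> A \<inter> T" by eventually_elim simp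
  with \<gamma>(1,2) show "X \<in> velocities (A \<inter> T) q" unfolding velocities_def by blast
qed

lemma velocities_mono: "A \<subseteq> B \<Longrightarrow> velocities A q \<subseteq> velocities B q"
  unfolding velocities_def by (fastforce elim: eventually_mono)

context local_front
begin

definition singular_points :: "(real ^ 'm) set" where
  "singular_points = {x \<in> \<Omega>. density x = 0}"

text \<open>
  Identities that hold along the singular set may be differentiated in directions tangent to it.
\<close>

lemma vanish_on_singular:
  assumes "X \<in> velocities singular_points q" "(G has_derivative G') (at q)" "q \<in> singular_points"
    "\<And>y. y \<in> singular_points \<Longrightarrow> G y = 0"
  shows "G' X = 0"
  by (rule dir_deriv_eq_0_of_velocity[OF assms(1,2)]) (use assms(3,4) in auto)

text \<open>
  Two identities along the singular set are differentiated in the direction \<open>X\<close>: \<open>dN(\<eta>) = \<langle>dN(\<eta>), n\<rangle> n\<close> and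
  \<open>dF(\<eta>) = 0\<close>. Because \<open>II\<close> vanishes at \<open>q\<close>, the images of \<open>dN\<close> and \<open>dF\<close> at \<open>q\<close> are orthogonal, which removes all
  terms that involve derivatives of \<open>\<eta>\<close> or of the coefficient.
\<close>

lemma weingarten_identity:
  assumes q: "q \<in> singular_points" and X: "X \<in> velocities singular_points q"
    and flat: "\<And>x X Y. x \<in> singular_points \<Longrightarrow> sff x X Y = 0"
    and \<eta>: "(\<eta> has_derivative \<eta>') (at q)" "\<And>x. x \<in> singular_points \<Longrightarrow> \<partial> F x (\<eta> x) = 0"
    and n: "(n has_derivative n') (at q)"
    and dN: "\<And>x. x \<in> singular_points \<Longrightarrow> \<partial> N x (\<eta> x) = (\<partial> N x (\<eta> x) \<bullet> n x) *\<^sub>R n x"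
    and c: "c = \<partial> N q (\<eta> q) \<bullet> n q" "c \<noteq> 0"
  shows "\<partial> (\<lambda>y. sff y X X) q (\<eta> q) = - c * (n' X \<bullet> \<partial> F q X)"
    and "\<partial> (\<lambda>y. sff y (\<eta> q) (\<eta> q)) q (\<eta> q) = - c * (hess q (\<eta> q) (\<eta> q) \<bullet> n q)"
proof -
  have q\<Omega>: "q \<in> \<Omega>" using q by (simp add: singular_points_def)
  have perp: "\<partial> F q Z \<bullet> \<partial> N q Y = 0" for Z Y using flat[OF q, of Z Y] by (simp add: sff_def)
  let ?\<eta> = "\<eta> q"
  have dN_eq: "\<partial> N q ?\<eta> = c *\<^sub>R n q" using dN[OF q] c(1) by simp
  then have Fn: "\<partial> F q Z \<bullet> n q = 0" for Z using perp[of Z ?\<eta>] c(2) by simp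
  define H where "H y = \<partial> N y (\<eta> y)" for y
  define H' where "H' u = \<partial> (\<lambda>y. \<partial> N y ?\<eta>) q u + \<partial> N q (\<eta>' u)" for u
  have H: "(H has_derivative H') (at q)"
    unfolding H_def H'_def by (rule has_derivative_dir_deriv_field[OF open_dom smooth_N q\<Omega> \<eta>(1)])
  have "((\<lambda>y. H y - (H y \<bullet> n y) *\<^sub>R n y) has_derivative
      (\<lambda>u. H' u - ((H q \<bullet> n q) *\<^sub>R n' u + (H q \<bullet> n' u + H' u \<bullet> n q) *\<^sub>R n q))) (at q)"
    by (intro derivative_intros H n)
  from vanish_on_singular[OF X this q]
  have "H' X - ((H q \<bullet> n q) *\<^sub>R n' X + (H q \<bullet> n' X + H' X \<bullet> n q) *\<^sub>R n q) = 0"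
    using dN by (simp add: H_def)
  then have "H' X = c *\<^sub>R n' X + (H q \<bullet> n' X + H' X \<bullet> n q) *\<^sub>R n q"
    by (simp add: H_def c(1))
  (* As dF(X) is orthogonal to n, the derivative of the coefficient of n drops out. *)
  then have "\<partial> F q X \<bullet> H' X = c * (\<partial> F q X \<bullet> n' X)"
    by (metis (no_types, lifting) Fn add.right_neutral inner_add_right inner_scaleR_right mult_zero_right)
  then have key: "\<partial> F q X \<bullet> \<partial> (\<lambda>y. \<partial> N y ?\<eta>) q X = c * (\<partial> F q X \<bullet> n' X)"
    by (simp add: H'_def inner_add_right perp)
  have "hess q X ?\<eta> + \<partial> F q (\<eta>' X) = 0"
    unfolding hess_def
    by (rule vanish_on_singular[OF X has_derivative_dir_deriv_field[OF open_dom smooth_F q\<Omega> \<eta>(1)] q \<eta>(2)])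
  then have "hess q ?\<eta> X = - \<partial> F q (\<eta>' X)"
    using hess_sym[OF q\<Omega>, of ?\<eta> X] by (simp add: add_eq_0_iff)
  then have hess0: "hess q ?\<eta> X \<bullet> \<partial> N q X = 0" by (simp add: perp)
  have sff_deriv: "\<partial> (\<lambda>y. sff y U U) q u = - (\<partial> F q U \<bullet> \<partial> (\<lambda>y. \<partial> N y U) q u + hess q u U \<bullet> \<partial> N q U)" for U u
    unfolding sff_def hess_def
    by (rule dir_deriv_eq)
      (intro derivative_intros smooth_on_has_derivative[OF smooth_dF q\<Omega>] smooth_on_has_derivative[OF smooth_dN q\<Omega>])
  have "\<partial> (\<lambda>y. \<partial> N y X) q ?\<eta> = \<partial> (\<lambda>y. \<partial> N y ?\<eta>) q X"
    by (rule second_deriv_symmetric[OF open_dom smooth_N q\<Omega>])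
  then show "\<partial> (\<lambda>y. sff y X X) q ?\<eta> = - c * (n' X \<bullet> \<partial> F q X)"
    using key hess0 by (simp add: sff_deriv inner_commute)
  show "\<partial> (\<lambda>y. sff y ?\<eta> ?\<eta>) q ?\<eta> = - c * (hess q ?\<eta> ?\<eta> \<bullet> n q)"
    using \<eta>(2)[OF q] by (simp add: sff_deriv dN_eq)
qed

text \<open>
  If \<open>d\<lambda>(\<eta>) = 0\<close>, the sign in the definition of the singular shape operator is \<open>0\<close>, and so are its eigenvalues.
  Otherwise \<open>q\<close> is a fold point. There \<open>D\<^sub>X n\<close> is orthogonal to \<open>n\<close> and \<open>N\<close>, hence the image of a vector tangent
  to the singular set, so that the eigenvalue equation can be mapped by \<open>dF\<close> and multiplied with \<open>dF(X)\<close>.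
\<close>

lemma principal_curvature_nonpos:
  fixes e :: "'m \<Rightarrow> real ^ 'm \<Rightarrow> real ^ 'm" and n :: "real ^ 'm \<Rightarrow> real ^ ('m option)" and k :: 'm
  defines "v \<equiv> \<lambda>x i. if i = k then n x else \<partial> F x (e i x)"
  assumes q: "q \<in> singular_points" and X: "X \<in> velocities singular_points q" "X \<noteq> 0"
    and flat: "\<And>x X Y. x \<in> singular_points \<Longrightarrow> sff x X Y = 0"
    and \<eta>: "(\<eta> has_derivative \<eta>') (at q)" "\<And>x. x \<in> singular_points \<Longrightarrow> \<partial> F x (\<eta> x) = 0"
    and n: "(n has_derivative n') (at q)"
    and e: "\<And>i. i \<noteq> k \<Longrightarrow> e i q \<in> velocities singular_points q"
    and pos: "det (\<chi> i. if i = k then \<eta> q else e i q) > 0"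
    and vN: "\<And>x i. x \<in> singular_points \<Longrightarrow> v x i \<bullet> N x = 0"
    and vv: "\<And>x i j. x \<in> singular_points \<Longrightarrow> v x i \<bullet> v x j = (if i = j then 1 else 0)"
    and vol: "\<And>x. x \<in> singular_points \<Longrightarrow> det (frame_matrix (v x) (N x)) = 1"
    and K: "\<And>X. \<partial> F q X \<noteq> 0 \<Longrightarrow>
      \<forall>\<^sub>F t in at 0. regular (q + t *\<^sub>R \<eta> q) \<longrightarrow> 0 \<le> sectional_curvature metric (q + t *\<^sub>R \<eta> q) X (\<eta> q)"
    and eig: "- sgn (\<partial> density q (\<eta> q)) *\<^sub>R
      inv_into (velocities singular_points q) (\<partial> F q) (n' X - (n' X \<bullet> N q) *\<^sub>R N q) = c *\<^sub>R X"
  shows "c \<le> 0"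
proof (cases "\<partial> density q (\<eta> q) = 0")
  case True
  then show ?thesis using eig X(2) by simp
next
  case transversal: False
  have q\<Omega>: "q \<in> \<Omega>" and d0: "density q = 0" using q by (simp_all add: singular_points_def)
  let ?\<eta> = "\<eta> q"
  have F\<eta>: "\<partial> F q ?\<eta> = 0" using \<eta>(2)[OF q] .
  have \<eta>0: "?\<eta> \<noteq> 0"
    using transversal linear_0[OF linear_dir_deriv[OF smooth_on_differentiable[OF smooth_density q\<Omega>]]] by auto
  note fold = transversal_imp_fold[OF q\<Omega> \<eta>0 F\<eta> transversal]
  have vk: "v x k = n x" for x by (simp add: v_def)
  have ddens: "(density has_derivative (\<lambda>u. \<partial> density q u)) (at q)"
    by (rule smooth_on_has_derivative[OF smooth_density q\<Omega>])
  note lin_d = linear_dir_deriv[OF smooth_on_differentiable[OF smooth_density q\<Omega>]]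
  have tangent: "\<partial> density q Z = 0" if "Z \<in> velocities singular_points q" for Z
    by (rule vanish_on_singular[OF that ddens q]) (simp add: singular_points_def)
  have FX: "\<partial> F q X \<noteq> 0"
  proof
    assume "\<partial> F q X = 0"
    then obtain a where a: "X = a *\<^sub>R ?\<eta>" using transversal_kernel[OF q\<Omega> \<eta>0 F\<eta> transversal] by blast
    have "\<partial> density q X = 0" by (rule tangent[OF X(1)])
    then have "a = 0" using transversal unfolding a linear_cmul[OF lin_d] by simp
    then show False using a X(2) by simp
  qed
  let ?w = "hess q ?\<eta> ?\<eta>"
  have wN: "?w \<bullet> N q = 0" using normal_deriv[OF q\<Omega>, of ?\<eta> ?\<eta>] F\<eta> by simp
  have sgn_eq: "sgn (\<partial> density q ?\<eta>) = sgn (?w \<bullet> n q)"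
  proof -
    define A :: "real ^ 'm ^ 'm" where "A = (\<chi> i. if i = k then ?\<eta> else e i q)"
    have A: "A $ k = ?\<eta>" "det A > 0" using pos by (simp_all add: A_def)
    have "(\<lambda>i. \<partial> F q (A $ i))(k := ?w) = (v q)(k := ?w)"
      by (auto simp: A_def v_def)
    then have "det A * \<partial> density q ?\<eta> = det (frame_matrix ((v q)(k := ?w)) (N q))"
      using density_deriv(2)[OF q\<Omega> F\<eta> A(1)] A(2) by simp
    also have "\<dots> = ?w \<bullet> n q"
      using det_replaced_orthonormal_row[of "v q" "N q" ?w k] vol[OF q] vv[OF q] vN[OF q] wN by (simp add: vk)
    finally have "det A * \<partial> density q ?\<eta> = ?w \<bullet> n q" .
    then have "sgn (?w \<bullet> n q) = sgn (det A) * sgn (\<partial> density q ?\<eta>)" by (metis sgn_mult)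
    then show ?thesis using A(2) by simp
  qed
  have dN: "\<partial> N x (\<eta> x) = (\<partial> N x (\<eta> x) \<bullet> n x) *\<^sub>R n x" if x: "x \<in> singular_points" for x
  proof -
    have x\<Omega>: "x \<in> \<Omega>" using x by (simp add: singular_points_def)
    have "\<partial> N x (\<eta> x) = (\<Sum>j\<in>UNIV. (\<partial> N x (\<eta> x) \<bullet> v x j) *\<^sub>R v x j)"
      by (rule orthonormal_frame_expansion[of _ "N x"])
        (use vol[OF x] vv[OF x] vN[OF x] dN_tangent[OF x\<Omega>] in auto)
    also have "\<dots> = (\<Sum>j\<in>UNIV. if j = k then (\<partial> N x (\<eta> x) \<bullet> n x) *\<^sub>R n x else 0)"
    proof (rule sum.cong)
      fix j :: 'm
      have "\<partial> N x (\<eta> x) \<bullet> \<partial> F x (e j x) = 0"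
        using flat[OF x, of "e j x" "\<eta> x"] by (simp add: sff_def inner_commute)
      then show "(\<partial> N x (\<eta> x) \<bullet> v x j) *\<^sub>R v x j = (if j = k then (\<partial> N x (\<eta> x) \<bullet> n x) *\<^sub>R n x else 0)"
        by (simp add: v_def)
    qed simp
    finally show ?thesis by simp
  qed
  define b where "b = \<partial> N q ?\<eta> \<bullet> n q"
  have b: "b \<noteq> 0"
    using dN[OF q] fold_normal_deriv[OF fold] unfolding b_def by auto
  have w1: "\<partial> (\<lambda>y. sff y X X) q ?\<eta> = - b * (n' X \<bullet> \<partial> F q X)"
    by (rule weingarten_identity(1)[where \<eta> = \<eta> and n = n, OF q X(1) flat \<eta> n dN b_def b])
  have w2: "\<partial> (\<lambda>y. sff y ?\<eta> ?\<eta>) q ?\<eta> = - b * (?w \<bullet> n q)"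
    by (rule weingarten_identity(2)[where \<eta> = \<eta> and n = n, OF q X(1) flat \<eta> n dN b_def b])
  have "\<forall>\<^sub>F t in at 0. 0 \<le> sectional_curvature metric (q + t *\<^sub>R ?\<eta>) X ?\<eta>"
    using K[OF FX] fold_regular_ray[OF fold] by eventually_elim simp
  note nonneg = fold_sff_deriv_nonneg[OF fold FX flat[OF q] this]
  have "0 \<le> (- b * (n' X \<bullet> \<partial> F q X)) * (- b * (?w \<bullet> n q))"
    unfolding w1[symmetric] w2[symmetric] by (rule nonneg)
  also have "\<dots> = b\<^sup>2 * ((n' X \<bullet> \<partial> F q X) * (?w \<bullet> n q))"
    by (simp add: power2_eq_square)
  finally have prod: "0 \<le> (n' X \<bullet> \<partial> F q X) * (?w \<bullet> n q)"
    using b mult_pos_neg[of "b\<^sup>2" "(n' X \<bullet> \<partial> F q X) * (?w \<bullet> n q)"] by force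
  define y where "y = n' X - (n' X \<bullet> N q) *\<^sub>R N q"
  have n1: "n x \<bullet> n x = 1" if "x \<in> singular_points" for x using vv[OF that, of k k] by (simp add: vk)
  have nN: "n q \<bullet> N q = 0" using vN[OF q, of k] by (simp add: vk)
  have "((\<lambda>x. n x \<bullet> n x - 1) has_derivative (\<lambda>u. n q \<bullet> n' u + n' u \<bullet> n q - 0)) (at q)"
    by (intro derivative_intros n)
  from vanish_on_singular[OF X(1) this q] have "n' X \<bullet> n q = 0"
    using n1 by (simp add: inner_commute)
  then have yn: "y \<bullet> n q = 0" using nN by (simp add: y_def inner_diff_left inner_commute[of "N q"])
  have yN: "y \<bullet> N q = 0" using N_unit[OF q\<Omega>] by (simp add: y_def inner_diff_left)
  (* The component of y along n = v k is zero, so y is the image of a combination of the e j, which are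
     tangent to the singular set. *)
  define Y where "Y = (\<Sum>j\<in>UNIV. (if j = k then 0 else y \<bullet> v q j) *\<^sub>R e j q)"
  have "y = (\<Sum>j\<in>UNIV. (y \<bullet> v q j) *\<^sub>R v q j)"
    by (rule orthonormal_frame_expansion[of _ "N q", OF _ vv[OF q] vN[OF q] yN]) (simp add: vol[OF q])
  also have "\<dots> = (\<Sum>j\<in>UNIV. (if j = k then 0 else y \<bullet> v q j) *\<^sub>R \<partial> F q (e j q))"
    by (rule sum.cong) (simp_all add: v_def yn)
  also have "\<dots> = \<partial> F q Y"
    unfolding Y_def by (simp add: linear_sum[OF linear_F[OF q\<Omega>]] linear_cmul[OF linear_F[OF q\<Omega>]])
  finally have yY: "y = \<partial> F q Y" .
  have term0: "(if j = k then 0 else y \<bullet> v q j) * \<partial> density q (e j q) = 0" for j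
    using tangent[OF e] by simp
  have "\<partial> density q Y = 0"
    unfolding Y_def linear_sum[OF lin_d] linear_cmul[OF lin_d] real_scaleR_def
    by (intro sum.neutral ballI) (rule term0)
  then have "Y \<in> velocities singular_points q"
    unfolding singular_points_def
    by (intro kernel_in_velocities[OF open_dom smooth_on_continuous[OF smooth_density] q\<Omega> ddens d0 _ transversal])
  then have "\<partial> F q (inv_into (velocities singular_points q) (\<partial> F q) y) = y"
    unfolding yY by (intro f_inv_into_f imageI)
  then have "- sgn (\<partial> density q ?\<eta>) *\<^sub>R y = c *\<^sub>R \<partial> F q X"
    using arg_cong[OF eig[folded y_def], of "\<partial> F q"]
    by (simp only: linear_cmul[OF linear_F[OF q\<Omega>]])
  then have "c * (\<partial> F q X \<bullet> \<partial> F q X) = - sgn (\<partial> density q ?\<eta>) * (y \<bullet> \<partial> F q X)"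
    by (simp only: inner_scaleR_left[symmetric])
  also have "y \<bullet> \<partial> F q X = n' X \<bullet> \<partial> F q X"
    using normal[OF q\<Omega>, of X] by (simp add: y_def inner_diff_left inner_commute[of "N q" "\<partial> F q X"])
  also have "- sgn (\<partial> density q ?\<eta>) * (n' X \<bullet> \<partial> F q X) \<le> 0"
  proof -
    have "- sgn r * p \<le> 0" if "0 \<le> p * r" for p r :: real
      using that by (cases r "0 :: real" rule: linorder_cases) (auto simp: zero_le_mult_iff)
    from this[OF prod] show ?thesis unfolding sgn_eq .
  qed
  finally have "c * (\<partial> F q X \<bullet> \<partial> F q X) \<le> 0" .
  moreover have "\<partial> F q X \<bullet> \<partial> F q X > 0" using FX by simp
  ultimately show ?thesis by (meson mult_pos_pos not_le)
qed

end

section \<open>Charts\<close>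

locale front_on_manifold =
  fixes \<A> :: "('a::topological_space, 'm::finite) chart set" and f :: "'a \<Rightarrow> real ^ ('m option)"
  assumes atlas: "smooth_atlas \<A>" and front: "wave_front \<A> f"
begin

lemma chart_homeomorphism:
  "\<kappa> \<in> \<A> \<Longrightarrow> homeomorphism (fst \<kappa>) (snd \<kappa> ` fst \<kappa>) (snd \<kappa>) (inv_into (fst \<kappa>) (snd \<kappa>))"
  and chart_open_domain: "\<kappa> \<in> \<A> \<Longrightarrow> open (fst \<kappa>)"
  and chart_open_range: "\<kappa> \<in> \<A> \<Longrightarrow> open (snd \<kappa> ` fst \<kappa>)"
  and transition_smooth: "\<kappa> \<in> \<A> \<Longrightarrow> \<kappa>' \<in> \<A> \<Longrightarrow>
    smooth_on (snd \<kappa> ` (fst \<kappa> \<inter> fst \<kappa>')) (local_rep \<kappa> (snd \<kappa>'))"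
  using atlas unfolding smooth_atlas_def by blast+

lemma chart_inverse: "\<kappa> \<in> \<A> \<Longrightarrow> p \<in> fst \<kappa> \<Longrightarrow> inv_into (fst \<kappa>) (snd \<kappa>) (snd \<kappa> p) = p"
  using chart_homeomorphism homeomorphism_apply1 by blast

lemma local_rep_chart: "\<kappa> \<in> \<A> \<Longrightarrow> p \<in> fst \<kappa> \<Longrightarrow> local_rep \<kappa> h (snd \<kappa> p) = h p"
  by (simp add: local_rep_def chart_inverse)

lemma chart_open_image:
  assumes "\<kappa> \<in> \<A>" "open W"
  shows "open (snd \<kappa> ` (W \<inter> fst \<kappa>))"
proof -
  have "openin (top_of_set (fst \<kappa>)) (W \<inter> fst \<kappa>)"
    using openin_open_Int[OF assms(2), of "fst \<kappa>"] by (simp add: Int_commute)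
  then have "openin (top_of_set (snd \<kappa> ` fst \<kappa>)) (snd \<kappa> ` (W \<inter> fst \<kappa>))"
    using homeomorphism_imp_open_map[OF chart_homeomorphism[OF assms(1)]] by blast
  then show ?thesis using chart_open_range[OF assms(1)] openin_open_trans by blast
qed

lemma smooth_f: "smooth_map \<A> (manifold \<A>) f"
  using front by (simp add: wave_front_def)

lemma smooth_map_subset: "smooth_map \<A> W h \<Longrightarrow> V \<subseteq> W \<Longrightarrow> smooth_map \<A> V h"
  unfolding smooth_map_def by (meson Int_mono image_mono order_refl smooth_on_subset)

lemma smooth_map_local_rep:
  "smooth_map \<A> W h \<Longrightarrow> \<kappa> \<in> \<A> \<Longrightarrow> smooth_on (snd \<kappa> ` (W \<inter> fst \<kappa>)) (local_rep \<kappa> h)"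
  by (simp add: smooth_map_def)

lemma smooth_map_differentiable:
  "smooth_map \<A> W h \<Longrightarrow> \<kappa> \<in> \<A> \<Longrightarrow> p \<in> W \<inter> fst \<kappa> \<Longrightarrow> local_rep \<kappa> h differentiable (at (snd \<kappa> p))"
  using smooth_on_differentiable[OF smooth_map_local_rep] by blast

lemma front_normal_subset:
  "front_normal \<A> f W \<nu> \<Longrightarrow> open V \<Longrightarrow> V \<subseteq> W \<Longrightarrow> front_normal \<A> f V \<nu>"
  unfolding front_normal_def using smooth_map_subset by (meson IntD1 IntD2 IntI subsetD subset_trans)

lemma tangent_space_velocities:
  "tangent_space \<kappa> S q = velocities (snd \<kappa> ` (S \<inter> fst \<kappa>)) (snd \<kappa> q)"
  by (simp add: tangent_space_def velocities_def)

text \<open>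
  In another chart, \<open>h\<close> is composed with the transition map, whose derivative is the derivative of the first coordinate map
  expressed in the second chart.
\<close>

lemma chart_change_of_derivative:
  assumes "\<kappa> \<in> \<A>" "\<kappa>' \<in> \<A>" "q \<in> fst \<kappa> \<inter> fst \<kappa>'" "local_rep \<kappa> h differentiable (at (snd \<kappa> q))"
  shows "tangent_map \<kappa>' h q X = tangent_map \<kappa> h q (tangent_map \<kappa>' (snd \<kappa>) q X)"
proof -
  let ?\<tau> = "local_rep \<kappa>' (snd \<kappa>)"
  let ?O = "snd \<kappa>' ` (fst \<kappa> \<inter> fst \<kappa>')"
  have O: "open ?O" "snd \<kappa>' q \<in> ?O"
    using chart_open_image[OF assms(2) chart_open_domain[OF assms(1)]] assms(3) by auto
  have \<tau>q: "?\<tau> (snd \<kappa>' q) = snd \<kappa> q" using assms(2,3) by (simp add: local_rep_chart)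
  have d\<tau>: "?\<tau> differentiable (at (snd \<kappa>' q))"
    using smooth_on_differentiable[OF transition_smooth[OF assms(2,1)]] O(2) by (simp add: Int_commute)
  have "((local_rep \<kappa> h \<circ> ?\<tau>) has_derivative (\<lambda>X. tangent_map \<kappa> h q (tangent_map \<kappa>' (snd \<kappa>) q X))) (at (snd \<kappa>' q))"
    using diff_chain_at[OF dir_deriv_works[OF d\<tau>] dir_deriv_works[of "local_rep \<kappa> h"]] assms(4)
    unfolding \<tau>q by (simp add: tangent_map_def o_def)
  moreover have "(local_rep \<kappa> h \<circ> ?\<tau>) y = local_rep \<kappa>' h y" if "y \<in> ?O" for y
    using that by (auto simp: local_rep_chart[OF assms(1)] local_rep_chart[OF assms(2)])
  ultimately have "(local_rep \<kappa>' h has_derivative (\<lambda>X. tangent_map \<kappa> h q (tangent_map \<kappa>' (snd \<kappa>) q X))) (at (snd \<kappa>' q))"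
    using has_derivative_transform_within_open O by blast
  then show ?thesis unfolding tangent_map_def by (rule dir_deriv_eq)
qed

lemma tangent_map_own_chart:
  assumes "\<kappa> \<in> \<A>" "q \<in> fst \<kappa>"
  shows "local_rep \<kappa> (snd \<kappa>) differentiable (at (snd \<kappa> q))" "tangent_map \<kappa> (snd \<kappa>) q X = X"
proof -
  have "(local_rep \<kappa> (snd \<kappa>) has_derivative (\<lambda>X. X)) (at (snd \<kappa> q))"
    by (rule has_derivative_transform_within_open[OF has_derivative_ident chart_open_range[OF assms(1)]])
      (use assms(2) in \<open>auto simp: local_rep_chart[OF assms(1)]\<close>)
  then show "local_rep \<kappa> (snd \<kappa>) differentiable (at (snd \<kappa> q))" "tangent_map \<kappa> (snd \<kappa>) q X = X"
    unfolding tangent_map_def differentiable_def by (auto intro: dir_deriv_eq)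
qed

lemma transition_derivative:
  assumes "\<kappa> \<in> \<A>" "\<kappa>' \<in> \<A>" "q \<in> fst \<kappa> \<inter> fst \<kappa>'"
  shows "linear (tangent_map \<kappa>' (snd \<kappa>) q)"
    and "tangent_map \<kappa>' (snd \<kappa>) q (tangent_map \<kappa> (snd \<kappa>') q Z) = Z"
proof -
  have d: "local_rep \<kappa>' (snd \<kappa>) differentiable (at (snd \<kappa>' q))"
    using smooth_on_differentiable[OF transition_smooth[OF assms(2,1)]] assms(3) by auto
  then show "linear (tangent_map \<kappa>' (snd \<kappa>) q)"
    unfolding tangent_map_def by (rule linear_dir_deriv)
  show "tangent_map \<kappa>' (snd \<kappa>) q (tangent_map \<kappa> (snd \<kappa>') q Z) = Z"
    using chart_change_of_derivative[OF assms(2,1) _ d, of Z] assms(3) tangent_map_own_chart(2)[OF assms(1), of q Z]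
    by auto
qed

lemma transition_derivative_inj:
  assumes "\<kappa> \<in> \<A>" "\<kappa>' \<in> \<A>" "q \<in> fst \<kappa> \<inter> fst \<kappa>'"
  shows "inj (tangent_map \<kappa>' (snd \<kappa>) q)"
  using transition_derivative(2)[OF assms(2,1)] assms(3) by (metis IntI IntD1 IntD2 injI)

lemma f_differentiable:
  "\<kappa> \<in> \<A> \<Longrightarrow> p \<in> fst \<kappa> \<Longrightarrow> local_rep \<kappa> f differentiable (at (snd \<kappa> p))"
  using smooth_map_differentiable[OF smooth_f] unfolding manifold_def by blast

lemma not_singular_iff:
  assumes "\<kappa> \<in> \<A>" "p \<in> fst \<kappa>"
  shows "p \<notin> singular_set \<A> f \<longleftrightarrow> inj (tangent_map \<kappa> f p)"
proof -
  have "p \<in> manifold \<A>" using assms by (auto simp: manifold_def)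
  moreover have "inj (tangent_map \<kappa>' f p)" if "inj (tangent_map \<kappa> f p)" "\<kappa>' \<in> \<A>" "p \<in> fst \<kappa>'" for \<kappa>'
  proof -
    have "tangent_map \<kappa>' f p = tangent_map \<kappa> f p \<circ> tangent_map \<kappa>' (snd \<kappa>) p"
      using chart_change_of_derivative[OF assms(1) that(2) _ f_differentiable[OF assms]] assms(2) that(3) by auto
    then show ?thesis
      using that(1) transition_derivative_inj[OF assms(1) that(2)] assms(2) that(3) by (simp add: inj_compose)
  qed
  ultimately show ?thesis using assms unfolding singular_set_def immersion_at_def by blast
qed

lemma local_front_chart:
  assumes "\<kappa> \<in> \<A>" "front_normal \<A> f W \<nu>"
  shows "local_front (snd \<kappa> ` (W \<inter> fst \<kappa>)) (local_rep \<kappa> f) (local_rep \<kappa> \<nu>)"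
proof
  note fn = assms(2)[unfolded front_normal_def]
  let ?O = "snd \<kappa> ` (W \<inter> fst \<kappa>)"
  show "open ?O" using chart_open_image[OF assms(1)] fn by blast
  show sF: "smooth_on ?O (local_rep \<kappa> f)"
    using smooth_map_local_rep[OF smooth_map_subset[OF smooth_f] assms(1)] fn by blast
  show sN: "smooth_on ?O (local_rep \<kappa> \<nu>)" using smooth_map_local_rep[OF _ assms(1)] fn by blast
  fix x assume x: "x \<in> ?O"
  then obtain p where p: "p \<in> W" "p \<in> fst \<kappa>" "x = snd \<kappa> p" by blast
  have pair: "local_rep \<kappa> (\<lambda>p. (f p, \<nu> p)) = (\<lambda>x. (local_rep \<kappa> f x, local_rep \<kappa> \<nu> x))"
    by (simp add: local_rep_def fun_eq_iff)
  show "norm (local_rep \<kappa> \<nu> x) = 1" using fn p by (simp add: local_rep_chart[OF assms(1)])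
  fix X
  show "\<partial> (local_rep \<kappa> f) x X \<bullet> local_rep \<kappa> \<nu> x = 0"
    using fn p assms(1) local_rep_chart[OF assms(1) p(2), of \<nu>] by (auto simp: tangent_map_def)
  assume 0: "\<partial> (local_rep \<kappa> f) x X = 0" "\<partial> (local_rep \<kappa> \<nu>) x X = 0"
  have "((\<lambda>x. (local_rep \<kappa> f x, local_rep \<kappa> \<nu> x)) has_derivative
      (\<lambda>X. (\<partial> (local_rep \<kappa> f) x X, \<partial> (local_rep \<kappa> \<nu>) x X))) (at x)"
    by (intro has_derivative_Pair smooth_on_has_derivative[OF sF x] smooth_on_has_derivative[OF sN x])
  then have eq: "tangent_map \<kappa> (\<lambda>p. (f p, \<nu> p)) p Y = (\<partial> (local_rep \<kappa> f) x Y, \<partial> (local_rep \<kappa> \<nu>) x Y)" for Y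
    unfolding tangent_map_def pair p(3)[symmetric] by (rule dir_deriv_eq)
  have "inj (tangent_map \<kappa> (\<lambda>p. (f p, \<nu> p)) p)"
    using fn p assms(1) unfolding immersion_at_def by blast
  moreover have "linear (\<partial> (local_rep \<kappa> f) x)" "linear (\<partial> (local_rep \<kappa> \<nu>) x)"
    using linear_dir_deriv smooth_on_differentiable sF sN x by blast+
  then have "tangent_map \<kappa> (\<lambda>p. (f p, \<nu> p)) p X = tangent_map \<kappa> (\<lambda>p. (f p, \<nu> p)) p 0"
    unfolding eq using 0 by (simp add: linear_0)
  ultimately show "X = 0" by (rule injD)
qed

lemma second_form_change_of_chart:
  assumes "\<kappa> \<in> \<A>" "\<kappa>' \<in> \<A>" "q \<in> fst \<kappa> \<inter> fst \<kappa>'" "smooth_map \<A> W \<nu>" "q \<in> W"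
  shows "second_form \<kappa>' f \<nu> q X Y = second_form \<kappa> f \<nu> q (tangent_map \<kappa>' (snd \<kappa>) q X) (tangent_map \<kappa>' (snd \<kappa>) q Y)"
  unfolding second_form_def
  using chart_change_of_derivative[OF assms(1-3) f_differentiable[OF assms(1)]]
    chart_change_of_derivative[OF assms(1-3) smooth_map_differentiable[OF assms(4,1)]] assms(3,5)
  by auto

end

text \<open>
  Through this locale the results on \<open>local_front\<close> apply, in a chart \<open>\<kappa>\<close>, to the front restricted to \<open>W\<close>.
\<close>

locale front_chart = front_on_manifold \<A> f
  for \<A> :: "('a::topological_space, 'm::finite) chart set" and f :: "'a \<Rightarrow> real ^ ('m option)" +
  fixes \<kappa> :: "('a, 'm) chart" and W :: "'a set" and \<nu> :: "'a \<Rightarrow> real ^ ('m option)"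
  assumes chart: "\<kappa> \<in> \<A>" and front_normal: "front_normal \<A> f W \<nu>"
begin

sublocale local_front "snd \<kappa> ` (W \<inter> fst \<kappa>)" "local_rep \<kappa> f" "local_rep \<kappa> \<nu>"
  by (rule local_front_chart[OF chart front_normal])

lemma metric_eq: "induced_metric \<kappa> f = metric"
  by (simp add: fun_eq_iff induced_metric_def metric_def)

lemma sff_eq: "second_form \<kappa> f \<nu> q X Y = sff (snd \<kappa> q) X Y"
  by (simp add: second_form_def sff_def tangent_map_def)

lemma regular_eq: "p \<in> fst \<kappa> \<Longrightarrow> regular (snd \<kappa> p) \<longleftrightarrow> p \<notin> singular_set \<A> f"
  using not_singular_iff[OF chart] by (simp add: regular_def tangent_map_def)

lemma signed_density_eq:
  assumes "p \<in> W \<inter> fst \<kappa>"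
  shows "signed_density \<kappa> f \<nu> p = density (snd \<kappa> p)"
  using assms local_rep_chart[OF chart, of p \<nu>]
  by (simp add: signed_density_def volume_form_def density_def frame_matrix_def tangent_map_def)

lemma tangent_map_signed_density:
  assumes "p \<in> W \<inter> fst \<kappa>"
  shows "tangent_map \<kappa> (signed_density \<kappa> f \<nu>) p X = \<partial> density (snd \<kappa> p) X"
  unfolding tangent_map_def
proof (rule dir_deriv_eq)
  have x: "snd \<kappa> p \<in> snd \<kappa> ` (W \<inter> fst \<kappa>)" using assms by blast
  show "(local_rep \<kappa> (signed_density \<kappa> f \<nu>) has_derivative (\<lambda>X. \<partial> density (snd \<kappa> p) X)) (at (snd \<kappa> p))"
    by (rule has_derivative_transform_within_open[OF smooth_on_has_derivative[OF smooth_density x] open_dom x])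
      (auto simp: signed_density_eq local_rep_chart[OF chart])
qed

lemma singular_points_eq: "singular_points = snd \<kappa> ` (singular_set \<A> f \<inter> fst \<kappa>) \<inter> snd \<kappa> ` (W \<inter> fst \<kappa>)"
proof -
  have "density (snd \<kappa> p) = 0 \<longleftrightarrow> p \<in> singular_set \<A> f" if "p \<in> W \<inter> fst \<kappa>" for p
    using regular_iff_density[of "snd \<kappa> p"] regular_eq[of p] that by blast
  moreover have "p = p'" if "p \<in> fst \<kappa>" "p' \<in> fst \<kappa>" "snd \<kappa> p = snd \<kappa> p'" for p p'
    using chart_inverse[OF chart] that by metis
  ultimately show ?thesis unfolding singular_points_def by blast
qed

lemma singular_pointsE:
  assumes "x \<in> singular_points"
  obtains p where "p \<in> W" "p \<in> fst \<kappa>" "p \<in> singular_set \<A> f" "x = snd \<kappa> p"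
  using assms regular_iff_density[of x] regular_eq unfolding singular_points_def by blast

lemma singular_pointsI:
  "p \<in> W \<inter> fst \<kappa> \<Longrightarrow> p \<in> singular_set \<A> f \<Longrightarrow> snd \<kappa> p \<in> singular_points"
  unfolding singular_points_eq by blast

lemma tangent_space_eq:
  assumes "p \<in> W \<inter> fst \<kappa>"
  shows "tangent_space \<kappa> (singular_set \<A> f) p = velocities singular_points (snd \<kappa> p)"
proof
  have "snd \<kappa> p \<in> snd \<kappa> ` (W \<inter> fst \<kappa>)" using assms by blast
  then show "tangent_space \<kappa> (singular_set \<A> f) p \<subseteq> velocities singular_points (snd \<kappa> p)"
    unfolding tangent_space_velocities singular_points_eq by (rule velocities_subset[OF open_dom])
  show "velocities singular_points (snd \<kappa> p) \<subseteq> tangent_space \<kappa> (singular_set \<A> f) p"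
    unfolding tangent_space_velocities singular_points_eq by (rule velocities_mono) blast
qed

text \<open>
  If \<open>d\<lambda>(\<eta>)\<close> were zero, then \<open>\<eta>\<close> would be tangent to the singular set, since this set has the kernel
  of \<open>d\<lambda> \<noteq> 0\<close> as its tangent space.
\<close>

lemma null_transversal:
  assumes "p \<in> W \<inter> fst \<kappa>" "p \<in> singular_set \<A> f" "nondegenerate \<kappa> f \<nu> p"
    "\<eta> \<notin> tangent_space \<kappa> (singular_set \<A> f) p"
  shows "\<partial> density (snd \<kappa> p) \<eta> \<noteq> 0"
proof
  assume 0: "\<partial> density (snd \<kappa> p) \<eta> = 0"
  obtain X where X: "\<partial> density (snd \<kappa> p) X \<noteq> 0"
    using assms(3) tangent_map_signed_density[OF assms(1)] unfolding nondegenerate_def by auto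
  have x: "snd \<kappa> p \<in> singular_points" using singular_pointsI[OF assms(1,2)] .
  then have x': "snd \<kappa> p \<in> snd \<kappa> ` (W \<inter> fst \<kappa>)" "density (snd \<kappa> p) = 0" by (auto simp: singular_points_def)
  have "\<eta> \<in> velocities singular_points (snd \<kappa> p)"
    unfolding singular_points_def
    by (rule kernel_in_velocities[OF open_dom smooth_on_continuous[OF smooth_density] x'(1)
          smooth_on_has_derivative[OF smooth_density x'(1)] x'(2) 0 X])
  then show False using assms(4) tangent_space_eq[OF assms(1)] by blast
qed

end

section \<open>Fronts with fold singularities\<close>

locale A2_front = front_on_manifold \<A> f
  for \<A> :: "('a::topological_space, 'm::finite) chart set" and f :: "'a \<Rightarrow> real ^ ('m option)" +
  fixes U :: "'a set"
  assumes U: "open U" "U \<subseteq> manifold \<A>"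
    and A2: "\<And>q. q \<in> U \<inter> singular_set \<A> f \<Longrightarrow> A2_singular_point \<A> f q"
begin

lemma front_chartI: "\<kappa> \<in> \<A> \<Longrightarrow> front_normal \<A> f W \<nu> \<Longrightarrow> front_chart \<A> f \<kappa> W \<nu>"
  by unfold_locales

text \<open>
  The definition of an \<open>A\<^sub>2\<close>-point provides one chart and one normal field. What is used of it is that
  \<open>d\<lambda>(\<eta>) \<noteq> 0\<close> there.
\<close>

lemma obtain_transversal_chart:
  assumes "q \<in> U \<inter> singular_set \<A> f"
  obtains \<kappa> W \<nu> \<eta> where "\<kappa> \<in> \<A>" "front_normal \<A> f W \<nu>" "W \<subseteq> U" "q \<in> W \<inter> fst \<kappa>"
    "\<eta> \<noteq> 0" "\<partial> (local_rep \<kappa> f) (snd \<kappa> q) \<eta> = 0"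
    "\<partial> (local_front.density (local_rep \<kappa> f) (local_rep \<kappa> \<nu>)) (snd \<kappa> q) \<eta> \<noteq> 0"
proof -
  obtain \<kappa> W \<nu> \<eta> where a: "\<kappa> \<in> \<A>" "q \<in> W \<inter> fst \<kappa>" "front_normal \<A> f W \<nu>" "nondegenerate \<kappa> f \<nu> q"
    "null_vector \<kappa> f q \<eta>" "\<eta> \<notin> tangent_space \<kappa> (singular_set \<A> f) q"
    using A2[OF assms] unfolding A2_singular_point_def by blast
  interpret front_chart \<A> f \<kappa> W \<nu> by (rule front_chartI[OF a(1,3)])
  have "open (W \<inter> U)" using a(3) U(1) by (auto simp: front_normal_def)
  then have "front_normal \<A> f (W \<inter> U) \<nu>" by (rule front_normal_subset[OF a(3)]) simp
  then show ?thesis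
    using that[of \<kappa> "W \<inter> U" \<nu> \<eta>] a assms null_transversal[OF a(2) _ a(4,6)]
    by (auto simp: null_vector_def tangent_map_def)
qed

lemma curvature_value_on_ray:
  assumes "\<kappa> \<in> \<A>" "front_normal \<A> f W \<nu>" "W \<subseteq> U" "q \<in> W \<inter> fst \<kappa>" "\<eta> \<noteq> 0"
    "\<partial> (local_rep \<kappa> f) (snd \<kappa> q) \<eta> = 0" "\<partial> (local_rep \<kappa> f) (snd \<kappa> q) X \<noteq> 0"
  shows "\<forall>\<^sub>F t in at 0. local_front.regular (local_rep \<kappa> f) (snd \<kappa> q + t *\<^sub>R \<eta>) \<longrightarrow>
    sectional_curvature (induced_metric \<kappa> f) (snd \<kappa> q + t *\<^sub>R \<eta>) X \<eta> \<in> curvature_values \<A> f (U - singular_set \<A> f)"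
proof -
  interpret front_chart \<A> f \<kappa> W \<nu> by (rule front_chartI[OF assms(1,2)])
  have x: "snd \<kappa> q \<in> snd \<kappa> ` (W \<inter> fst \<kappa>)" using assms(4) by blast
  have "X \<noteq> \<eta>" using assms(6,7) by auto
  have "X \<notin> span {\<eta>}"
    using assms(6,7) linear_cmul[OF linear_F[OF x]] by (auto simp: span_singleton)
  then have "independent {X, \<eta>}"
    using assms(5) by (simp add: independent_insert)
  note XY = \<open>X \<noteq> \<eta>\<close> this
  show ?thesis
    using ray_in_dom[OF x, of \<eta>]
  proof (eventually_elim, intro impI)
    fix t assume elim: "snd \<kappa> q + t *\<^sub>R \<eta> \<in> snd \<kappa> ` (W \<inter> fst \<kappa>)"
      and reg: "regular (snd \<kappa> q + t *\<^sub>R \<eta>)"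
    then obtain p where p: "p \<in> W" "p \<in> fst \<kappa>" "snd \<kappa> q + t *\<^sub>R \<eta> = snd \<kappa> p" by blast
    have "p \<in> (U - singular_set \<A> f) \<inter> fst \<kappa>"
      using reg regular_eq[OF p(2)] p assms(3) by auto
    then show "sectional_curvature (induced_metric \<kappa> f) (snd \<kappa> q + t *\<^sub>R \<eta>) X \<eta> \<in> curvature_values \<A> f (U - singular_set \<A> f)"
      unfolding p(3) curvature_values_def using assms(1) XY by blast
  qed
qed

text \<open>
  The given chart and normal field need not be those of the \<open>A\<^sub>2\<close>-point. The normal field is exchanged first,
  by \<open>fold_at_change_normal\<close> in the chart of the \<open>A\<^sub>2\<close>-point; afterwards the second form is transformed to
  the given chart as a tensor.
\<close>

lemma second_form_vanishes:
  assumes K: "(\<exists>C. \<forall>K\<in>curvature_values \<A> f (U - singular_set \<A> f). \<bar>K\<bar> \<le> C) \<or>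
      (\<forall>K\<in>curvature_values \<A> f (U - singular_set \<A> f). 0 \<le> K)"
    and q: "q \<in> U \<inter> singular_set \<A> f" "\<kappa> \<in> \<A>" "q \<in> W \<inter> fst \<kappa>" "front_normal \<A> f W \<nu>"
  shows "second_form \<kappa> f \<nu> q X Y = 0"
proof -
  obtain \<kappa>0 W0 \<nu>0 \<eta> where a: "\<kappa>0 \<in> \<A>" "front_normal \<A> f W0 \<nu>0" "W0 \<subseteq> U" "q \<in> W0 \<inter> fst \<kappa>0"
    "\<eta> \<noteq> 0" "\<partial> (local_rep \<kappa>0 f) (snd \<kappa>0 q) \<eta> = 0"
    "\<partial> (local_front.density (local_rep \<kappa>0 f) (local_rep \<kappa>0 \<nu>0)) (snd \<kappa>0 q) \<eta> \<noteq> 0"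
    using obtain_transversal_chart[OF q(1)] by metis
  interpret c0: front_chart \<A> f \<kappa>0 W0 \<nu>0 by (rule front_chartI[OF a(1,2)])
  have "open (W \<inter> U)" using q(4) U(1) by (auto simp: front_normal_def)
  then have fn: "front_normal \<A> f (W \<inter> U) \<nu>" by (rule front_normal_subset[OF q(4)]) simp
  (* The normal field is restricted to U, so that the points of the ray lie in U. *)
  interpret c: front_chart \<A> f \<kappa>0 "W \<inter> U" \<nu> by (rule front_chartI[OF a(1) fn])
  let ?x = "snd \<kappa>0 q"
  have x0: "?x \<in> snd \<kappa>0 ` (W0 \<inter> fst \<kappa>0)" using a(4) by blast
  have qW: "q \<in> (W \<inter> U) \<inter> fst \<kappa>0" using q a(4) by blast
  then have x: "?x \<in> snd \<kappa>0 ` ((W \<inter> U) \<inter> fst \<kappa>0)" by blast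
  have fold: "c.fold_at ?x \<eta>"
    by (rule fold_at_change_normal[OF c0.local_front_axioms c.local_front_axioms
          c0.transversal_imp_fold[OF x0 a(5,6,7)] x])
  have on_ray: "\<forall>\<^sub>F t in at 0. sectional_curvature c.metric (?x + t *\<^sub>R \<eta>) Z \<eta> \<in> curvature_values \<A> f (U - singular_set \<A> f)"
    if "\<partial> (local_rep \<kappa>0 f) ?x Z \<noteq> 0" for Z
    using curvature_value_on_ray[OF a(1) fn _ qW a(5,6) that] c.fold_regular_ray[OF fold]
    unfolding c.metric_eq[symmetric] by (auto elim: eventually_elim2)
  have "c.sff ?x Z Z' = 0" for Z Z'
    using K
  proof
    assume "\<exists>C. \<forall>K\<in>curvature_values \<A> f (U - singular_set \<A> f). \<bar>K\<bar> \<le> C"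
    then obtain C where C: "\<forall>K\<in>curvature_values \<A> f (U - singular_set \<A> f). \<bar>K\<bar> \<le> C" ..
    show ?thesis
    proof (rule c.fold_sff_eq_0_if_bounded[OF fold])
      show "\<forall>\<^sub>F t in at 0. \<bar>sectional_curvature c.metric (?x + t *\<^sub>R \<eta>) Y \<eta>\<bar> \<le> C"
        if "\<partial> (local_rep \<kappa>0 f) ?x Y \<noteq> 0" for Y
        using on_ray[OF that] by eventually_elim (use C in blast)
    qed
  next
    assume K: "\<forall>K\<in>curvature_values \<A> f (U - singular_set \<A> f). 0 \<le> K"
    show ?thesis
    proof (rule c.fold_sff_eq_0_if_nonneg[OF fold])
      show "\<forall>\<^sub>F t in at 0. 0 \<le> sectional_curvature c.metric (?x + t *\<^sub>R \<eta>) Y \<eta>"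
        if "\<partial> (local_rep \<kappa>0 f) ?x Y \<noteq> 0" for Y
        using on_ray[OF that] by eventually_elim (use K in blast)
    qed
  qed
  then have "second_form \<kappa>0 f \<nu> q Z Z' = 0" for Z Z' by (simp add: c.sff_eq)
  then show ?thesis
    using second_form_change_of_chart[OF a(1) q(2), of q W \<nu>] a(4) q(3,4) by (auto simp: front_normal_def)
qed

lemma sectional_curvature_change_of_chart:
  assumes "\<kappa> \<in> \<A>" "\<kappa>' \<in> \<A>" "p \<in> fst \<kappa> \<inter> fst \<kappa>'" "front_normal \<A> f W \<nu>" "p \<in> W" "p \<notin> singular_set \<A> f"
  shows "sectional_curvature (induced_metric \<kappa>' f) (snd \<kappa>' p) X Y =
    sectional_curvature (induced_metric \<kappa> f) (snd \<kappa> p) (tangent_map \<kappa>' (snd \<kappa>) p X) (tangent_map \<kappa>' (snd \<kappa>) p Y)"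
proof -
  interpret c: front_chart \<A> f \<kappa> W \<nu> by (rule front_chartI[OF assms(1,4)])
  interpret c': front_chart \<A> f \<kappa>' W \<nu> by (rule front_chartI[OF assms(2,4)])
  have x: "snd \<kappa> p \<in> snd \<kappa> ` (W \<inter> fst \<kappa>)" "snd \<kappa>' p \<in> snd \<kappa>' ` (W \<inter> fst \<kappa>')" using assms(3,5) by blast+
  have r: "c.regular (snd \<kappa> p)" "c'.regular (snd \<kappa>' p)"
    using c.regular_eq c'.regular_eq assms(3,6) by blast+
  have sff: "c'.sff (snd \<kappa>' p) X Y = c.sff (snd \<kappa> p) (tangent_map \<kappa>' (snd \<kappa>) p X) (tangent_map \<kappa>' (snd \<kappa>) p Y)" for X Y
    using second_form_change_of_chart[OF assms(1-3), of W \<nu>] assms(4,5)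
    by (auto simp: front_normal_def c.sff_eq c'.sff_eq)
  have "p \<in> fst \<kappa>" using assms(3) by blast
  then have metric: "c'.metric (snd \<kappa>' p) X Y = c.metric (snd \<kappa> p) (tangent_map \<kappa>' (snd \<kappa>) p X) (tangent_map \<kappa>' (snd \<kappa>) p Y)" for X Y
    using chart_change_of_derivative[OF assms(1-3) f_differentiable[OF assms(1)]]
    by (simp add: c.metric_def c'.metric_def tangent_map_def)
  show ?thesis
    unfolding c.metric_eq c'.metric_eq c.sectional_curvature_eq[OF x(1) r(1)] c'.sectional_curvature_eq[OF x(2) r(2)]
    by (simp add: sff metric)
qed

text \<open>
  The bound holds for all charts of the atlas at once. The curvature is computed in one chart around \<open>q\<close>, and the
  Gauss equation shows that it does not depend on the chart.
\<close>

lemma curvature_locally_bounded: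
  assumes K: "\<forall>K\<in>curvature_values \<A> f (U - singular_set \<A> f). 0 \<le> K" and q: "q \<in> U"
  shows "\<exists>V C. open V \<and> q \<in> V \<and> (\<forall>K\<in>curvature_values \<A> f (V - singular_set \<A> f). \<bar>K\<bar> \<le> C)"
proof -
  obtain \<kappa> W \<nu> where a: "\<kappa> \<in> \<A>" "front_normal \<A> f W \<nu>" "q \<in> W \<inter> fst \<kappa>"
    "local_front.curvature_bounded_near (local_rep \<kappa> f) (snd \<kappa> q)"
  proof (cases "q \<in> singular_set \<A> f")
    case True
    then have qS: "q \<in> U \<inter> singular_set \<A> f" using q by blast
    obtain \<kappa> W \<nu> \<eta> where a: "\<kappa> \<in> \<A>" "front_normal \<A> f W \<nu>" "W \<subseteq> U" "q \<in> W \<inter> fst \<kappa>"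
      "\<eta> \<noteq> 0" "\<partial> (local_rep \<kappa> f) (snd \<kappa> q) \<eta> = 0"
      "\<partial> (local_front.density (local_rep \<kappa> f) (local_rep \<kappa> \<nu>)) (snd \<kappa> q) \<eta> \<noteq> 0"
      using obtain_transversal_chart[OF qS] by metis
    interpret c: front_chart \<A> f \<kappa> W \<nu> by (rule front_chartI[OF a(1,2)])
    have x: "snd \<kappa> q \<in> snd \<kappa> ` (W \<inter> fst \<kappa>)" using a(4) by blast
    have "c.sff x X Y = 0" if "x \<in> snd \<kappa> ` (W \<inter> fst \<kappa>)" "c.density x = 0" for x X Y
    proof -
      have "x \<in> c.singular_points" using that by (simp add: c.singular_points_def)
      then obtain p where "p \<in> W" "p \<in> fst \<kappa>" "p \<in> singular_set \<A> f" "x = snd \<kappa> p"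
        by (rule c.singular_pointsE)
      then show ?thesis
        using second_form_vanishes[of p \<kappa> W \<nu> X Y] K a(1-3) by (auto simp: c.sff_eq)
    qed
    then show ?thesis
      using that[OF a(1,2,4)] c.curvature_bounded_near_transversal[OF x a(5-7)] by blast
  next
    case False
    obtain \<kappa> where \<kappa>: "\<kappa> \<in> \<A>" "q \<in> fst \<kappa>" using q U(2) by (auto simp: manifold_def)
    obtain W \<nu> where W: "q \<in> W" "front_normal \<A> f W \<nu>"
      using front q U(2) unfolding wave_front_def by blast
    interpret c: front_chart \<A> f \<kappa> W \<nu> by (rule front_chartI[OF \<kappa>(1) W(2)])
    have "c.curvature_bounded_near (snd \<kappa> q)"
      using False c.regular_eq[OF \<kappa>(2)] \<kappa>(2) W(1) by (intro c.curvature_bounded_near_regular) blast+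
    then show ?thesis using that[OF \<kappa>(1) W(2)] \<kappa>(2) W(1) by blast
  qed
  interpret c: front_chart \<A> f \<kappa> W \<nu> by (rule front_chartI[OF a(1,2)])
  obtain C where "\<forall>\<^sub>F x in nhds (snd \<kappa> q). c.regular x \<longrightarrow>
     (\<forall>X Y. X \<noteq> Y \<longrightarrow> independent {X, Y} \<longrightarrow> \<bar>sectional_curvature c.metric x X Y\<bar> \<le> C)"
    using a(4) unfolding c.curvature_bounded_near_def by blast
  then obtain T where T: "open T" "snd \<kappa> q \<in> T"
    "\<And>x X Y. x \<in> T \<Longrightarrow> c.regular x \<Longrightarrow> X \<noteq> Y \<Longrightarrow> independent {X, Y} \<Longrightarrow> \<bar>sectional_curvature c.metric x X Y\<bar> \<le> C"
    unfolding eventually_nhds by blast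
  define V where "V = W \<inter> (fst \<kappa> \<inter> snd \<kappa> -` T)"
  have "open (fst \<kappa> \<inter> snd \<kappa> -` T)"
    using chart_homeomorphism[OF a(1)] chart_open_domain[OF a(1)] T(1)
    by (intro continuous_open_preimage) (auto simp: homeomorphism_def)
  then have "open V" using a(2) by (auto simp: V_def front_normal_def)
  moreover have "q \<in> V" using a(3) T(2) by (simp add: V_def)
  moreover have "\<bar>k\<bar> \<le> C" if "k \<in> curvature_values \<A> f (V - singular_set \<A> f)" for k
  proof -
    obtain \<kappa>' p X Y where b: "k = sectional_curvature (induced_metric \<kappa>' f) (snd \<kappa>' p) X Y"
      "\<kappa>' \<in> \<A>" "p \<in> V" "p \<notin> singular_set \<A> f" "p \<in> fst \<kappa>'" "X \<noteq> Y" "independent {X, Y}"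
      using \<open>k \<in> _\<close> unfolding curvature_values_def by blast
    let ?T = "tangent_map \<kappa>' (snd \<kappa>) p"
    have p: "p \<in> fst \<kappa> \<inter> fst \<kappa>'" "p \<in> W" "snd \<kappa> p \<in> T" using b(3,5) by (auto simp: V_def)
    have "inj ?T" by (rule transition_derivative_inj[OF a(1) b(2) p(1)])
    then have "?T X \<noteq> ?T Y" using b(6) by (auto dest: injD)
    moreover have "independent (?T ` {X, Y})"
      by (rule linear_independent_injective_image[OF transition_derivative(1)[OF a(1) b(2) p(1)] b(7)])
        (rule inj_on_subset[OF \<open>inj ?T\<close> subset_UNIV])
    moreover have "c.regular (snd \<kappa> p)" using c.regular_eq b(4) p(1) by blast
    ultimately show ?thesis
      using T(3)[OF p(3), of "?T X" "?T Y"]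
        sectional_curvature_change_of_chart[OF a(1) b(2) p(1) a(2) p(2) b(4), of X Y]
      by (simp add: b(1) c.metric_eq)
  qed
  ultimately show ?thesis by blast
qed

lemma curvature_bounded_on_compact:
  assumes K: "\<forall>K\<in>curvature_values \<A> f (U - singular_set \<A> f). 0 \<le> K" and C: "compact C" "C \<subseteq> U"
  shows "bounded (curvature_values \<A> f (C - singular_set \<A> f))"
proof -
  obtain V B where VB: "\<And>q. q \<in> U \<Longrightarrow> open (V q)" "\<And>q. q \<in> U \<Longrightarrow> q \<in> V q"
    "\<And>q. q \<in> U \<Longrightarrow> \<forall>K\<in>curvature_values \<A> f (V q - singular_set \<A> f). \<bar>K\<bar> \<le> B q"
    using curvature_locally_bounded[OF K] by metis
  obtain D where D: "D \<subseteq> C" "finite D" "C \<subseteq> (\<Union>q\<in>D. V q)"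
  proof (rule compactE_image[OF C(1), of C V])
    show "open (V q)" if "q \<in> C" for q using that VB(1) C(2) by blast
    show "C \<subseteq> (\<Union>q\<in>C. V q)" using VB(2) C(2) by blast
  qed
  have "curvature_values \<A> f (C - singular_set \<A> f) \<subseteq> (\<Union>q\<in>D. curvature_values \<A> f (V q - singular_set \<A> f))"
  proof
    fix k assume "k \<in> curvature_values \<A> f (C - singular_set \<A> f)"
    then obtain \<kappa> p X Y where k: "k = sectional_curvature (induced_metric \<kappa> f) (snd \<kappa> p) X Y" "\<kappa> \<in> \<A>"
      "p \<in> C" "p \<notin> singular_set \<A> f" "p \<in> fst \<kappa>" "X \<noteq> Y" "independent {X, Y}"
      unfolding curvature_values_def by blast
    obtain q where q: "q \<in> D" "p \<in> V q" using D(3) k(3) by blast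
    then have "p \<in> (V q - singular_set \<A> f) \<inter> fst \<kappa>" using k by blast
    then have "k \<in> curvature_values \<A> f (V q - singular_set \<A> f)"
      unfolding curvature_values_def using k(1,2,6,7) by blast
    then show "k \<in> (\<Union>q\<in>D. curvature_values \<A> f (V q - singular_set \<A> f))" using q(1) by blast
  qed
  moreover have "bounded (\<Union>q\<in>D. curvature_values \<A> f (V q - singular_set \<A> f))"
  proof (intro bounded_UN ballI)
    show "finite D" by (rule D(2))
    fix q assume "q \<in> D"
    then have "q \<in> U" using D(1) C(2) by blast
    from VB(3)[OF this] show "bounded (curvature_values \<A> f (V q - singular_set \<A> f))"
      by (auto simp: bounded_iff)
  qed
  ultimately show ?thesis using bounded_subset by blast
qed

lemma singular_principal_curvature_nonpos:
  assumes K: "\<forall>K\<in>curvature_values \<A> f (U - singular_set \<A> f). 0 \<le> K"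
    and q: "q \<in> U \<inter> singular_set \<A> f" "singular_principal_curvature \<A> f q c"
  shows "c \<le> 0"
proof -
  obtain \<kappa> W \<nu> k e \<eta> n X where a: "\<kappa> \<in> \<A>" "q \<in> W" "W \<subseteq> fst \<kappa>" "front_normal \<A> f W \<nu>"
    "adapted_frame \<A> \<kappa> f W \<nu> k e \<eta> n" "X \<in> tangent_space \<kappa> (singular_set \<A> f) q" "X \<noteq> 0"
    "singular_shape_operator \<A> \<kappa> f \<nu> \<eta> n q X = c *\<^sub>R X"
    using q(2) unfolding singular_principal_curvature_def by blast
  have "open (W \<inter> U)" using a(4) U(1) by (auto simp: front_normal_def)
  then have fn: "front_normal \<A> f (W \<inter> U) \<nu>" by (rule front_normal_subset[OF a(4)]) simp
  interpret front_chart \<A> f \<kappa> "W \<inter> U" \<nu> by (rule front_chartI[OF a(1) fn])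
  let ?x = "snd \<kappa> q"
  have qW: "q \<in> (W \<inter> U) \<inter> fst \<kappa>" using a(2,3) q(1) by blast
  have x: "?x \<in> singular_points" by (rule singular_pointsI[OF qW]) (use q(1) in blast)
  note af = a(5)[unfolded adapted_frame_def Let_def]
  have frame: "null_vector \<kappa> f p (\<eta> p)" "i \<noteq> k \<Longrightarrow> e i p \<in> tangent_space \<kappa> (singular_set \<A> f) p"
    "det (\<chi> i. if i = k then \<eta> p else e i p) > 0"
    "(if i = k then n p else tangent_map \<kappa> f p (e i p)) \<bullet> \<nu> p = 0"
    "(if i = k then n p else tangent_map \<kappa> f p (e i p)) \<bullet> (if j = k then n p else tangent_map \<kappa> f p (e j p)) = (if i = j then 1 else 0)"
    "volume_form \<nu> p (\<lambda>i. if i = k then n p else tangent_map \<kappa> f p (e i p)) = 1"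
    if "p \<in> W" "p \<in> singular_set \<A> f" for p i j
    using af that by blast+
  (* Two instances of one rule, because a fact inside a proof is monomorphic. *)
  have lr: "local_rep \<kappa> h (snd \<kappa> p) = h p" if "p \<in> W" for h :: "'a \<Rightarrow> real ^ 'm" and p
    by (rule local_rep_chart[OF a(1)]) (use that a(3) in blast)
  have lr': "local_rep \<kappa> h (snd \<kappa> p) = h p" if "p \<in> W" for h :: "'a \<Rightarrow> real ^ ('m option)" and p
    by (rule local_rep_chart[OF a(1)]) (use that a(3) in blast)
  have d\<eta>: "local_rep \<kappa> \<eta> differentiable (at ?x)" and dn: "local_rep \<kappa> n differentiable (at ?x)"
    using smooth_map_differentiable[OF _ a(1), of W] af a(2,3) by blast+
  have nulls: "\<partial> (local_rep \<kappa> f) y (local_rep \<kappa> \<eta> y) = 0" if "y \<in> singular_points" for y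
    using that by (elim singular_pointsE) (use frame(1) lr in \<open>auto simp: null_vector_def tangent_map_def\<close>)
  have \<eta>0: "\<eta> q \<noteq> 0" using frame(1) a(2) q(1) by (auto simp: null_vector_def)
  show ?thesis
  proof (rule principal_curvature_nonpos[where q = ?x and X = X and \<eta> = "local_rep \<kappa> \<eta>" and n = "local_rep \<kappa> n"
        and e = "\<lambda>i. local_rep \<kappa> (e i)" and k = k])
    show "?x \<in> singular_points" by (rule x)
    show "X \<in> velocities singular_points ?x" using a(6) tangent_space_eq[OF qW] by blast
    show "X \<noteq> 0" by (rule a(7))
    show "sff y Z Z' = 0" if "y \<in> singular_points" for y Z Z'
      using that by (elim singular_pointsE)
        (use second_form_vanishes[OF disjI2[OF K] _ a(1) _ fn] in \<open>auto simp: sff_eq\<close>)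
    show "(local_rep \<kappa> \<eta> has_derivative (\<lambda>u. \<partial> (local_rep \<kappa> \<eta>) ?x u)) (at ?x)"
      by (rule dir_deriv_works[OF d\<eta>])
    show "(local_rep \<kappa> n has_derivative (\<lambda>u. \<partial> (local_rep \<kappa> n) ?x u)) (at ?x)"
      by (rule dir_deriv_works[OF dn])
    show "\<partial> (local_rep \<kappa> f) y (local_rep \<kappa> \<eta> y) = 0" if "y \<in> singular_points" for y
      by (rule nulls[OF that])
    show "local_rep \<kappa> (e i) ?x \<in> velocities singular_points ?x" if "i \<noteq> k" for i
      using frame(2)[OF a(2) _ that] q(1) tangent_space_eq[OF qW] lr[OF a(2)] by auto
    show "0 < det (\<chi> i. if i = k then local_rep \<kappa> \<eta> ?x else local_rep \<kappa> (e i) ?x)"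
      using frame(3)[OF a(2)] q(1) unfolding lr[OF a(2)] by blast
    show "(if i = k then local_rep \<kappa> n y else \<partial> (local_rep \<kappa> f) y (local_rep \<kappa> (e i) y)) \<bullet> local_rep \<kappa> \<nu> y = 0"
      if "y \<in> singular_points" for y i
      using that by (elim singular_pointsE) (use frame(4)[of _ i] lr lr' in \<open>auto simp: tangent_map_def\<close>)
    show "(if i = k then local_rep \<kappa> n y else \<partial> (local_rep \<kappa> f) y (local_rep \<kappa> (e i) y)) \<bullet>
        (if j = k then local_rep \<kappa> n y else \<partial> (local_rep \<kappa> f) y (local_rep \<kappa> (e j) y)) = (if i = j then 1 else 0)"
      if "y \<in> singular_points" for y i j
    proof -
      from that obtain p where "p \<in> W \<inter> U" and p': "p \<in> fst \<kappa>" "p \<in> singular_set \<A> f" "y = snd \<kappa> p"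
        by (rule singular_pointsE)
      then have p: "p \<in> W" "p \<in> singular_set \<A> f" "y = snd \<kappa> p" by blast+
      show ?thesis using frame(5)[OF p(1,2), of i j] unfolding p(3) lr[OF p(1)] lr'[OF p(1)] tangent_map_def .
    qed
    show "det (frame_matrix (\<lambda>i. if i = k then local_rep \<kappa> n y else \<partial> (local_rep \<kappa> f) y (local_rep \<kappa> (e i) y)) (local_rep \<kappa> \<nu> y)) = 1"
      if "y \<in> singular_points" for y
    proof -
      from that obtain p where "p \<in> W \<inter> U" and p': "p \<in> fst \<kappa>" "p \<in> singular_set \<A> f" "y = snd \<kappa> p"
        by (rule singular_pointsE)
      then have p: "p \<in> W" "p \<in> singular_set \<A> f" "y = snd \<kappa> p" by blast+
      show ?thesis
        using frame(6)[OF p(1,2)] unfolding p(3) lr[OF p(1)] lr'[OF p(1)] tangent_map_def volume_form_def frame_matrix_def .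
    qed
    show "\<forall>\<^sub>F t in at 0. regular (?x + t *\<^sub>R local_rep \<kappa> \<eta> ?x) \<longrightarrow>
        0 \<le> sectional_curvature metric (?x + t *\<^sub>R local_rep \<kappa> \<eta> ?x) Z (local_rep \<kappa> \<eta> ?x)"
      if "\<partial> (local_rep \<kappa> f) ?x Z \<noteq> 0" for Z
      using curvature_value_on_ray[OF a(1) fn _ qW \<eta>0 _ that] nulls[OF x] K
      unfolding metric_eq lr[OF a(2)] by (auto elim!: eventually_mono)
    show "- sgn (\<partial> density ?x (local_rep \<kappa> \<eta> ?x)) *\<^sub>R
        inv_into (velocities singular_points ?x) (\<partial> (local_rep \<kappa> f) ?x)
          (\<partial> (local_rep \<kappa> n) ?x X - (\<partial> (local_rep \<kappa> n) ?x X \<bullet> local_rep \<kappa> \<nu> ?x) *\<^sub>R local_rep \<kappa> \<nu> ?x) = c *\<^sub>R X"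
      using a(8)
      unfolding singular_shape_operator_def cov_deriv_def tangent_map_signed_density[OF qW] tangent_space_eq[OF qW]
        lr[OF a(2)] lr'[OF a(2)] tangent_map_def[of \<kappa> f] tangent_map_def[of \<kappa> n] .
  qed
qed

end

theorem theorem0p1:
  fixes \<A> :: "('a::{second_countable_topology, t2_space}, 'm::finite) chart set"
    and f :: "'a \<Rightarrow> real ^ ('m option)"
    and U :: "'a set"
  assumes "smooth_atlas \<A>"
    and "wave_front \<A> f"
    and "open U" and "U \<subseteq> manifold \<A>"
    and "\<forall>q \<in> U \<inter> singular_set \<A> f. A2_singular_point \<A> f q"
  shows "(bounded (curvature_values \<A> f (U - singular_set \<A> f)) \<longrightarrow>
           (\<forall>q \<in> singular_set \<A> f \<inter> U. \<forall>\<kappa>\<in>\<A>. \<forall>W \<nu>. q \<in> W \<inter> fst \<kappa> \<and> front_normal \<A> f W \<nu> \<longrightarrow>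
              (\<forall>X Y. second_form \<kappa> f \<nu> q X Y = 0))) \<and>
         ((\<forall>K \<in> curvature_values \<A> f (U - singular_set \<A> f). 0 \<le> K) \<longrightarrow>
           (\<forall>C. compact C \<and> C \<subseteq> U \<longrightarrow> bounded (curvature_values \<A> f (C - singular_set \<A> f))) \<and>
           (\<forall>q \<in> U \<inter> singular_set \<A> f. \<forall>c. singular_principal_curvature \<A> f q c \<longrightarrow> c \<le> 0))"
proof -
  interpret A2_front \<A> f U
    using assms by unfold_locales auto
  show ?thesis
  proof (intro conjI impI allI ballI)
    fix q \<kappa> W \<nu> X Y
    assume "bounded (curvature_values \<A> f (U - singular_set \<A> f))" "q \<in> singular_set \<A> f \<inter> U" "\<kappa> \<in> \<A>"
      "q \<in> W \<inter> fst \<kappa> \<and> front_normal \<A> f W \<nu>"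
    then show "second_form \<kappa> f \<nu> q X Y = 0"
      by (intro second_form_vanishes[of q \<kappa> W \<nu> X Y]) (auto simp: bounded_iff)
  next
    fix C assume "\<forall>K \<in> curvature_values \<A> f (U - singular_set \<A> f). 0 \<le> K" "compact C \<and> C \<subseteq> U"
    then show "bounded (curvature_values \<A> f (C - singular_set \<A> f))"
      using curvature_bounded_on_compact by blast
  next
    fix q c assume "\<forall>K \<in> curvature_values \<A> f (U - singular_set \<A> f). 0 \<le> K" "q \<in> U \<inter> singular_set \<A> f"
      "singular_principal_curvature \<A> f q c"
    then show "c \<le> 0" using singular_principal_curvature_nonpos by blast
  qed
qed

end
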